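(* Let $P:\mathbb{R}\to\mathbb{R}$ be a polynomial without constant term whose degree is greater than one. There exists $s_0>0$, depending only on $P$, such that the following holds. For every $\beta\in(1-s_0,1)$ and all positive real numbers $C_1,C_2,B$, there exists $\alpha_0\in(0,1)$ such that: if $\alpha_0<\alpha<1$ and $E\subset[0,1]$ is a closed set that supports a probability measure $\mu$ satisfying $$\text{(A)}\quad \mu([x,x+\epsilon])\le C_1\epsilon^{\alpha}\ \text{ for all } x \text{ and all } 0<\epsilon\le 1,$$ $$\text{(B)}\quad |\hat\mu(k)|\le C_2(1-\alpha)^{-B}|k|^{-\beta/2}\ \text{ for all } k\in\mathbb{Z},\ k\ne 0,$$ then $E$ contains three points $x,\ x+t,\ x+P(t)$ for some $t>0$.
   Context: "$E$ supports $\mu$" means that $\mu$ is a Borel probability measure whose support is contained in $E$. For $k\in\mathbb{Z}$, $\hat\mu(k)=\int_0^1 e^{-2\pi i kx}\,d\mu(x)$ is the $k$-th Fourier coefficient. *)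

theory Defs
  imports "HOL-Probability.Probability" "HOL-Computational_Algebra.Polynomial"
begin

text \<open>The topological (closed) support: the points all of whose open neighbourhoods are charged.\<close>

definition measure_support :: "'a::topological_space measure \<Rightarrow> 'a set" where
  "measure_support \<mu> = {x. \<forall>U. open U \<longrightarrow> x \<in> U \<longrightarrow> emeasure \<mu> U > 0}"

definition supports :: "real set \<Rightarrow> real measure \<Rightarrow> bool" where
  "supports E \<mu> \<longleftrightarrow> prob_space \<mu> \<and> sets \<mu> = sets borel \<and> measure_support \<mu> \<subseteq> E"

text \<open>The interval of integration is closed, so an atom at \<open>0\<close> or at \<open>1\<close> is counted.\<close>

definition fourier_coeff :: "real measure \<Rightarrow> int \<Rightarrow> complex" where
  "fourier_coeff \<mu> k =
     (LINT x:{0..1}|\<mu>. exp (- 2 * of_real pi * \<i> * of_int k * complex_of_real x))"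

end

theory Submission
  imports Defs
begin

text \<open>
  With \<open>u n\<close> the de la Vallee-Poussin mean of \<open>\<mu>\<close> at frequency \<open>2^n\<close> and \<open>r\<close> a bump on an interval
  \<open>{p..q}\<close> with \<open>p > 0\<close>, consider \<open>\<Lambda> n = \<integral>\<integral> u n (x + t) u n (x + P t) r(t) dt d\<mu>(x)\<close>. If \<open>\<Lambda> n\<close> stays
  bounded below for all large \<open>n\<close>, compactness of the support produces a configuration.

  \<open>\<Lambda>\<close> stabilises because of a smoothing inequality: a function of frequency at least \<open>R\<close> gains a
  power of \<open>R\<close> over the trivial \<open>L\<^sup>2\<close> bound, whereas (A) makes the \<open>L\<^sup>2\<close> norm of \<open>u n\<close> grow only like
  \<open>2^(n (1 - \<alpha>) / 2)\<close>. To prove it, square the bilinear operator and sort the result by the frequency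
  shift \<open>h\<close> between the two copies. Small \<open>h\<close> is controlled by van der Corput's bound for the multiplier.
  For large \<open>h\<close> one has to bound \<open>\<integral>\<integral> A(u) B(P(s+u) - P(s)) e(h (s - P(s))) ds du\<close>; after Cauchy-Schwarz
  in \<open>u\<close>, one integrates by parts along the vector field \<open>u \<partial>\<^sub>u - g(u,s) \<partial>\<^sub>s - g(u,s') \<partial>\<^sub>s\<^sub>'\<close> which
  annihilates both \<open>P(s+u) - P(s)\<close> and \<open>P(s'+u) - P(s')\<close>.

  For the lower bound, among many disjoint ranges of scales \<open>l < n\<close> one carries so little energy
  that \<open>u n\<close> may be replaced by \<open>u l\<close> in \<open>\<Lambda> n\<close>. If \<open>{p..q}\<close> lies close enough to \<open>0\<close> then \<open>u l\<close> does
  not feel the shifts, and \<open>\<integral> (u l)\<^sup>2 d\<mu> \<ge> (\<integral> u l d\<mu>)\<^sup>2 \<ge> 1\<close> bounds \<open>\<Lambda> l\<close> below.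
\<close>

section \<open>Iterated integrals over boxes\<close>

text \<open>The smoothing constant depends on \<open>{p..q}\<close> and is not controlled as the
  interval shrinks to 0, while the lower bound forces it to shrink as \<open>l\<close> grows. The
  way out is the order of choices. Given \<open>l\<close>, crude bounds on \<open>u l\<close> valid
  for every measure fix \<open>{p..q}\<close>; the curve fixes the smoothing constant; that constant
  fixes an \<open>n\<close> beyond which the variation of \<open>\<Lambda>\<close> is negligible.
  Iterating yields a finite chain of scales that knows only \<open>P\<close> and the constant in
  (A). The exponent \<open>\<alpha>\<close> is taken close to 1 last, so that
  \<open>2^(n (1 - \<alpha>)) \<le> 2\<close> at all scales of the chain: up to there the measure
  behaves like one of bounded density, and its bounded energy cannot fill every block.

  Exponents: smoothing gains \<open>R^(-1/12)\<close> in the squared norm, and estimating the square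
  of an increment of \<open>\<Lambda>\<close> costs three factors
  \<open>2^(n (1 - \<alpha>))\<close>; \<open>1 - \<alpha> \<le> 1/72\<close> leaves half of the
  gain.\<close>

lemma integral_swap_interval:
  fixes f :: "real \<Rightarrow> real \<Rightarrow> 'a::banach"
  assumes "continuous_on ({a..b} \<times> {c..d}) (\<lambda>(x,y). f x y)"
  shows "integral {a..b} (\<lambda>x. integral {c..d} (f x)) = integral {c..d} (\<lambda>y. integral {a..b} (\<lambda>x. f x y))"
  using integral_swap_continuous[of a c b d f] assms by (simp add: cbox_Pair_eq)

lemma continuous_on_integral_interval:
  fixes f :: "'t::topological_space \<Rightarrow> real \<Rightarrow> 'a::banach"
  assumes "continuous_on (U \<times> {a..b}) (\<lambda>(x,y). f x y)"
  shows "continuous_on U (\<lambda>x. integral {a..b} (f x))"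
  using integral_continuous_on_param[of U a b f] assms by simp

lemma continuous_on_fix_fst:
  assumes "continuous_on (U \<times> V) (\<lambda>(x,y). f x y)" "x \<in> U"
  shows "continuous_on V (f x)"
proof -
  have "continuous_on V (\<lambda>y. case (x,y) of (x,y) \<Rightarrow> f x y)"
    by (rule continuous_on_compose2[OF assms(1)]) (use assms(2) in \<open>auto intro!: continuous_intros\<close>)
  then show ?thesis by simp
qed

lemma continuous_on_fix_snd:
  assumes "continuous_on (U \<times> V) (\<lambda>(x,y). f x y)" "y \<in> V"
  shows "continuous_on U (\<lambda>x. f x y)"
proof -
  have "continuous_on U (\<lambda>x. case (x,y) of (x,y) \<Rightarrow> f x y)"
    by (rule continuous_on_compose2[OF assms(1)]) (use assms(2) in \<open>auto intro!: continuous_intros\<close>)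
  then show ?thesis by simp
qed

lemma integral3_rotate:
  fixes f :: "real \<Rightarrow> real \<Rightarrow> real \<Rightarrow> 'a::banach"
  assumes f: "continuous_on ({a..b} \<times> {c..d} \<times> {e..k}) (\<lambda>(x,y,z). f x y z)"
  shows "integral {a..b} (\<lambda>x. integral {c..d} (\<lambda>y. integral {e..k} (f x y)))
       = integral {c..d} (\<lambda>y. integral {e..k} (\<lambda>z. integral {a..b} (\<lambda>x. f x y z)))"
proof -
  have "continuous_on (({a..b} \<times> {c..d}) \<times> {e..k}) (\<lambda>(xy,z). f (fst xy) (snd xy) z)"
    using continuous_on_compose2[OF f, of "({a..b} \<times> {c..d}) \<times> {e..k}" "\<lambda>xyz. (fst (fst xyz), snd (fst xyz), snd xyz)"]
    by (force simp: case_prod_unfold intro!: continuous_intros)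
  then have "continuous_on ({a..b} \<times> {c..d}) (\<lambda>xy. integral {e..k} (f (fst xy) (snd xy)))"
    by (rule continuous_on_integral_interval)
  then have "integral {a..b} (\<lambda>x. integral {c..d} (\<lambda>y. integral {e..k} (f x y)))
      = integral {c..d} (\<lambda>y. integral {a..b} (\<lambda>x. integral {e..k} (f x y)))"
    by (intro integral_swap_interval) (simp add: case_prod_unfold)
  also have "\<dots> = integral {c..d} (\<lambda>y. integral {e..k} (\<lambda>z. integral {a..b} (\<lambda>x. f x y z)))"
  proof (rule integral_cong)
    fix y assume y: "y \<in> {c..d}"
    have "continuous_on ({a..b} \<times> {e..k}) (\<lambda>(x,z). f x y z)"
      using continuous_on_compose2[OF f, of "{a..b} \<times> {e..k}" "\<lambda>xz. (fst xz, y, snd xz)"] y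
      by (force simp: case_prod_unfold intro!: continuous_intros)
    then show "integral {a..b} (\<lambda>x. integral {e..k} (f x y)) = integral {e..k} (\<lambda>z. integral {a..b} (\<lambda>x. f x y z))"
      by (rule integral_swap_interval)
  qed
  finally show ?thesis .
qed

lemma integral3_swap_inner:
  fixes f :: "real \<Rightarrow> real \<Rightarrow> real \<Rightarrow> 'a::banach"
  assumes f: "continuous_on ({a..b} \<times> {c..d} \<times> {e..k}) (\<lambda>(x,y,z). f x y z)"
  shows "integral {a..b} (\<lambda>x. integral {c..d} (\<lambda>y. integral {e..k} (f x y)))
       = integral {a..b} (\<lambda>x. integral {e..k} (\<lambda>z. integral {c..d} (\<lambda>y. f x y z)))"
  using integral_swap_interval[OF continuous_on_fix_fst[of "{a..b}" "{c..d} \<times> {e..k}" "\<lambda>x (y,z). f x y z"]] f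
  by (intro integral_cong) (auto simp: case_prod_unfold)

lemma integral_derivative_eq_0:
  fixes f :: "real \<Rightarrow> 'a::banach"
  assumes "\<And>x. x \<in> {a..b} \<Longrightarrow> (f has_vector_derivative f' x) (at x within {a..b})"
    and "f a = 0" "f b = 0"
  shows "integral {a..b} f' = 0"
proof (cases "a \<le> b")
  case True
  then show ?thesis using fundamental_theorem_of_calculus[OF True assms(1)] assms(2,3) by auto
qed auto

lemma integrable_slices3:
  fixes f :: "real \<Rightarrow> real \<Rightarrow> real \<Rightarrow> 'a::banach"
  assumes f: "continuous_on ({a..b} \<times> {c..d} \<times> {e..k}) (\<lambda>(x,y,z). f x y z)"
  shows "x \<in> {a..b} \<Longrightarrow> y \<in> {c..d} \<Longrightarrow> f x y integrable_on {e..k}"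
    and "x \<in> {a..b} \<Longrightarrow> (\<lambda>y. integral {e..k} (f x y)) integrable_on {c..d}"
    and "(\<lambda>x. integral {c..d} (\<lambda>y. integral {e..k} (f x y))) integrable_on {a..b}"
proof -
  have f1: "continuous_on ({c..d} \<times> {e..k}) (\<lambda>(y,z). f x y z)" if "x \<in> {a..b}" for x
    using continuous_on_fix_fst[of "{a..b}" "{c..d} \<times> {e..k}" "\<lambda>x (y,z). f x y z" x] that f by (simp add: case_prod_unfold)
  show "f x y integrable_on {e..k}" if "x \<in> {a..b}" "y \<in> {c..d}"
    by (intro integrable_continuous_real continuous_on_fix_fst[OF f1] that)
  show "(\<lambda>y. integral {e..k} (f x y)) integrable_on {c..d}" if "x \<in> {a..b}"
    by (intro integrable_continuous_real continuous_on_integral_interval f1 that)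
  have "continuous_on (({a..b} \<times> {c..d}) \<times> {e..k}) (\<lambda>(us,t). f (fst us) (snd us) t)"
    using continuous_on_compose2[OF f, of "({a..b} \<times> {c..d}) \<times> {e..k}" "\<lambda>xyz. (fst (fst xyz), snd (fst xyz), snd xyz)"]
    by (force simp: case_prod_unfold intro!: continuous_intros)
  then have "continuous_on ({a..b} \<times> {c..d}) (\<lambda>us. integral {e..k} (f (fst us) (snd us)))"
    by (rule continuous_on_integral_interval)
  then show "(\<lambda>x. integral {c..d} (\<lambda>y. integral {e..k} (f x y))) integrable_on {a..b}"
    by (intro integrable_continuous_real continuous_on_integral_interval) (simp add: case_prod_unfold)
qed

lemma integral3_linear:
  fixes f f' :: "real \<Rightarrow> real \<Rightarrow> real \<Rightarrow> 'a::{real_normed_field,banach}"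
  assumes f: "continuous_on ({a..b} \<times> {c..d} \<times> {e..k}) (\<lambda>(x,y,z). f x y z)"
    and f': "continuous_on ({a..b} \<times> {c..d} \<times> {e..k}) (\<lambda>(x,y,z). f' x y z)"
  shows "integral {a..b} (\<lambda>x. integral {c..d} (\<lambda>y. integral {e..k} (\<lambda>z. f x y z + r * f' x y z)))
    = integral {a..b} (\<lambda>x. integral {c..d} (\<lambda>y. integral {e..k} (f x y)))
      + r * integral {a..b} (\<lambda>x. integral {c..d} (\<lambda>y. integral {e..k} (f' x y)))"
proof -
  note i = integrable_slices3[OF f] integrable_slices3[OF f']
  have "integral {a..b} (\<lambda>x. integral {c..d} (\<lambda>y. integral {e..k} (\<lambda>z. f x y z + r * f' x y z)))
     = integral {a..b} (\<lambda>x. integral {c..d} (\<lambda>y. integral {e..k} (f x y) + r * integral {e..k} (f' x y)))"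
    by (intro integral_cong, subst integral_add) (auto intro!: i integrable_on_mult_right)
  also have "\<dots> = integral {a..b} (\<lambda>x. integral {c..d} (\<lambda>y. integral {e..k} (f x y)) + r * integral {c..d} (\<lambda>y. integral {e..k} (f' x y)))"
    by (intro integral_cong, subst integral_add) (auto intro!: i integrable_on_mult_right)
  also have "\<dots> = integral {a..b} (\<lambda>x. integral {c..d} (\<lambda>y. integral {e..k} (f x y)))
      + r * integral {a..b} (\<lambda>x. integral {c..d} (\<lambda>y. integral {e..k} (f' x y)))"
    by (subst integral_add) (auto intro!: i integrable_on_mult_right)
  finally show ?thesis .
qed

lemma integral3_norm_bound:
  fixes f :: "real \<Rightarrow> real \<Rightarrow> real \<Rightarrow> 'a::banach" and h :: "real \<Rightarrow> real \<Rightarrow> real \<Rightarrow> real"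
  assumes f: "continuous_on ({a..b} \<times> {c..d} \<times> {e..k}) (\<lambda>(x,y,z). f x y z)"
    and h: "continuous_on ({a..b} \<times> {c..d} \<times> {e..k}) (\<lambda>(x,y,z). h x y z)"
    and le: "\<And>x y z. x \<in> {a..b} \<Longrightarrow> y \<in> {c..d} \<Longrightarrow> z \<in> {e..k} \<Longrightarrow> norm (f x y z) \<le> h x y z"
  shows "norm (integral {a..b} (\<lambda>x. integral {c..d} (\<lambda>y. integral {e..k} (f x y))))
    \<le> integral {a..b} (\<lambda>x. integral {c..d} (\<lambda>y. integral {e..k} (h x y)))"
  by (intro integral_norm_bound_integral integrable_slices3[OF f] integrable_slices3[OF h] le)

lemma integral_interval_complex_of_real:
  "integral S (\<lambda>x. complex_of_real (f x)) = of_real (integral S f)"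
proof (cases "f integrable_on S")
  case True
  show ?thesis using integral_linear[OF True bounded_linear_of_real] by (simp add: o_def)
next
  \<comment> \<open>Both integrals take the default value 0: the complex function is not integrable
    either, since its real part is \<open>f\<close>.\<close>
  case False
  then have "\<not> (\<lambda>x. complex_of_real (f x)) integrable_on S"
    using integrable_linear[OF _ bounded_linear_Re, of "\<lambda>x. complex_of_real (f x)" S] by (auto simp: o_def)
  then show ?thesis using False by (simp add: not_integrable_integral)
qed

section \<open>Oscillatory integrals along a transporting vector field\<close>

text \<open>The integrand is the derivative of \<open>- (d / c) * arctan (c * (s - t) / d)\<close>,
  and arctan varies by at most pi. This will measure a neighbourhood of the diagonal of width about
  \<open>d / c\<close>, uniformly in \<open>s\<close>.\<close>

lemma integral_lorentz_le:
  fixes c d :: real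
  assumes "0 < c" "0 < d"
  shows "integral {p..q} (\<lambda>t. d\<^sup>2 / (d\<^sup>2 + (c * (s - t))\<^sup>2)) \<le> pi * d / c"
proof (cases "p \<le> q")
  case True
  have "((\<lambda>t. - (d / c) * arctan (c * (s - t) / d)) has_vector_derivative d\<^sup>2 / (d\<^sup>2 + (c * (s - t))\<^sup>2)) (at t within {p..q})" for t
  proof -
    have "((\<lambda>t. c * (s - t) / d) has_real_derivative - (c / d)) (at t within {p..q})"
      by (rule derivative_eq_intros refl)+ (use assms in auto)
    from DERIV_cmult[OF DERIV_chain2[OF DERIV_arctan this], of "- (d / c)"]
    have "((\<lambda>t. - (d / c) * arctan (c * (s - t) / d)) has_real_derivative
        - (d / c) * (inverse (1 + (c * (s - t) / d)\<^sup>2) * - (c / d))) (at t within {p..q})" .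
    also have "- (d / c) * (inverse (1 + (c * (s - t) / d)\<^sup>2) * - (c / d)) = inverse (1 + (c * (s - t) / d)\<^sup>2)"
      using assms by simp
    also have "\<dots> = d\<^sup>2 / (d\<^sup>2 + (c * (s - t))\<^sup>2)"
      using assms by (simp add: power_divide add_divide_eq_iff inverse_eq_divide)
    finally show ?thesis by (simp add: has_real_derivative_iff_has_vector_derivative)
  qed
  from fundamental_theorem_of_calculus[OF True this]
  have "integral {p..q} (\<lambda>t. d\<^sup>2 / (d\<^sup>2 + (c * (s - t))\<^sup>2)) = (d / c) * (arctan (c * (s - p) / d) - arctan (c * (s - q) / d))"
    by (subst integral_unique, assumption) (simp add: algebra_simps)
  also have "\<dots> \<le> (d / c) * pi"
    using arctan_bounded[of "c * (s - p) / d"] arctan_bounded[of "c * (s - q) / d"] assms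
    by (intro mult_left_mono) auto
  finally show ?thesis by (simp add: algebra_simps)
qed (use assms in auto)

text \<open>A regularised \<open>1 / y\<close>, bounded by \<open>1 / (2 * d)\<close>: integration
  by parts wants to divide by a phase derivative that vanishes on the diagonal \<open>s = t\<close>.
  The width \<open>d\<close> is optimised at the end.\<close>

definition kap where "kap d y = y / (d\<^sup>2 + y\<^sup>2)" for d y :: real
definition kap' where "kap' d y = (d\<^sup>2 - y\<^sup>2) / (d\<^sup>2 + y\<^sup>2)\<^sup>2" for d y :: real

lemma kap_deriv: "d \<noteq> 0 \<Longrightarrow> (kap d has_real_derivative kap' d y) (at y within S)"
  unfolding kap_def[abs_def] kap'_def
  by (rule derivative_eq_intros refl | simp)+
     (auto simp: power2_eq_square field_simps add_nonneg_eq_0_iff sum_power2_eq_zero_iff)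

text \<open>By AM-GM \<open>kap\<close> is already of size \<open>1 / d\<close>; the weaker
  \<open>1 / d\<^sup>2\<close>, valid since \<open>d \<le> 1\<close>, lets it share a bound with its
  derivative.\<close>

lemma kap_bounds:
  assumes "0 < d" "d \<le> 1"
  shows "\<bar>kap d y\<bar> \<le> 1 / d\<^sup>2" "\<bar>kap' d y\<bar> \<le> 1 / d\<^sup>2"
proof -
  have pos: "0 < d\<^sup>2 + y\<^sup>2" using assms by (simp add: add_pos_nonneg)
  have "2 * (d * \<bar>y\<bar>) \<le> d\<^sup>2 + y\<^sup>2"
    using zero_le_power2[of "d - \<bar>y\<bar>"] by (simp add: power2_diff)
  moreover have "0 \<le> d * \<bar>y\<bar>" using assms by simp
  ultimately have "d * \<bar>y\<bar> \<le> d\<^sup>2 + y\<^sup>2" by linarith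
  moreover have "d\<^sup>2 * \<bar>y\<bar> \<le> d * \<bar>y\<bar>"
    using assms by (intro mult_right_mono) (auto simp: power2_eq_square mult_left_le)
  ultimately show "\<bar>kap d y\<bar> \<le> 1 / d\<^sup>2"
    unfolding kap_def using pos assms by (simp add: field_simps)
  have "\<bar>d\<^sup>2 - y\<^sup>2\<bar> \<le> d\<^sup>2 + y\<^sup>2" by (simp add: abs_le_iff)
  then have "\<bar>kap' d y\<bar> \<le> (d\<^sup>2 + y\<^sup>2) / (d\<^sup>2 + y\<^sup>2)\<^sup>2"
    unfolding kap'_def by (simp add: divide_right_mono)
  also have "\<dots> = 1 / (d\<^sup>2 + y\<^sup>2)" using pos by (simp add: power2_eq_square)
  also have "\<dots> \<le> 1 / d\<^sup>2" using assms pos by (intro divide_left_mono mult_pos_pos) auto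
  finally show "\<bar>kap' d y\<bar> \<le> 1 / d\<^sup>2" .
qed

text \<open>The suffixes \<open>u\<close> and \<open>s\<close> denote partial derivatives. The vector field is \<open>u \<partial>\<^sub>u - g \<partial>\<^sub>s\<close>, \<open>E\<close> is (up to
  sign) the derivative of the phase along it, and \<open>sep\<close> is the nondegeneracy that makes the phases at
  \<open>s\<close> and \<open>t\<close> oscillate against each other.\<close>

locale transport_box =
  fixes w p q c :: real and g gs E Eu Es om omu oms :: "real \<Rightarrow> real \<Rightarrow> real"
  assumes pq: "p < q" and w0: "0 < w" and c0: "0 < c"
    and cont: "continuous_on ({-w..w} \<times> {p..q}) (\<lambda>(u,s). g u s)"
      "continuous_on ({-w..w} \<times> {p..q}) (\<lambda>(u,s). gs u s)"
      "continuous_on ({-w..w} \<times> {p..q}) (\<lambda>(u,s). E u s)"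
      "continuous_on ({-w..w} \<times> {p..q}) (\<lambda>(u,s). Eu u s)"
      "continuous_on ({-w..w} \<times> {p..q}) (\<lambda>(u,s). Es u s)"
      "continuous_on ({-w..w} \<times> {p..q}) (\<lambda>(u,s). om u s)"
      "continuous_on ({-w..w} \<times> {p..q}) (\<lambda>(u,s). omu u s)"
      "continuous_on ({-w..w} \<times> {p..q}) (\<lambda>(u,s). oms u s)"
    and g_s: "\<And>u s. u \<in> {-w..w} \<Longrightarrow> s \<in> {p..q} \<Longrightarrow> (g u has_real_derivative gs u s) (at s within {p..q})"
    and E_u: "\<And>u s. u \<in> {-w..w} \<Longrightarrow> s \<in> {p..q} \<Longrightarrow> ((\<lambda>u. E u s) has_real_derivative Eu u s) (at u within {-w..w})"
    and E_s: "\<And>u s. u \<in> {-w..w} \<Longrightarrow> s \<in> {p..q} \<Longrightarrow> (E u has_real_derivative Es u s) (at s within {p..q})"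
    and om_u: "\<And>u s. u \<in> {-w..w} \<Longrightarrow> s \<in> {p..q} \<Longrightarrow> ((\<lambda>u. om u s) has_real_derivative omu u s) (at u within {-w..w})"
    and om_s: "\<And>u s. u \<in> {-w..w} \<Longrightarrow> s \<in> {p..q} \<Longrightarrow> (om u has_real_derivative oms u s) (at s within {p..q})"
    and om_bdry: "\<And>s. s \<in> {p..q} \<Longrightarrow> om w s = 0" "\<And>s. s \<in> {p..q} \<Longrightarrow> om (-w) s = 0"
      "\<And>u. u \<in> {-w..w} \<Longrightarrow> om u p = 0" "\<And>u. u \<in> {-w..w} \<Longrightarrow> om u q = 0"
    and om_nonneg: "\<And>u s. 0 \<le> om u s"
    and sep: "\<And>u s t. u \<in> {-w..w} \<Longrightarrow> s \<in> {p..q} \<Longrightarrow> t \<in> {p..q} \<Longrightarrow> c * \<bar>s - t\<bar> \<le> \<bar>E u s - E u t\<bar>"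
begin

abbreviation Bx where "Bx \<equiv> {-w..w} \<times> {p..q} \<times> {p..q}"

definition D where "D u s t = E u s - E u t"
text \<open>\<open>D kap(D)\<close> replaces \<open>1\<close> up to the error \<open>d\<^sup>2 / (d\<^sup>2 + D\<^sup>2)\<close>, which is concentrated near the diagonal; \<open>dv\<close> is
  what integration by parts leaves on the remaining factor.\<close>

definition dv where
  "dv d u s t = kap d (D u s t) * om u s * om u t * (1 - gs u s - gs u t)
     + kap' d (D u s t) * om u s * om u t * ((u * Eu u s - g u s * Es u s) - (u * Eu u t - g u t * Es u t))
     + kap d (D u s t) * ((u * omu u s - g u s * oms u s) * om u t + om u s * (u * omu u t - g u t * oms u t))"

lemma cont_st:
  assumes "continuous_on ({-w..w} \<times> {p..q}) (\<lambda>(u,s). f u s)"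
  shows "continuous_on Bx (\<lambda>z. f (fst z) (fst (snd z)))" "continuous_on Bx (\<lambda>z. f (fst z) (snd (snd z)))"
proof -
  have "continuous_on Bx (\<lambda>z. case (fst z, fst (snd z)) of (u,s) \<Rightarrow> f u s)"
    by (rule continuous_on_compose2[OF assms]) (auto intro!: continuous_intros)
  then show "continuous_on Bx (\<lambda>z. f (fst z) (fst (snd z)))" by simp
  have "continuous_on Bx (\<lambda>z. case (fst z, snd (snd z)) of (u,s) \<Rightarrow> f u s)"
    by (rule continuous_on_compose2[OF assms]) (auto intro!: continuous_intros)
  then show "continuous_on Bx (\<lambda>z. f (fst z) (snd (snd z)))" by simp
qed

lemmas conts = cont_st[OF cont(1)] cont_st[OF cont(2)] cont_st[OF cont(3)] cont_st[OF cont(4)]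
  cont_st[OF cont(5)] cont_st[OF cont(6)] cont_st[OF cont(7)] cont_st[OF cont(8)]

lemma cont_kap: "d \<noteq> 0 \<Longrightarrow> continuous_on Bx (\<lambda>z. kap d (D (fst z) (fst (snd z)) (snd (snd z))))"
  "d \<noteq> 0 \<Longrightarrow> continuous_on Bx (\<lambda>z. kap' d (D (fst z) (fst (snd z)) (snd (snd z))))"
  unfolding kap_def kap'_def D_def
  by (intro continuous_intros conts; simp add: sum_power2_eq_zero_iff)+

lemma cont_dv: "d \<noteq> 0 \<Longrightarrow> continuous_on Bx (\<lambda>z. dv d (fst z) (fst (snd z)) (snd (snd z)))"
  unfolding dv_def by (intro continuous_intros conts cont_kap)

text \<open>The divergence theorem for the field with components \<open>u\<close>,
  \<open>- g u s\<close>, \<open>- g u t\<close>, applied to \<open>b u s * cnj (b u t)\<close>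
  times the weight \<open>kap d (D u s t) * om u s * om u t\<close>. Along the field the product of
  the two amplitudes only acquires the multiplier \<open>- \<i> * H * D u s t\<close>, which gives
  the left side; the divergence of the field and the derivative of the weight make up
  \<open>dv\<close>. Boundary terms vanish with \<open>om\<close>.\<close>

lemma transport_identity:
  fixes b bu bs :: "real \<Rightarrow> real \<Rightarrow> complex" and d H :: real
  assumes d: "d \<noteq> 0"
    and contb: "continuous_on ({-w..w} \<times> {p..q}) (\<lambda>(u,s). b u s)"
      "continuous_on ({-w..w} \<times> {p..q}) (\<lambda>(u,s). bu u s)"
      "continuous_on ({-w..w} \<times> {p..q}) (\<lambda>(u,s). bs u s)"
    and b_u: "\<And>u s. u \<in> {-w..w} \<Longrightarrow> s \<in> {p..q} \<Longrightarrow> ((\<lambda>u. b u s) has_vector_derivative bu u s) (at u within {-w..w})"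
    and b_s: "\<And>u s. u \<in> {-w..w} \<Longrightarrow> s \<in> {p..q} \<Longrightarrow> (b u has_vector_derivative bs u s) (at s within {p..q})"
    and transport: "\<And>u s. u \<in> {-w..w} \<Longrightarrow> s \<in> {p..q} \<Longrightarrow> of_real u * bu u s - of_real (g u s) * bs u s = - \<i> * of_real (H * E u s) * b u s"
  shows "\<i> * of_real H * integral {-w..w} (\<lambda>u. integral {p..q} (\<lambda>s. integral {p..q} (\<lambda>t.
            b u s * cnj (b u t) * of_real (D u s t * kap d (D u s t) * om u s * om u t))))
       = integral {-w..w} (\<lambda>u. integral {p..q} (\<lambda>s. integral {p..q} (\<lambda>t.
            b u s * cnj (b u t) * of_real (dv d u s t))))"
proof -
  define R where "R u s t = kap d (D u s t) * om u s * om u t" for u s t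
  define Ru where "Ru u s t = kap' d (D u s t) * (Eu u s - Eu u t) * om u s * om u t
      + kap d (D u s t) * (omu u s * om u t + om u s * omu u t)" for u s t
  define Rs where "Rs u s t = kap' d (D u s t) * Es u s * om u s * om u t + kap d (D u s t) * oms u s * om u t" for u s t
  define Rt where "Rt u s t = - kap' d (D u s t) * Es u t * om u s * om u t + kap d (D u s t) * om u s * oms u t" for u s t
  \<comment> \<open>\<open>h1\<close>, \<open>h2\<close>, \<open>h3\<close> are the
    \<open>u\<close>-, \<open>s\<close>- and \<open>t\<close>-derivatives of \<open>u * F\<close>,
    \<open>g u s * F\<close>, \<open>g u t * F\<close> with
    \<open>F = b u s * cnj (b u t) * R u s t\<close>; each integrates to 0 in its own
    variable.\<close>
  define h1 where "h1 u s t = (bu u s * cnj (b u t) + b u s * cnj (bu u t)) * of_real (u * R u s t)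
     + b u s * cnj (b u t) * of_real (R u s t + u * Ru u s t)" for u s t
  define h2 where "h2 u s t = bs u s * cnj (b u t) * of_real (g u s * R u s t)
     + b u s * cnj (b u t) * of_real (gs u s * R u s t + g u s * Rs u s t)" for u s t
  define h3 where "h3 u s t = b u s * cnj (bs u t) * of_real (g u t * R u s t)
     + b u s * cnj (b u t) * of_real (gs u t * R u s t + g u t * Rt u s t)" for u s t
  note cb = cont_st[OF contb(1)] cont_st[OF contb(2)] cont_st[OF contb(3)]
  have c1: "continuous_on Bx (\<lambda>(u,s,t). h1 u s t)"
    unfolding h1_def R_def Ru_def case_prod_unfold by (intro continuous_intros conts cont_kap cb d)
  have c2: "continuous_on Bx (\<lambda>(u,s,t). h2 u s t)"
    unfolding h2_def R_def Rs_def case_prod_unfold by (intro continuous_intros conts cont_kap cb d)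
  have c3: "continuous_on Bx (\<lambda>(u,s,t). h3 u s t)"
    unfolding h3_def R_def Rt_def case_prod_unfold by (intro continuous_intros conts cont_kap cb d)
  let ?I = "\<lambda>h. integral {-w..w} (\<lambda>u. integral {p..q} (\<lambda>s. integral {p..q} (\<lambda>t. h u s t :: complex)))"
  have R_u: "((\<lambda>u. R u s t) has_real_derivative Ru u s t) (at u within {-w..w})"
    if "u \<in> {-w..w}" "s \<in> {p..q}" "t \<in> {p..q}" for u s t
    unfolding R_def Ru_def D_def
    by (rule derivative_eq_intros DERIV_chain2[OF kap_deriv[OF d]] E_u om_u that refl)+ (simp add: algebra_simps)
  have R_s: "((\<lambda>s. R u s t) has_real_derivative Rs u s t) (at s within {p..q})"
    if "u \<in> {-w..w}" "s \<in> {p..q}" "t \<in> {p..q}" for u s t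
    unfolding R_def Rs_def D_def
    by (rule derivative_eq_intros DERIV_chain2[OF kap_deriv[OF d]] E_s om_s that refl)+ (simp add: algebra_simps)
  have R_t: "((\<lambda>t. R u s t) has_real_derivative Rt u s t) (at t within {p..q})"
    if "u \<in> {-w..w}" "s \<in> {p..q}" "t \<in> {p..q}" for u s t
    unfolding R_def Rt_def D_def
    by (rule derivative_eq_intros DERIV_chain2[OF kap_deriv[OF d]] E_s om_s that refl)+ (simp add: algebra_simps)
  have cr: "(f has_real_derivative f') F \<Longrightarrow> ((\<lambda>x. of_real (f x) :: complex) has_vector_derivative of_real f') F" for f f' F
    by (intro has_vector_derivative_of_real) (simp add: has_real_derivative_iff_has_vector_derivative)
  have cj: "(f has_vector_derivative f') F \<Longrightarrow> ((\<lambda>x. cnj (f x)) has_vector_derivative cnj f') F" for f f' F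
    by (rule bounded_linear.has_vector_derivative[OF bounded_linear_cnj])
  have i1: "?I h1 = 0"
  proof -
    have "?I h1 = integral {p..q} (\<lambda>s. integral {p..q} (\<lambda>t. integral {-w..w} (\<lambda>u. h1 u s t)))"
      by (rule integral3_rotate[OF c1])
    also have "\<dots> = integral {p..q} (\<lambda>s. integral {p..q} (\<lambda>t. 0))"
    proof (intro integral_cong)
      fix s t assume st: "s \<in> {p..q}" "t \<in> {p..q}"
      show "integral {-w..w} (\<lambda>u. h1 u s t) = 0"
      proof (rule integral_derivative_eq_0)
        fix u assume u: "u \<in> {-w..w}"
        have "((\<lambda>u. b u s * cnj (b u t) * of_real (u * R u s t)) has_vector_derivative
            b u s * cnj (b u t) * of_real (1 * R u s t + Ru u s t * u)
             + (b u s * cnj (bu u t) + bu u s * cnj (b u t)) * of_real (u * R u s t)) (at u within {-w..w})"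
          by (intro has_vector_derivative_mult b_u cj cr DERIV_mult DERIV_ident R_u u st)
        then show "((\<lambda>u. b u s * cnj (b u t) * of_real (u * R u s t)) has_vector_derivative h1 u s t) (at u within {-w..w})"
          by (rule back_subst[of "\<lambda>x. (_ has_vector_derivative x) _"]) (simp add: h1_def algebra_simps)
      qed (use st om_bdry in \<open>auto simp: R_def\<close>)
    qed
    finally show ?thesis by simp
  qed
  have i2: "?I h2 = 0"
  proof -
    have "?I h2 = integral {-w..w} (\<lambda>u. integral {p..q} (\<lambda>t. integral {p..q} (\<lambda>s. h2 u s t)))"
      by (rule integral3_swap_inner[OF c2])
    also have "\<dots> = integral {-w..w} (\<lambda>u. integral {p..q} (\<lambda>t. 0))"
    proof (intro integral_cong)
      fix u t assume ut: "u \<in> {-w..w}" "t \<in> {p..q}"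
      show "integral {p..q} (\<lambda>s. h2 u s t) = 0"
      proof (rule integral_derivative_eq_0)
        fix s assume s: "s \<in> {p..q}"
        have "((\<lambda>s. b u s * (cnj (b u t) * of_real (g u s * R u s t))) has_vector_derivative
            b u s * (cnj (b u t) * of_real (gs u s * R u s t + Rs u s t * g u s))
             + bs u s * (cnj (b u t) * of_real (g u s * R u s t))) (at s within {p..q})"
          by (intro has_vector_derivative_mult has_vector_derivative_mult_right b_s cr DERIV_mult g_s R_s s ut)
        then show "((\<lambda>s. b u s * (cnj (b u t) * of_real (g u s * R u s t))) has_vector_derivative h2 u s t) (at s within {p..q})"
          by (rule back_subst[of "\<lambda>x. (_ has_vector_derivative x) _"]) (simp add: h2_def algebra_simps)
      qed (use ut om_bdry in \<open>auto simp: R_def\<close>)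
    qed
    finally show ?thesis by simp
  qed
  have i3: "?I h3 = 0"
  proof -
    have "?I h3 = integral {-w..w} (\<lambda>u. integral {p..q} (\<lambda>t. 0))"
    proof (intro integral_cong)
      fix u s assume us: "u \<in> {-w..w}" "s \<in> {p..q}"
      show "integral {p..q} (\<lambda>t. h3 u s t) = 0"
      proof (rule integral_derivative_eq_0)
        fix t assume t: "t \<in> {p..q}"
        have "((\<lambda>t. b u s * (cnj (b u t) * of_real (g u t * R u s t))) has_vector_derivative
            b u s * (cnj (b u t) * of_real (gs u t * R u s t + Rt u s t * g u t)
             + cnj (bs u t) * of_real (g u t * R u s t))) (at t within {p..q})"
          by (intro has_vector_derivative_mult has_vector_derivative_mult_right b_s cj cr DERIV_mult g_s R_t t us)
        then show "((\<lambda>t. b u s * (cnj (b u t) * of_real (g u t * R u s t))) has_vector_derivative h3 u s t) (at t within {p..q})"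
          by (rule back_subst[of "\<lambda>x. (_ has_vector_derivative x) _"]) (simp add: h3_def algebra_simps)
      qed (use us om_bdry in \<open>auto simp: R_def\<close>)
    qed
    then show ?thesis by simp
  qed
  have key: "h1 u s t - h2 u s t - h3 u s t = b u s * cnj (b u t) * of_real (dv d u s t)
      - \<i> * of_real H * (b u s * cnj (b u t) * of_real (D u s t * kap d (D u s t) * om u s * om u t))"
    if "u \<in> {-w..w}" "s \<in> {p..q}" "t \<in> {p..q}" for u s t
  proof -
    have t': "of_real u * cnj (bu u t) - of_real (g u t) * cnj (bs u t) = \<i> * of_real (H * E u t) * cnj (b u t)"
      using arg_cong[OF transport[of u t], of cnj] that by simp
    have "h1 u s t - h2 u s t - h3 u s t = (of_real u * bu u s - of_real (g u s) * bs u s) * (cnj (b u t) * of_real (R u s t))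
       + (of_real u * cnj (bu u t) - of_real (g u t) * cnj (bs u t)) * (b u s * of_real (R u s t))
       + b u s * cnj (b u t) * of_real (R u s t + u * Ru u s t - gs u s * R u s t - g u s * Rs u s t - gs u t * R u s t - g u t * Rt u s t)"
      unfolding h1_def h2_def h3_def by (simp add: algebra_simps)
    also have "R u s t + u * Ru u s t - gs u s * R u s t - g u s * Rs u s t - gs u t * R u s t - g u t * Rt u s t = dv d u s t"
      unfolding R_def Ru_def Rs_def Rt_def dv_def by (simp add: algebra_simps)
    finally show ?thesis
      unfolding t' transport[OF that(1,2)] by (simp add: R_def D_def algebra_simps)
  qed
  note I2 = integral3_linear
  let ?X = "\<lambda>u s t. b u s * cnj (b u t) * of_real (dv d u s t)"
  let ?Y = "\<lambda>u s t. b u s * cnj (b u t) * of_real (D u s t * kap d (D u s t) * om u s * om u t)"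
  have cX: "continuous_on Bx (\<lambda>(u,s,t). ?X u s t)"
    unfolding case_prod_unfold by (intro continuous_intros conts cont_dv cb d)
  have cY: "continuous_on Bx (\<lambda>(u,s,t). ?Y u s t)"
    unfolding case_prod_unfold D_def by (intro continuous_intros conts cont_kap[unfolded D_def] cb d)
  have c12: "continuous_on Bx (\<lambda>(u,s,t). h1 u s t + (-1) * h2 u s t)"
    using c1 c2 unfolding case_prod_unfold by (intro continuous_intros)
  have "?I (\<lambda>u s t. h1 u s t + (-1) * h2 u s t + (-1) * h3 u s t) = 0"
    unfolding I2[OF c12 c3] I2[OF c1 c2] i1 i2 i3 by simp
  moreover have "?I (\<lambda>u s t. h1 u s t + (-1) * h2 u s t + (-1) * h3 u s t) = ?I (\<lambda>u s t. ?X u s t + (- \<i> * of_real H) * ?Y u s t)"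
    by (intro integral_cong) (use key in \<open>simp add: algebra_simps\<close>)
  ultimately show ?thesis unfolding I2[OF cX cY] by simp
qed



text \<open>Schur's test: AM-GM on \<open>\<beta> u s * \<beta> u t\<close> leaves squares, against
  which \<open>k\<close> integrates to at most \<open>K\<close> in the free variable. The bound on
  \<open>\<beta>\<close> is uniform in \<open>s\<close>, hence the total mass
  \<open>(q - p) * S\<close> after exchanging integrals.\<close>

lemma schur_bound:
  fixes \<beta> :: "real \<Rightarrow> real \<Rightarrow> real" and k :: "real \<Rightarrow> real \<Rightarrow> real \<Rightarrow> real"
  assumes cb: "continuous_on ({-w..w} \<times> {p..q}) (\<lambda>(u,s). \<beta> u s)"
    and ck: "continuous_on Bx (\<lambda>(u,s,t). k u s t)"
    and k0: "\<And>u s t. u \<in> {-w..w} \<Longrightarrow> s \<in> {p..q} \<Longrightarrow> t \<in> {p..q} \<Longrightarrow> 0 \<le> k u s t"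
    and k1: "\<And>u s. u \<in> {-w..w} \<Longrightarrow> s \<in> {p..q} \<Longrightarrow> integral {p..q} (k u s) \<le> K"
    and k2: "\<And>u t. u \<in> {-w..w} \<Longrightarrow> t \<in> {p..q} \<Longrightarrow> integral {p..q} (\<lambda>s. k u s t) \<le> K"
    and S: "\<And>s. s \<in> {p..q} \<Longrightarrow> integral {-w..w} (\<lambda>u. (\<beta> u s)\<^sup>2) \<le> S" and K0: "0 \<le> K"
  shows "integral {-w..w} (\<lambda>u. integral {p..q} (\<lambda>s. integral {p..q} (\<lambda>t. \<beta> u s * \<beta> u t * k u s t))) \<le> K * ((q - p) * S)"
proof -
  let ?I = "\<lambda>h. integral {-w..w} (\<lambda>u. integral {p..q} (\<lambda>s. integral {p..q} (\<lambda>t. h u s t :: real)))"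
  note cs = cont_st[OF cb]
  have ck': "continuous_on Bx (\<lambda>z. k (fst z) (fst (snd z)) (snd (snd z)))"
    using ck by (simp add: case_prod_unfold)
  have c1: "continuous_on Bx (\<lambda>(u,s,t). (\<beta> u s)\<^sup>2 * k u s t)" "continuous_on Bx (\<lambda>(u,s,t). (\<beta> u t)\<^sup>2 * k u s t)"
    "continuous_on Bx (\<lambda>(u,s,t). \<beta> u s * \<beta> u t * k u s t)"
    unfolding case_prod_unfold by (intro continuous_intros cs ck')+
  have c2: "continuous_on Bx (\<lambda>(u,s,t). (1/2) * ((\<beta> u s)\<^sup>2 * k u s t) + (1/2) * ((\<beta> u t)\<^sup>2 * k u s t))"
    "continuous_on Bx (\<lambda>(u,s,t). (1/2) * ((\<beta> u s)\<^sup>2 * k u s t))"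
    unfolding case_prod_unfold by (intro continuous_intros cs ck')+
  have cb2: "continuous_on ({-w..w} \<times> {p..q}) (\<lambda>(u,s). (\<beta> u s)\<^sup>2)"
    using cb unfolding case_prod_unfold by (intro continuous_intros)
  have main: "integral {-w..w} (\<lambda>u. integral {p..q} (\<lambda>s. (\<beta> u s)\<^sup>2)) \<le> (q - p) * S"
  proof -
    have "integral {-w..w} (\<lambda>u. integral {p..q} (\<lambda>s. (\<beta> u s)\<^sup>2)) = integral {p..q} (\<lambda>s. integral {-w..w} (\<lambda>u. (\<beta> u s)\<^sup>2))"
      by (rule integral_swap_interval[OF cb2])
    also have "\<dots> \<le> integral {p..q} (\<lambda>s. S)"
    proof (rule integral_le)
      have "continuous_on ({p..q} \<times> {-w..w}) (\<lambda>su. case (snd su, fst su) of (u,s) \<Rightarrow> (\<beta> u s)\<^sup>2)"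
        by (rule continuous_on_compose2[OF cb2]) (auto intro!: continuous_intros)
      then show "(\<lambda>s. integral {-w..w} (\<lambda>u. (\<beta> u s)\<^sup>2)) integrable_on {p..q}"
        by (intro integrable_continuous_real continuous_on_integral_interval) (simp add: case_prod_unfold)
    qed (use S in auto)
    also have "\<dots> = (q - p) * S" using pq by simp
    finally show ?thesis .
  qed
  have mainK: "integral {-w..w} (\<lambda>u. integral {p..q} (\<lambda>s. K * (\<beta> u s)\<^sup>2)) \<le> K * ((q - p) * S)"
    using mult_left_mono[OF main K0] by simp
  have iK: "(\<lambda>s. K * (\<beta> u s)\<^sup>2) integrable_on {p..q}" if "u \<in> {-w..w}" for u
    using continuous_on_fix_fst[OF cb2 that] by (intro integrable_on_mult_right integrable_continuous_real)
  have iK': "(\<lambda>u. integral {p..q} (\<lambda>s. K * (\<beta> u s)\<^sup>2)) integrable_on {-w..w}"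
    using continuous_on_integral_interval[OF cb2] by (simp add: integrable_on_mult_right integrable_continuous_real)
  have ik: "k u s integrable_on {p..q}" if "u \<in> {-w..w}" "s \<in> {p..q}" for u s
    by (rule integrable_slices3(1)[OF ck]) (use that in auto)
  have a1: "?I (\<lambda>u s t. (\<beta> u s)\<^sup>2 * k u s t) \<le> K * ((q - p) * S)"
  proof -
    have "?I (\<lambda>u s t. (\<beta> u s)\<^sup>2 * k u s t) \<le> integral {-w..w} (\<lambda>u. integral {p..q} (\<lambda>s. K * (\<beta> u s)\<^sup>2))"
    proof (intro integral_le integrable_slices3[OF c1(1)] iK iK')
      fix u s assume us: "u \<in> {-w..w}" "s \<in> {p..q}"
      show "integral {p..q} (\<lambda>t. (\<beta> u s)\<^sup>2 * k u s t) \<le> K * (\<beta> u s)\<^sup>2"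
        using mult_left_mono[OF k1[OF us], of "(\<beta> u s)\<^sup>2"] by (simp add: mult.commute)
    qed auto
    then show ?thesis using mainK by linarith
  qed
  have a2: "?I (\<lambda>u s t. (\<beta> u t)\<^sup>2 * k u s t) \<le> K * ((q - p) * S)"
  proof -
    have c1': "continuous_on Bx (\<lambda>(u,t,s). (\<beta> u t)\<^sup>2 * k u s t)"
    proof -
      have "continuous_on Bx (\<lambda>z. case (fst z, snd (snd z), fst (snd z)) of (u,s,t) \<Rightarrow> (\<beta> u t)\<^sup>2 * k u s t)"
        by (rule continuous_on_compose2[OF c1(2)]) (auto intro!: continuous_intros)
      then show ?thesis by (simp add: case_prod_unfold)
    qed
    have "?I (\<lambda>u s t. (\<beta> u t)\<^sup>2 * k u s t) = ?I (\<lambda>u t s. (\<beta> u t)\<^sup>2 * k u s t)"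
      by (rule integral3_swap_inner[OF c1(2)])
    also have "\<dots> \<le> integral {-w..w} (\<lambda>u. integral {p..q} (\<lambda>s. K * (\<beta> u s)\<^sup>2))"
    proof (intro integral_le integrable_slices3[OF c1'] iK iK')
      fix u t assume us: "u \<in> {-w..w}" "t \<in> {p..q}"
      show "integral {p..q} (\<lambda>s. (\<beta> u t)\<^sup>2 * k u s t) \<le> K * (\<beta> u t)\<^sup>2"
        using mult_left_mono[OF k2[OF us], of "(\<beta> u t)\<^sup>2"] by (simp add: mult.commute)
    qed auto
    finally show ?thesis using mainK by linarith
  qed
  have "?I (\<lambda>u s t. \<beta> u s * \<beta> u t * k u s t) \<le> norm (?I (\<lambda>u s t. \<beta> u s * \<beta> u t * k u s t))" by simp
  also have "\<dots> \<le> ?I (\<lambda>u s t. (1/2) * ((\<beta> u s)\<^sup>2 * k u s t) + (1/2) * ((\<beta> u t)\<^sup>2 * k u s t))"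
  proof (rule integral3_norm_bound[OF c1(3) c2(1)])
    fix u s t assume "u \<in> {-w..w}" "s \<in> {p..q}" "t \<in> {p..q}"
    then have k: "0 \<le> k u s t" by (rule k0)
    have "\<bar>\<beta> u s * \<beta> u t\<bar> \<le> (1/2) * (\<beta> u s)\<^sup>2 + (1/2) * (\<beta> u t)\<^sup>2"
      using zero_le_power2[of "\<bar>\<beta> u s\<bar> - \<bar>\<beta> u t\<bar>"] by (simp add: power2_diff abs_mult)
    from mult_right_mono[OF this k]
    show "norm (\<beta> u s * \<beta> u t * k u s t) \<le> (1/2) * ((\<beta> u s)\<^sup>2 * k u s t) + (1/2) * ((\<beta> u t)\<^sup>2 * k u s t)"
      using k by (simp add: abs_mult algebra_simps)
  qed
  also have "\<dots> = (1/2) * ?I (\<lambda>u s t. (\<beta> u s)\<^sup>2 * k u s t) + (1/2) * ?I (\<lambda>u s t. (\<beta> u t)\<^sup>2 * k u s t)"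
    by (subst integral3_linear[OF c2(2) c1(2)]) simp
  also have "\<dots> \<le> K * ((q - p) * S)" using a1 a2 by linarith
  finally show ?thesis .
qed

text \<open>\<open>dv d\<close> is a combination of values of \<open>kap d\<close> and
  \<open>kap' d\<close> whose coefficients do not involve \<open>d\<close> and are continuous on a
  compact box, so one \<open>K\<close> serves every \<open>d\<close>.\<close>

lemma weight_bounds:
  "\<exists>K>0. \<forall>u\<in>{-w..w}. \<forall>s\<in>{p..q}. \<forall>t\<in>{p..q}. om u s * om u t \<le> K \<and> (\<forall>d. 0 < d \<longrightarrow> d \<le> 1 \<longrightarrow> \<bar>dv d u s t\<bar> \<le> K / d\<^sup>2)"
proof -
  define N where "N u s t = \<bar>om u s * om u t * (1 - gs u s - gs u t)\<bar>
     + \<bar>om u s * om u t * ((u * Eu u s - g u s * Es u s) - (u * Eu u t - g u t * Es u t))\<bar>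
     + \<bar>(u * omu u s - g u s * oms u s) * om u t + om u s * (u * omu u t - g u t * oms u t)\<bar>" for u s t
  have cpt: "compact Bx" by (intro compact_Times compact_Icc)
  have "continuous_on Bx (\<lambda>z. N (fst z) (fst (snd z)) (snd (snd z)))"
    unfolding N_def by (intro continuous_intros conts)
  from compact_imp_bounded[OF compact_continuous_image[OF this cpt]]
  obtain K1 where K1: "\<And>z. z \<in> Bx \<Longrightarrow> norm (N (fst z) (fst (snd z)) (snd (snd z))) \<le> K1"
    unfolding bounded_iff by blast
  have "continuous_on Bx (\<lambda>z. om (fst z) (fst (snd z)) * om (fst z) (snd (snd z)))"
    by (intro continuous_intros conts)
  from compact_imp_bounded[OF compact_continuous_image[OF this cpt]]
  obtain K2 where K2: "\<And>z. z \<in> Bx \<Longrightarrow> norm (om (fst z) (fst (snd z)) * om (fst z) (snd (snd z))) \<le> K2"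
    unfolding bounded_iff by blast
  show ?thesis
  proof (intro exI[of _ "\<bar>K1\<bar> + \<bar>K2\<bar> + 1"] conjI ballI allI impI)
    fix u s t assume i: "u \<in> {-w..w}" "s \<in> {p..q}" "t \<in> {p..q}"
    show "om u s * om u t \<le> \<bar>K1\<bar> + \<bar>K2\<bar> + 1" using K2[of "(u,s,t)"] i by auto
    fix d :: real assume d: "0 < d" "d \<le> 1"
    have tri: "\<bar>x1 * y1 + x2 * y2 + x1 * y3\<bar> \<le> \<bar>x1\<bar> * \<bar>y1\<bar> + \<bar>x2\<bar> * \<bar>y2\<bar> + \<bar>x1\<bar> * \<bar>y3\<bar>" for x1 x2 y1 y2 y3 :: real
      unfolding abs_mult[symmetric] by linarith
    have "\<bar>dv d u s t\<bar> \<le> \<bar>kap d (D u s t)\<bar> * \<bar>om u s * om u t * (1 - gs u s - gs u t)\<bar>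
     + \<bar>kap' d (D u s t)\<bar> * \<bar>om u s * om u t * ((u * Eu u s - g u s * Es u s) - (u * Eu u t - g u t * Es u t))\<bar>
     + \<bar>kap d (D u s t)\<bar> * \<bar>(u * omu u s - g u s * oms u s) * om u t + om u s * (u * omu u t - g u t * oms u t)\<bar>"
      unfolding dv_def using tri by (simp only: mult.assoc)
    also have "\<dots> \<le> (1 / d\<^sup>2) * N u s t"
      unfolding N_def distrib_left by (intro add_mono mult_right_mono kap_bounds d) auto
    also have "\<dots> \<le> (1 / d\<^sup>2) * (\<bar>K1\<bar> + \<bar>K2\<bar> + 1)"
      using K1[of "(u,s,t)"] i by (intro mult_left_mono) auto
    finally show "\<bar>dv d u s t\<bar> \<le> (\<bar>K1\<bar> + \<bar>K2\<bar> + 1) / d\<^sup>2" by simp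
  qed auto
qed

definition transported where
  "transported b bu bs H \<longleftrightarrow> continuous_on ({-w..w} \<times> {p..q}) (\<lambda>(u,s). b u s :: complex) \<and>
     continuous_on ({-w..w} \<times> {p..q}) (\<lambda>(u,s). bu u s) \<and>
     continuous_on ({-w..w} \<times> {p..q}) (\<lambda>(u,s). bs u s) \<and>
     (\<forall>u\<in>{-w..w}. \<forall>s\<in>{p..q}. ((\<lambda>u. b u s) has_vector_derivative bu u s) (at u within {-w..w}) \<and>
       (b u has_vector_derivative bs u s) (at s within {p..q}) \<and>
       of_real u * bu u s - of_real (g u s) * bs u s = - \<i> * of_real (H * E u s) * b u s)"

text \<open>The square of the inner integral is a double integral over \<open>s\<close> and
  \<open>t\<close>. The part near the diagonal, where \<open>D\<close> is at most about
  \<open>d\<close>, costs \<open>O(d)\<close> by Schur's test; on the rest the transport identity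
  gains \<open>1 / \<bar>H\<bar>\<close> against a weight of size
  \<open>1 / d\<^sup>2\<close>.\<close>

lemma oscillatory_bound:
  "\<exists>K>0. \<forall>b bu bs H S. transported b bu bs H \<longrightarrow> 1 \<le> \<bar>H\<bar> \<longrightarrow>
     (\<forall>s\<in>{p..q}. integral {-w..w} (\<lambda>u. (norm (b u s))\<^sup>2) \<le> S) \<longrightarrow>
     integral {-w..w} (\<lambda>u. (norm (integral {p..q} (\<lambda>s. b u s * of_real (om u s))))\<^sup>2) \<le> K * \<bar>H\<bar> powr (-1/3) * S"
proof -
  obtain K where K: "0 < K" "\<And>u s t. u \<in> {-w..w} \<Longrightarrow> s \<in> {p..q} \<Longrightarrow> t \<in> {p..q} \<Longrightarrow> om u s * om u t \<le> K"
    "\<And>u s t d. u \<in> {-w..w} \<Longrightarrow> s \<in> {p..q} \<Longrightarrow> t \<in> {p..q} \<Longrightarrow> 0 < d \<Longrightarrow> d \<le> 1 \<Longrightarrow> \<bar>dv d u s t\<bar> \<le> K / d\<^sup>2"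
    using weight_bounds by blast
  let ?I = "\<lambda>h. integral {-w..w} (\<lambda>u. integral {p..q} (\<lambda>s. integral {p..q} (\<lambda>t. h u s t)))"
  have "integral {-w..w} (\<lambda>u. (norm (integral {p..q} (\<lambda>s. b u s * of_real (om u s))))\<^sup>2)
      \<le> (q - p) * K * (pi / c + (q - p)) * \<bar>H\<bar> powr (-1/3) * S"
    if tr: "transported b bu bs H" and H: "1 \<le> \<bar>H\<bar>"
      and S: "\<And>s. s \<in> {p..q} \<Longrightarrow> integral {-w..w} (\<lambda>u. (norm (b u s))\<^sup>2) \<le> S" for b bu bs H S
  proof -
    \<comment> \<open>Makes the two contributions \<open>d\<close> and
      \<open>1 / (d\<^sup>2 * \<bar>H\<bar>)\<close> coincide.\<close>
    define d where "d = \<bar>H\<bar> powr (-1/3)"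
    have d: "0 < d" "d \<le> 1" "d \<noteq> 0" using H powr_mono[of "-1/3" 0 "\<bar>H\<bar>"] by (auto simp: d_def split: if_splits)
    have cb: "continuous_on ({-w..w} \<times> {p..q}) (\<lambda>(u,s). b u s)" using tr by (simp add: transported_def)
    have cn: "continuous_on ({-w..w} \<times> {p..q}) (\<lambda>(u,s). norm (b u s))"
      using cb unfolding case_prod_unfold by (intro continuous_intros)
    note cs = cont_st[OF cb]
    \<comment> \<open>By \<open>sep\<close> this dominates the near-diagonal weight, and the arctan
      bound controls its integral in \<open>s\<close> or \<open>t\<close> whatever \<open>E\<close>
      is.\<close>
    define k where "k u s t = K * (d\<^sup>2 / (d\<^sup>2 + (c * (s - t))\<^sup>2))" for u s t :: real
    have dpos: "d\<^sup>2 + x\<^sup>2 \<noteq> 0" for x using d by (simp add: add_nonneg_eq_0_iff)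
    have cL: "continuous_on Bx (\<lambda>z. d\<^sup>2 / (d\<^sup>2 + (D (fst z) (fst (snd z)) (snd (snd z)))\<^sup>2))"
      unfolding D_def by (intro continuous_intros conts) (use d in simp)
    have cD: "continuous_on Bx (\<lambda>z. D (fst z) (fst (snd z)) (snd (snd z)))"
      unfolding D_def by (intro continuous_intros conts)
    let ?Y1 = "\<lambda>u s t. b u s * cnj (b u t) * of_real (om u s * om u t * (d\<^sup>2 / (d\<^sup>2 + (D u s t)\<^sup>2)))"
    let ?Y2 = "\<lambda>u s t. b u s * cnj (b u t) * of_real (D u s t * kap d (D u s t) * om u s * om u t)"
    let ?X = "\<lambda>u s t. b u s * cnj (b u t) * of_real (dv d u s t)"
    have cY1: "continuous_on Bx (\<lambda>(u,s,t). ?Y1 u s t)"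
      unfolding case_prod_unfold by (intro continuous_intros conts cs cL)
    have cY2: "continuous_on Bx (\<lambda>(u,s,t). ?Y2 u s t)"
      unfolding case_prod_unfold by (intro continuous_intros conts cs cD cont_kap d)
    have cX: "continuous_on Bx (\<lambda>(u,s,t). ?X u s t)"
      unfolding case_prod_unfold by (intro continuous_intros conts cs cont_dv d)
    have ck: "continuous_on Bx (\<lambda>(u,s,t). k u s t)"
      unfolding case_prod_unfold k_def by (intro continuous_intros) (use d in simp)
    have ck2: "continuous_on Bx (\<lambda>(u,s,t). K / d\<^sup>2)"
      unfolding case_prod_unfold by (intro continuous_intros)
    have nb: "continuous_on Bx (\<lambda>(u,s,t). norm (b u s) * norm (b u t) * k u s t)"
       "continuous_on Bx (\<lambda>(u,s,t). norm (b u s) * norm (b u t) * (K / d\<^sup>2))"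
      using ck cs unfolding case_prod_unfold by (intro continuous_intros; simp)+
    have kK: "integral {p..q} (k u s) \<le> K * (pi * d / c)" for u s
    proof -
      have "integral {p..q} (k u s) = K * integral {p..q} (\<lambda>t. d\<^sup>2 / (d\<^sup>2 + (c * (s - t))\<^sup>2))"
        unfolding k_def[abs_def] by (rule integral_mult_right)
      then show ?thesis using mult_left_mono[OF integral_lorentz_le[OF c0 d(1), of p q s], of K] K(1) by simp
    qed
    have ksym: "k u s t = k u t s" for u s t
      by (simp add: k_def power2_commute[of s t] power_mult_distrib)
    have y1: "norm (?I ?Y1) \<le> (K * (pi * d / c)) * ((q - p) * S)"
    proof -
      have "norm (?I ?Y1) \<le> ?I (\<lambda>u s t. norm (b u s) * norm (b u t) * k u s t)"
      proof (rule integral3_norm_bound[OF cY1 nb(1)])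
        fix u s t assume i: "u \<in> {-w..w}" "s \<in> {p..q}" "t \<in> {p..q}"
        have "(c * (s - t))\<^sup>2 \<le> (D u s t)\<^sup>2"
          using sep[OF i] c0 by (subst abs_le_square_iff[symmetric]) (simp add: D_def abs_mult)
        then have "d\<^sup>2 / (d\<^sup>2 + (D u s t)\<^sup>2) \<le> d\<^sup>2 / (d\<^sup>2 + (c * (s - t))\<^sup>2)"
          using d by (intro divide_left_mono mult_pos_pos add_pos_nonneg) auto
        then have "om u s * om u t * (d\<^sup>2 / (d\<^sup>2 + (D u s t)\<^sup>2)) \<le> k u s t"
          unfolding k_def using K(1) K(2)[OF i] om_nonneg by (intro mult_mono) auto
        moreover have "0 \<le> om u s * om u t * (d\<^sup>2 / (d\<^sup>2 + (D u s t)\<^sup>2))" using om_nonneg by auto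
        ultimately show "norm (?Y1 u s t) \<le> norm (b u s) * norm (b u t) * k u s t"
          by (simp only: norm_mult complex_mod_cnj norm_of_real abs_of_nonneg) (intro mult_left_mono, auto)
      qed
      also have "\<dots> \<le> (K * (pi * d / c)) * ((q - p) * S)"
      proof (rule schur_bound[OF cn ck _ kK _ S])
        show "0 \<le> k u s t" for u s t using K(1) by (simp add: k_def)
        show "integral {p..q} (\<lambda>s. k u s t) \<le> K * (pi * d / c)" for u t
          using kK[of u t] by (subst ksym)
      qed (use K(1) c0 d in auto)
      finally show ?thesis .
    qed
    have x: "norm (?I ?X) \<le> ((q - p) * (K / d\<^sup>2)) * ((q - p) * S)"
    proof -
      have "norm (?I ?X) \<le> ?I (\<lambda>u s t. norm (b u s) * norm (b u t) * (K / d\<^sup>2))"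
      proof (rule integral3_norm_bound[OF cX nb(2)])
        fix u s t assume i: "u \<in> {-w..w}" "s \<in> {p..q}" "t \<in> {p..q}"
        show "norm (?X u s t) \<le> norm (b u s) * norm (b u t) * (K / d\<^sup>2)"
          using K(3)[OF i d(1,2)] by (simp only: norm_mult complex_mod_cnj norm_of_real) (intro mult_left_mono, auto)
      qed
      also have "\<dots> \<le> ((q - p) * (K / d\<^sup>2)) * ((q - p) * S)"
        by (rule schur_bound[OF cn ck2 _ _ _ S]) (use K(1) pq in auto)
      finally show ?thesis .
    qed
    have y2: "norm (?I ?Y2) \<le> ((q - p) * (K / d\<^sup>2)) * ((q - p) * S) / \<bar>H\<bar>"
    proof -
      have "\<i> * of_real H * ?I ?Y2 = ?I ?X"
        using tr d(3) unfolding transported_def by (intro transport_identity[where bu=bu and bs=bs]) blast+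
      then have "\<bar>H\<bar> * norm (?I ?Y2) = norm (?I ?X)" by (metis (no_types, lifting) norm_mult norm_of_real norm_ii mult_1)
      moreover have "y \<le> z / h" if "h * y = x" "x \<le> z" "1 \<le> h" for h x y z :: real
        using that by (simp add: field_simps)
      ultimately show ?thesis using x H by blast
    qed
    have split1: "x * y = x * y * A + A' * A'' * x * y" if "A + A' * A'' = 1" for x y A A' A'' :: real
      using that by algebra
    have split: "of_real ((norm (integral {p..q} (\<lambda>s. b u s * of_real (om u s))))\<^sup>2)
       = integral {p..q} (\<lambda>s. integral {p..q} (\<lambda>t. ?Y1 u s t + 1 * ?Y2 u s t))" if u: "u \<in> {-w..w}" for u
    proof -
      have "of_real ((norm (integral {p..q} (\<lambda>s. b u s * of_real (om u s))))\<^sup>2)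
        = integral {p..q} (\<lambda>s. b u s * of_real (om u s)) * cnj (integral {p..q} (\<lambda>t. b u t * of_real (om u t)))"
        by (rule complex_norm_square)
      also have "\<dots> = integral {p..q} (\<lambda>s. b u s * of_real (om u s)) * integral {p..q} (\<lambda>t. cnj (b u t) * of_real (om u t))"
        by (simp add: Henstock_Kurzweil_Integration.integral_cnj)
      also have "\<dots> = integral {p..q} (\<lambda>s. integral {p..q} (\<lambda>t. (b u s * of_real (om u s)) * (cnj (b u t) * of_real (om u t))))"
        by simp
      also have "\<dots> = integral {p..q} (\<lambda>s. integral {p..q} (\<lambda>t. ?Y1 u s t + 1 * ?Y2 u s t))"
      proof (intro integral_cong)
        fix s t
        have "d\<^sup>2 / (d\<^sup>2 + (D u s t)\<^sup>2) + D u s t * kap d (D u s t) = 1"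
        proof -
          have "d\<^sup>2 / (d\<^sup>2 + (D u s t)\<^sup>2) + D u s t * kap d (D u s t) = (d\<^sup>2 + (D u s t)\<^sup>2) / (d\<^sup>2 + (D u s t)\<^sup>2)"
            unfolding kap_def add_divide_distrib by (simp add: power2_eq_square)
          also have "\<dots> = 1" using dpos by (rule divide_self)
          finally show ?thesis .
        qed
        then have "om u s * om u t = om u s * om u t * (d\<^sup>2 / (d\<^sup>2 + (D u s t)\<^sup>2)) + D u s t * kap d (D u s t) * om u s * om u t"
          using split1 by blast
        then have "complex_of_real (om u s * om u t) = of_real (om u s * om u t * (d\<^sup>2 / (d\<^sup>2 + (D u s t)\<^sup>2)) + D u s t * kap d (D u s t) * om u s * om u t)"
          by simp
        then have "b u s * cnj (b u t) * complex_of_real (om u s * om u t) = ?Y1 u s t + 1 * ?Y2 u s t"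
          by (simp only: of_real_add distrib_left mult_1)
        then show "(b u s * of_real (om u s)) * (cnj (b u t) * of_real (om u t)) = ?Y1 u s t + 1 * ?Y2 u s t"
          by (simp add: algebra_simps)
      qed
      finally show ?thesis .
    qed
    have "complex_of_real (integral {-w..w} (\<lambda>u. (norm (integral {p..q} (\<lambda>s. b u s * of_real (om u s))))\<^sup>2))
       = integral {-w..w} (\<lambda>u. of_real ((norm (integral {p..q} (\<lambda>s. b u s * of_real (om u s))))\<^sup>2))"
      by (rule integral_interval_complex_of_real[symmetric])
    also have "\<dots> = ?I (\<lambda>u s t. ?Y1 u s t + 1 * ?Y2 u s t)"
      by (intro integral_cong split)
    also have "\<dots> = ?I ?Y1 + 1 * ?I ?Y2" by (rule integral3_linear[OF cY1 cY2])
    finally have "norm (complex_of_real (integral {-w..w} (\<lambda>u. (norm (integral {p..q} (\<lambda>s. b u s * of_real (om u s))))\<^sup>2)))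
       \<le> norm (?I ?Y1) + norm (?I ?Y2)" by (simp only: mult_1 norm_triangle_ineq)
    then have "integral {-w..w} (\<lambda>u. (norm (integral {p..q} (\<lambda>s. b u s * of_real (om u s))))\<^sup>2)
       \<le> (K * (pi * d / c)) * ((q - p) * S) + ((q - p) * (K / d\<^sup>2)) * ((q - p) * S) / \<bar>H\<bar>"
      using y1 y2 by (auto simp only: norm_of_real)
    also have "\<dots> = (q - p) * K * (pi / c * d + (q - p) * (1 / (d\<^sup>2 * \<bar>H\<bar>))) * S"
      by (simp add: algebra_simps add_divide_distrib diff_divide_distrib)
    also have "1 / (d\<^sup>2 * \<bar>H\<bar>) = d"
    proof -
      have "d * (d\<^sup>2 * \<bar>H\<bar>) = \<bar>H\<bar> powr (-1/3) * (\<bar>H\<bar> powr (-1/3) * \<bar>H\<bar> powr (-1/3) * \<bar>H\<bar> powr 1)"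
        using H by (simp add: d_def power2_eq_square)
      also have "\<dots> = 1" unfolding powr_add[symmetric] using H by simp
      finally show ?thesis using d H by (simp add: field_simps)
    qed
    finally show ?thesis by (simp add: d_def algebra_simps add_divide_distrib diff_divide_distrib)
  qed
  moreover have "(q - p) * K * (pi / c + (q - p)) > 0" using pq K c0 by (simp add: add_pos_pos)
  ultimately show ?thesis by blast
qed

end

section \<open>Trigonometric polynomials and divided differences\<close>

definition uexp :: "real \<Rightarrow> complex" where "uexp x = cis (2 * pi * x)"

lemma norm_uexp [simp]: "norm (uexp x) = 1"
  and uexp_0 [simp]: "uexp 0 = 1"
  and uexp_add: "uexp (x + y) = uexp x * uexp y"
  and cnj_uexp: "cnj (uexp x) = uexp (- x)"
  by (simp_all add: uexp_def cis_mult distrib_left cis_cnj)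

lemma uexp_of_int [simp]: "uexp (of_int k) = 1"
  unfolding uexp_def by (metis cis_multiple_2pi Ints_of_int)

lemma continuous_on_uexp [continuous_intros]: "continuous_on S f \<Longrightarrow> continuous_on S (\<lambda>x. uexp (f x))"
  unfolding uexp_def by (intro continuous_intros)

lemma uexp_has_vector_derivative:
  assumes "(f has_real_derivative f') (at x within S)"
  shows "((\<lambda>x. uexp (f x)) has_vector_derivative (2 * pi * \<i> * of_real f') * uexp (f x)) (at x within S)"
proof -
  have "((\<lambda>x. exp (\<i> * of_real (2 * pi * f x))) has_vector_derivative
      ((\<i> * of_real (2 * pi * f')) * exp (\<i> * of_real (2 * pi * f x)))) (at x within S)"
  proof (rule field_vector_diff_chain_within[where f = "\<lambda>x. \<i> * of_real (2 * pi * f x)" and g = exp, unfolded o_def])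
    have "((\<lambda>x. complex_of_real (2 * pi * f x)) has_vector_derivative of_real (2 * pi * f')) (at x within S)"
      using DERIV_cmult[OF assms, of "2 * pi"]
      by (intro has_vector_derivative_of_real) (simp add: has_real_derivative_iff_has_vector_derivative)
    then show "((\<lambda>x. \<i> * complex_of_real (2 * pi * f x)) has_vector_derivative \<i> * of_real (2 * pi * f')) (at x within S)"
      by (rule has_vector_derivative_mult_right)
  qed (auto intro!: derivative_eq_intros)
  then show ?thesis by (simp add: uexp_def cis_conv_exp mult_ac)
qed

lemma integral_uexp_period: "integral {x..x+1} (\<lambda>y. uexp (of_int n * y)) = (if n = 0 then 1 else 0)"
proof (cases "n = 0")
  case False
  let ?c = "1 / (2 * pi * \<i> * of_int n) :: complex"
  have "((\<lambda>y. ?c * uexp (of_int n * y)) has_vector_derivative uexp (of_int n * y)) (at y within {x..x+1})" for y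
  proof -
    have "((\<lambda>y. of_int n * y) has_real_derivative of_int n) (at y within {x..x+1})"
      by (auto intro!: derivative_eq_intros)
    from has_vector_derivative_mult_right[OF uexp_has_vector_derivative[OF this], of ?c]
    show ?thesis using False by simp
  qed
  from fundamental_theorem_of_calculus[of x "x+1", OF _ this]
  have "integral {x..x+1} (\<lambda>y. uexp (of_int n * y)) = ?c * uexp (of_int n * (x + 1)) - ?c * uexp (of_int n * x)"
    by (auto intro!: integral_unique)
  also have "uexp (of_int n * (x + 1)) = uexp (of_int n * x)"
    by (simp add: distrib_left uexp_add)
  finally show ?thesis using False by simp
qed simp

definition trigpoly :: "int set \<Rightarrow> (int \<Rightarrow> complex) \<Rightarrow> real \<Rightarrow> complex" where
  "trigpoly S a x = (\<Sum>k\<in>S. a k * uexp (of_int k * x))"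

lemma continuous_on_trigpoly [continuous_intros]:
  "continuous_on T f \<Longrightarrow> continuous_on T (\<lambda>x. trigpoly S a (f x))"
  unfolding trigpoly_def by (intro continuous_intros)

lemma norm_trigpoly_le: "norm (trigpoly S a x) \<le> (\<Sum>k\<in>S. norm (a k))"
  unfolding trigpoly_def by (rule order_trans[OF norm_sum]) (simp add: norm_mult)

lemma norm_trigpoly_square:
  "of_real ((norm (trigpoly S a x))\<^sup>2) = (\<Sum>k\<in>S. \<Sum>l\<in>S. a k * cnj (a l) * uexp (of_int (k - l) * x))"
  unfolding complex_norm_square trigpoly_def cnj_sum sum_product
  by (intro sum.cong) (auto simp: cnj_uexp uexp_add[symmetric] algebra_simps)

lemma parseval_period:
  assumes "finite S"
  shows "integral {x..x+1} (\<lambda>y. (norm (trigpoly S a y))\<^sup>2) = (\<Sum>k\<in>S. (norm (a k))\<^sup>2)"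
proof -
  have "complex_of_real (integral {x..x+1} (\<lambda>y. (norm (trigpoly S a y))\<^sup>2))
      = integral {x..x+1} (\<lambda>y. \<Sum>k\<in>S. \<Sum>l\<in>S. a k * cnj (a l) * uexp (of_int (k - l) * y))"
    unfolding integral_interval_complex_of_real[symmetric] norm_trigpoly_square ..
  also have "\<dots> = (\<Sum>k\<in>S. \<Sum>l\<in>S. integral {x..x+1} (\<lambda>y. a k * cnj (a l) * uexp (of_int (k - l) * y)))"
    using assms by (subst integral_sum, (auto intro!: integrable_continuous_real continuous_intros)[2])
      (intro sum.cong refl integral_sum; auto intro!: integrable_continuous_real continuous_intros)
  also have "\<dots> = (\<Sum>k\<in>S. \<Sum>l\<in>S. if k = l then a k * cnj (a l) else 0)"
    by (intro sum.cong refl) (simp add: integral_uexp_period del: of_int_diff)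
  also have "\<dots> = of_real (\<Sum>k\<in>S. (norm (a k))\<^sup>2)"
    using assms by (simp add: complex_norm_square del: of_real_power)
  finally show ?thesis by (simp only: of_real_eq_iff)
qed

lemma trigpoly_L2_le:
  assumes "finite S" "y - x \<le> 1"
  shows "integral {x..y} (\<lambda>y. (norm (trigpoly S a y))\<^sup>2) \<le> (\<Sum>k\<in>S. (norm (a k))\<^sup>2)"
  unfolding parseval_period[OF assms(1), of x a, symmetric]
  by (rule integral_subset_le) (use assms in \<open>auto intro!: integrable_continuous_real continuous_intros\<close>)

lemma trigpoly_has_vector_derivative:
  assumes "(f has_real_derivative f') (at x within T)"
  shows "((\<lambda>x. trigpoly S a (f x)) has_vector_derivative of_real f' * trigpoly S (\<lambda>k. 2 * pi * \<i> * of_int k * a k) (f x)) (at x within T)"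
proof -
  have "((\<lambda>x. \<Sum>k\<in>S. a k * uexp (of_int k * f x)) has_vector_derivative
      (\<Sum>k\<in>S. a k * ((2 * pi * \<i> * of_real (of_int k * f')) * uexp (of_int k * f x)))) (at x within T)"
    by (intro has_vector_derivative_sum has_vector_derivative_mult_right uexp_has_vector_derivative DERIV_cmult assms)
  then show ?thesis
    unfolding trigpoly_def by (simp add: sum_distrib_left mult_ac)
qed

text \<open>Substitute \<open>y = Q x\<close>: the sign \<open>\<sigma>\<close> makes
  \<open>\<sigma> * Q\<close> increasing, the Jacobian costs \<open>1 / c\<close>, and the image has
  length at most 1, so Parseval over one period gives a bound without any dependence on the
  frequencies.\<close>

lemma trigpoly_substitution_le:
  fixes Q Q' :: "real \<Rightarrow> real"
  assumes S: "finite S" and ab: "a \<le> b" and c: "0 < c" and sg: "\<sigma> = 1 \<or> \<sigma> = -1"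
    and Q: "\<And>x. x \<in> {a..b} \<Longrightarrow> (Q has_real_derivative Q' x) (at x within {a..b})"
    and Q': "\<And>x. x \<in> {a..b} \<Longrightarrow> c \<le> \<sigma> * Q' x" and cQ': "continuous_on {a..b} Q'"
    and len: "\<sigma> * (Q b - Q a) \<le> 1"
  shows "integral {a..b} (\<lambda>x. (norm (trigpoly S f (Q x)))\<^sup>2) \<le> (\<Sum>k\<in>S. (norm (f k))\<^sup>2) / c"
proof -
  define g where "g x = \<sigma> * Q x" for x
  define h where "h y = (norm (trigpoly S f (\<sigma> * y)))\<^sup>2" for y
  have hg: "h (g x) = (norm (trigpoly S f (Q x)))\<^sup>2" for x
    using sg by (auto simp: h_def g_def)
  have g: "(g has_real_derivative \<sigma> * Q' x) (at x within {a..b})" if "x \<in> {a..b}" for x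
    unfolding g_def by (intro DERIV_cmult Q that)
  have gmono: "g x \<le> g y" if "a \<le> x" "x \<le> y" "y \<le> b" for x y
  proof -
    have "((\<lambda>x. \<sigma> * Q' x) has_integral g y - g x) {x..y}"
    proof (rule fundamental_theorem_of_calculus[OF that(2)])
      fix z assume z: "z \<in> {x..y}"
      then have "(g has_vector_derivative \<sigma> * Q' z) (at z within {a..b})"
        using g[of z] that by (simp add: has_real_derivative_iff_has_vector_derivative)
      then show "(g has_vector_derivative \<sigma> * Q' z) (at z within {x..y})"
        by (rule has_vector_derivative_within_subset) (use that in auto)
    qed
    then have "0 \<le> g y - g x"
      by (rule has_integral_nonneg) (use Q' c that in \<open>force intro: order_trans[of 0 c]\<close>)
    then show ?thesis by simp
  qed
  have contQ: "continuous_on {a..b} Q"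
    using Q by (intro DERIV_continuous_on)
  have conth: "continuous_on T h" for T unfolding h_def by (intro continuous_intros)
  have "((\<lambda>x. (\<sigma> * Q' x) *\<^sub>R h (g x)) has_integral integral {g a..g b} h) {a..b}"
  proof (rule has_integral_substitution[OF ab])
    show "g a \<le> g b" using gmono ab by simp
    show "g ` {a..b} \<subseteq> {g a..g b}" using gmono by auto
  qed (use g conth in auto)
  then have int: "integral {a..b} (\<lambda>x. \<sigma> * Q' x * h (g x)) = integral {g a..g b} h" by (auto intro: integral_unique)
  have "integral {g a..g b} h \<le> (\<Sum>k\<in>S. (norm (f k))\<^sup>2)"
  proof (cases "\<sigma> = 1")
    case True
    then show ?thesis using trigpoly_L2_le[OF S, of "g b" "g a" f] len by (simp add: h_def[abs_def] g_def algebra_simps)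
  next
    case False
    then have s: "\<sigma> = -1" using sg by simp
    \<comment> \<open>A decreasing \<open>Q\<close> reflects the variable; the reflection is
      absorbed by conjugating the coefficients, which keeps their moduli.\<close>
    have "norm (trigpoly S f (- y)) = norm (trigpoly S (\<lambda>k. cnj (f k)) y)" for y
    proof -
      have "trigpoly S f (- y) = cnj (trigpoly S (\<lambda>k. cnj (f k)) y)"
        by (simp add: trigpoly_def cnj_uexp)
      then show ?thesis by simp
    qed
    then have "h = (\<lambda>y. (norm (trigpoly S (\<lambda>k. cnj (f k)) y))\<^sup>2)" by (auto simp: h_def s)
    then show ?thesis using trigpoly_L2_le[OF S, of "g b" "g a" "\<lambda>k. cnj (f k)"] len by (simp add: g_def algebra_simps)
  qed
  moreover have "c * integral {a..b} (\<lambda>x. h (g x)) \<le> integral {a..b} (\<lambda>x. \<sigma> * Q' x * h (g x))"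
  proof -
    have "integral {a..b} (\<lambda>x. c * h (g x)) \<le> integral {a..b} (\<lambda>x. \<sigma> * Q' x * h (g x))"
      by (intro integral_le integrable_continuous_real)
        (auto simp: hg intro!: continuous_intros contQ cQ' mult_right_mono Q')
    then show ?thesis by simp
  qed
  ultimately show ?thesis using int c by (simp add: hg field_simps)
qed

text \<open>Squaring makes the truncation continuously differentiable. The bump \<open>r\<close>
  below has this form; single integrations by parts need no more smoothness.\<close>

lemma has_real_derivative_max_0_square:
  "((\<lambda>y. (max 0 y)\<^sup>2) has_real_derivative 2 * max 0 y) (at y)" for y :: real
proof -
  consider "0 < y" | "y < 0" | "y = 0" by linarith
  then show ?thesis
  proof cases
    case 1
    have "((\<lambda>y. y\<^sup>2) has_real_derivative 2 * max 0 y) (at y)" using 1 by (auto intro!: derivative_eq_intros)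
    then show ?thesis by (rule has_field_derivative_transform_within_open[of _ _ _ "{0<..}"]) (use 1 in auto)
  next
    case 2
    have "((\<lambda>y. 0) has_real_derivative 2 * max 0 y) (at y)" using 2 by (auto intro!: derivative_eq_intros)
    then show ?thesis by (rule has_field_derivative_transform_within_open[of _ _ _ "{..<0}"]) (use 2 in auto)
  next
    case 3
    have "((\<lambda>h. (max 0 h)\<^sup>2 / h) \<longlongrightarrow> 0) (at (0::real))"
    proof (rule Lim_null_comparison)
      show "\<forall>\<^sub>F h in at (0::real). norm ((max 0 h)\<^sup>2 / h) \<le> \<bar>h\<bar>"
        by (intro always_eventually) (auto simp: max_def power2_eq_square)
      show "((\<lambda>h. \<bar>h\<bar>) \<longlongrightarrow> 0) (at (0::real))" by (rule tendsto_eq_intros refl | simp)+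
    qed
    then show ?thesis using 3 by (simp add: has_field_derivative_iff)
  qed
qed

text \<open>Horner's rule: for \<open>a + x * r x\<close> the quotient is
  \<open>r (s + u) + s * d u s\<close>. Building it recursively instead of dividing by
  \<open>u\<close> makes smoothness across \<open>u = 0\<close> part of the induction.\<close>

lemma poly_divided_difference:
  fixes R :: "real poly"
  shows "\<exists>d du ds. (\<forall>u s. poly R (s + u) - poly R s = u * d u s) \<and> (\<forall>s. d 0 s = poly (pderiv R) s) \<and>
    (\<forall>u s. ((\<lambda>u. d u s) has_real_derivative du u s) (at u) \<and> (d u has_real_derivative ds u s) (at s)) \<and>
    continuous_on UNIV (\<lambda>(u,s). d u s) \<and> continuous_on UNIV (\<lambda>(u,s). du u s) \<and> continuous_on UNIV (\<lambda>(u,s). ds u s)"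
proof (induction R)
  case 0
  show ?case
    by (intro exI[of _ "\<lambda>_ _. 0"]) auto
next
  case (pCons a r)
  then obtain d du ds where d: "\<And>u s. poly r (s + u) - poly r s = u * d u s" "\<And>s. d 0 s = poly (pderiv r) s"
    "\<And>u s. ((\<lambda>u. d u s) has_real_derivative du u s) (at u)" "\<And>u s. (d u has_real_derivative ds u s) (at s)"
    and cont: "continuous_on UNIV (\<lambda>(u,s). d u s)" "continuous_on UNIV (\<lambda>(u,s). du u s)" "continuous_on UNIV (\<lambda>(u,s). ds u s)"
    by blast
  have 1: "poly (pCons a r) (s + u) - poly (pCons a r) s = u * (poly r (s + u) + s * d u s)" for u s
  proof -
    have "poly (pCons a r) (s + u) - poly (pCons a r) s = u * poly r (s + u) + s * (poly r (s + u) - poly r s)"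
      by (simp add: algebra_simps)
    then show ?thesis by (simp add: d(1) algebra_simps)
  qed
  show ?case
  proof (rule exI[of _ "\<lambda>u s. poly r (s + u) + s * d u s"], rule exI[of _ "\<lambda>u s. poly (pderiv r) (s + u) + s * du u s"],
      rule exI[of _ "\<lambda>u s. poly (pderiv r) (s + u) + (d u s + s * ds u s)"], intro conjI allI 1)
    fix u s
    show "poly r (s + 0) + s * d 0 s = poly (pderiv (pCons a r)) s" by (simp add: pderiv_pCons d(2))
    show "((\<lambda>u. poly r (s + u) + s * d u s) has_real_derivative poly (pderiv r) (s + u) + s * du u s) (at u)"
      by (auto intro!: derivative_eq_intros DERIV_chain2[OF poly_DERIV] d(3))
    show "((\<lambda>s. poly r (s + u) + s * d u s) has_real_derivative poly (pderiv r) (s + u) + (d u s + s * ds u s)) (at s)"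
      by (auto intro!: derivative_eq_intros DERIV_chain2[OF poly_DERIV] d(4))
  qed (use cont in \<open>auto simp: case_prod_unfold intro!: continuous_intros\<close>)
qed

section \<open>A nondegenerate piece of the curve\<close>

text \<open>\<open>dq u s\<close> is the quotient \<open>(P'(s + u) - P'(s)) / u\<close> continued to \<open>u = 0\<close>. The last assumption bounds the
  \<open>s\<close>-derivative of \<open>P'(s + u) / dq u s \<cdot> (1 - P'(s))\<close>, which at \<open>u = 0\<close> is \<open>(P' (1 - P') / P'')'\<close>.\<close>

locale good_curve =
  fixes P :: "real poly" and p q c \<sigma> \<tau> :: real and dq dqu dqs :: "real \<Rightarrow> real \<Rightarrow> real"
  assumes p0: "0 < p" and pq: "p < q" and c0: "0 < c"
    and sgn1: "\<sigma> = 1 \<or> \<sigma> = -1" and sgn2: "\<tau> = 1 \<or> \<tau> = -1"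
    and short: "q - p \<le> 1/2"
    and len: "\<And>s. s \<in> {p..q} \<Longrightarrow> \<sigma> * (poly P (s + (q - p)) - poly P (s - (q - p))) \<le> 1"
    and dq_eq: "\<And>u s. poly (pderiv P) (s + u) - poly (pderiv P) s = u * dq u s"
    and dq_u: "\<And>u s. ((\<lambda>u. dq u s) has_real_derivative dqu u s) (at u)"
    and dq_s: "\<And>u s. (dq u has_real_derivative dqs u s) (at s)"
    and dq_cont: "continuous_on UNIV (\<lambda>(u,s). dq u s)" "continuous_on UNIV (\<lambda>(u,s). dqu u s)" "continuous_on UNIV (\<lambda>(u,s). dqs u s)"
    and P1_lb: "\<And>u s. u \<in> {-(q-p)..q-p} \<Longrightarrow> s \<in> {p..q} \<Longrightarrow> c \<le> \<sigma> * poly (pderiv P) (s + u)"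
    and P2_lb: "\<And>s. s \<in> {p..q} \<Longrightarrow> c \<le> \<tau> * poly (pderiv (pderiv P)) s"
    and dq_nz: "\<And>u s. u \<in> {-(q-p)..q-p} \<Longrightarrow> s \<in> {p..q} \<Longrightarrow> dq u s \<noteq> 0"
    and Es_lb: "\<And>u s. u \<in> {-(q-p)..q-p} \<Longrightarrow> s \<in> {p..q} \<Longrightarrow>
        c \<le> \<bar>(poly (pderiv (pderiv P)) (s + u) * dq u s - poly (pderiv P) (s + u) * dqs u s) / (dq u s)\<^sup>2 * (1 - poly (pderiv P) s)
              - poly (pderiv P) (s + u) / dq u s * poly (pderiv (pderiv P)) s\<bar>"
begin

abbreviation P0 where "P0 \<equiv> poly P"
abbreviation P1 where "P1 \<equiv> poly (pderiv P)"
abbreviation P2 where "P2 \<equiv> poly (pderiv (pderiv P))"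
abbreviation w where "w \<equiv> q - p"

text \<open>The solution of \<open>u * P1 (s + u) = g u s * (P1 (s + u) - P1 s)\<close>, written
  with \<open>dq\<close> so that it stays regular at \<open>u = 0\<close>.\<close>

definition g where "g u s = P1 (s + u) / dq u s"
definition gu where "gu u s = (P2 (s + u) * dq u s - P1 (s + u) * dqu u s) / (dq u s)\<^sup>2"
definition gs where "gs u s = (P2 (s + u) * dq u s - P1 (s + u) * dqs u s) / (dq u s)\<^sup>2"
definition E where "E u s = g u s * (1 - P1 s)"
definition Eu where "Eu u s = gu u s * (1 - P1 s)"
definition Es where "Es u s = gs u s * (1 - P1 s) - g u s * P2 s"
definition r where "r x = (max 0 ((x - p) * (q - x)))\<^sup>2"
definition r' where "r' x = 2 * max 0 ((x - p) * (q - x)) * (p + q - 2 * x)"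
text \<open>What becomes of \<open>r s * r t\<close> under \<open>t = s + u\<close>. At
  \<open>u = w\<close> and \<open>u = - w\<close> the point \<open>s + u\<close> has left the
  interior of \<open>{p..q}\<close>, so the weight vanishes on the whole boundary of the
  box.\<close>

definition om where "om u s = r s * r (s + u)"
definition omu where "omu u s = r s * r' (s + u)"
definition oms where "oms u s = r' s * r (s + u) + r s * r' (s + u)"

lemma r_nonneg: "0 \<le> r x" by (simp add: r_def)

lemma r_zero: "x \<le> p \<or> q \<le> x \<Longrightarrow> r x = 0"
proof -
  assume "x \<le> p \<or> q \<le> x"
  then have "(x - p) * (q - x) \<le> 0" using pq by (auto simp: mult_le_0_iff)
  then show ?thesis by (simp add: r_def max_def)
qed

lemma r_deriv: "(r has_real_derivative r' x) (at x)"
proof -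
  have "((\<lambda>x. (x - p) * (q - x)) has_real_derivative (p + q - 2 * x)) (at x)"
    by (auto intro!: derivative_eq_intros simp: algebra_simps)
  from DERIV_chain2[OF has_real_derivative_max_0_square this] show ?thesis
    unfolding r_def[abs_def] r'_def .
qed

lemma continuous_on_r [continuous_intros]:
  "continuous_on S f \<Longrightarrow> continuous_on S (\<lambda>x. r (f x))"
  "continuous_on S f \<Longrightarrow> continuous_on S (\<lambda>x. r' (f x))"
  unfolding r_def r'_def by (intro continuous_intros; assumption)+

lemma P_deriv: "(P0 has_real_derivative P1 x) (at x)" "(P1 has_real_derivative P2 x) (at x)"
  by (rule poly_DERIV)+

lemma shift_deriv: "((\<lambda>u. s + u) has_real_derivative 1) (at u within S)" "((\<lambda>s. s + u) has_real_derivative 1) (at s within S)"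
  by (auto intro!: derivative_eq_intros)

lemma P1_shift: "((\<lambda>u. P1 (s + u)) has_real_derivative P2 (s + u)) (at u)" "((\<lambda>s. P1 (s + u)) has_real_derivative P2 (s + u)) (at s)"
  "((\<lambda>u. P0 (s + u)) has_real_derivative P1 (s + u)) (at u)" "((\<lambda>s. P0 (s + u)) has_real_derivative P1 (s + u)) (at s)"
  "((\<lambda>u. r (s + u)) has_real_derivative r' (s + u)) (at u)" "((\<lambda>s. r (s + u)) has_real_derivative r' (s + u)) (at s)"
  using DERIV_chain2[OF P_deriv(2) shift_deriv(1)[of s u UNIV]] DERIV_chain2[OF P_deriv(2) shift_deriv(2)[of u s UNIV]]
    DERIV_chain2[OF P_deriv(1) shift_deriv(1)[of s u UNIV]] DERIV_chain2[OF P_deriv(1) shift_deriv(2)[of u s UNIV]]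
    DERIV_chain2[OF r_deriv shift_deriv(1)[of s u UNIV]] DERIV_chain2[OF r_deriv shift_deriv(2)[of u s UNIV]]
  by simp_all

lemma g_deriv:
  assumes "dq u s \<noteq> 0"
  shows "((\<lambda>u. g u s) has_real_derivative gu u s) (at u)" "(g u has_real_derivative gs u s) (at s)"
  unfolding g_def[abs_def] gu_def gs_def power2_eq_square
  by (rule DERIV_divide P1_shift dq_u dq_s assms)+

lemma E_deriv:
  assumes "dq u s \<noteq> 0"
  shows "((\<lambda>u. E u s) has_real_derivative Eu u s) (at u)" "(E u has_real_derivative Es u s) (at s)"
proof -
  show "((\<lambda>u. E u s) has_real_derivative Eu u s) (at u)"
    unfolding E_def Eu_def by (rule DERIV_cmult_right g_deriv assms)+
  have "((\<lambda>s. 1 - P1 s) has_real_derivative - P2 s) (at s)"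
    by (auto intro!: derivative_eq_intros P_deriv)
  from DERIV_mult[OF g_deriv(2)[OF assms] this] show "(E u has_real_derivative Es u s) (at s)"
    unfolding E_def[abs_def] Es_def by (simp add: algebra_simps)
qed

lemma cont_dq: "continuous_on T (\<lambda>z. dq (fst z) (snd z))" "continuous_on T (\<lambda>z. dqu (fst z) (snd z))" "continuous_on T (\<lambda>z. dqs (fst z) (snd z))"
  using dq_cont by (auto simp: case_prod_unfold elim: continuous_on_subset)

text \<open>\<open>Es_lb\<close> keeps the \<open>s\<close>-derivative of \<open>E\<close> away from
  0, and the mean value theorem turns this into the separation \<open>sep\<close>.\<close>

sublocale transport_box w p q c g gs E Eu Es om omu oms
proof
  have nz: "\<forall>z\<in>{-w..w} \<times> {p..q}. dq (fst z) (snd z) \<noteq> 0" using dq_nz by auto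
  show "continuous_on ({-w..w} \<times> {p..q}) (\<lambda>(u,s). g u s)"
    "continuous_on ({-w..w} \<times> {p..q}) (\<lambda>(u,s). gs u s)"
    "continuous_on ({-w..w} \<times> {p..q}) (\<lambda>(u,s). E u s)"
    "continuous_on ({-w..w} \<times> {p..q}) (\<lambda>(u,s). Eu u s)"
    "continuous_on ({-w..w} \<times> {p..q}) (\<lambda>(u,s). Es u s)"
    unfolding case_prod_unfold g_def gs_def gu_def E_def Eu_def Es_def
    by (intro continuous_intros cont_dq; use nz in simp)+
  show "continuous_on ({-w..w} \<times> {p..q}) (\<lambda>(u,s). om u s)"
    "continuous_on ({-w..w} \<times> {p..q}) (\<lambda>(u,s). omu u s)"
    "continuous_on ({-w..w} \<times> {p..q}) (\<lambda>(u,s). oms u s)"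
    unfolding case_prod_unfold om_def omu_def oms_def
    by (intro continuous_intros)+
  fix u s assume us: "u \<in> {-w..w}" "s \<in> {p..q}"
  note dq = dq_nz[OF us]
  show "(g u has_real_derivative gs u s) (at s within {p..q})" "((\<lambda>u. E u s) has_real_derivative Eu u s) (at u within {-w..w})"
    "(E u has_real_derivative Es u s) (at s within {p..q})"
    by (rule has_field_derivative_at_within[OF g_deriv(2)[OF dq]] has_field_derivative_at_within[OF E_deriv(1)[OF dq]]
        has_field_derivative_at_within[OF E_deriv(2)[OF dq]])+
  show "((\<lambda>u. om u s) has_real_derivative omu u s) (at u within {-w..w})"
    unfolding om_def omu_def by (rule has_field_derivative_at_within[OF DERIV_cmult[OF P1_shift(5)]])
  have "((\<lambda>s. r s * r (s + u)) has_real_derivative oms u s) (at s)"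
  proof -
    have "((\<lambda>s. r s * r (s + u)) has_real_derivative r' s * r (s + u) + r' (s + u) * r s) (at s)"
      by (rule DERIV_mult[OF r_deriv P1_shift(6)])
    then show ?thesis by (simp add: oms_def mult.commute)
  qed
  then show "(om u has_real_derivative oms u s) (at s within {p..q})"
    unfolding om_def[abs_def] by (rule has_field_derivative_at_within)
next
  show "om w s = 0" "om (- w) s = 0" if "s \<in> {p..q}" for s
    using that by (auto simp: om_def r_zero)
  show "om u p = 0" "om u q = 0" for u by (auto simp: om_def r_zero)
  show "0 \<le> om u s" for u s by (simp add: om_def r_nonneg)
  fix u s t assume ust: "u \<in> {-w..w}" "s \<in> {p..q}" "t \<in> {p..q}"
  have "c * (y - x) \<le> \<bar>E u y - E u x\<bar>" if xy: "x \<in> {p..q}" "y \<in> {p..q}" "x < y" for x y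
  proof -
    have "\<exists>z>x. z < y \<and> E u y - E u x = (y - x) * Es u z"
      by (rule MVT2[OF xy(3)]) (use xy ust dq_nz in \<open>auto intro!: E_deriv\<close>)
    then obtain z where z: "x < z" "z < y" "E u y - E u x = (y - x) * Es u z" by blast
    have "c \<le> \<bar>Es u z\<bar>" using Es_lb[OF ust(1), of z] z xy unfolding Es_def gs_def g_def by auto
    then show ?thesis using z xy by (simp add: abs_mult mult.commute)
  qed
  from this[of s t] this[of t s] show "c * \<bar>s - t\<bar> \<le> \<bar>E u s - E u t\<bar>"
    using ust by (cases s t rule: linorder_cases) (auto simp: abs_minus_commute)
qed (use pq c0 in auto)

text \<open>The field kills every function of \<open>P0 (s + u) - P0 s\<close>, so arbitrary
  coefficients are allowed and only the factor with \<open>h\<close> oscillates along it. The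
  constant is uniform in \<open>S\<close> and \<open>a\<close> because the norm of the amplitude is
  computed by substituting \<open>y = P0 (s + u) - P0 s\<close> and applying Parseval.\<close>

lemma bilinear_decay:
  "\<exists>K>0. \<forall>S a h. finite S \<longrightarrow> h \<noteq> 0 \<longrightarrow>
     integral {-w..w} (\<lambda>u. (norm (integral {p..q} (\<lambda>s. trigpoly S a (P0 (s + u) - P0 s) * uexp (of_int h * (s - P0 s)) * of_real (om u s))))\<^sup>2)
       \<le> K * \<bar>of_int h\<bar> powr (-1/3) * (\<Sum>k\<in>S. (norm (a k))\<^sup>2)"
proof -
  obtain K where K: "0 < K" "\<And>b bu bs H S. transported b bu bs H \<Longrightarrow> 1 \<le> \<bar>H\<bar> \<Longrightarrow>
     (\<forall>s\<in>{p..q}. integral {-w..w} (\<lambda>u. (norm (b u s))\<^sup>2) \<le> S) \<Longrightarrow>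
     integral {-w..w} (\<lambda>u. (norm (integral {p..q} (\<lambda>s. b u s * of_real (om u s))))\<^sup>2) \<le> K * \<bar>H\<bar> powr (-1/3) * S"
    using oscillatory_bound by blast
  have "integral {-w..w} (\<lambda>u. (norm (integral {p..q} (\<lambda>s. trigpoly S a (P0 (s + u) - P0 s) * uexp (of_int h * (s - P0 s)) * of_real (om u s))))\<^sup>2)
       \<le> K / c * \<bar>of_int h\<bar> powr (-1/3) * (\<Sum>k\<in>S. (norm (a k))\<^sup>2)"
    if S: "finite S" and h: "h \<noteq> 0" for S a and h :: int
  proof -
    define a' where "a' k = 2 * pi * \<i> * of_int k * a k" for k
    define b where "b u s = trigpoly S a (P0 (s + u) - P0 s) * uexp (of_int h * (s - P0 s))" for u s
    define bu where "bu u s = of_real (P1 (s + u)) * trigpoly S a' (P0 (s + u) - P0 s) * uexp (of_int h * (s - P0 s))" for u s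
    define bs where "bs u s = trigpoly S a (P0 (s + u) - P0 s) * ((2 * pi * \<i> * of_real (of_int h * (1 - P1 s))) * uexp (of_int h * (s - P0 s)))
       + of_real (P1 (s + u) - P1 s) * trigpoly S a' (P0 (s + u) - P0 s) * uexp (of_int h * (s - P0 s))" for u s
    have tr: "transported b bu bs (2 * pi * of_int h)"
      unfolding transported_def
    proof (intro conjI ballI)
      show "continuous_on ({-w..w} \<times> {p..q}) (\<lambda>(u,s). b u s)"
        "continuous_on ({-w..w} \<times> {p..q}) (\<lambda>(u,s). bu u s)"
        "continuous_on ({-w..w} \<times> {p..q}) (\<lambda>(u,s). bs u s)"
        unfolding case_prod_unfold b_def bu_def bs_def by (intro continuous_intros)+
      fix u s assume us: "u \<in> {-w..w}" "s \<in> {p..q}"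
      have "((\<lambda>u. P0 (s + u) - P0 s) has_real_derivative P1 (s + u)) (at u within {-w..w})"
        using has_field_derivative_at_within[OF DERIV_diff[OF P1_shift(3) DERIV_const]] by simp
      from has_vector_derivative_mult_left[OF trigpoly_has_vector_derivative[OF this, of S a]]
      show "((\<lambda>u. b u s) has_vector_derivative bu u s) (at u within {-w..w})"
        unfolding b_def bu_def a'_def .
      have 1: "((\<lambda>s. P0 (s + u) - P0 s) has_real_derivative P1 (s + u) - P1 s) (at s within {p..q})"
        by (intro has_field_derivative_at_within[OF DERIV_diff[OF P1_shift(4) P_deriv(1)]])
      have 2: "((\<lambda>s. of_int h * (s - P0 s)) has_real_derivative of_int h * (1 - P1 s)) (at s within {p..q})"
        by (intro DERIV_cmult DERIV_diff DERIV_ident has_field_derivative_at_within[OF P_deriv(1)])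
      show "(b u has_vector_derivative bs u s) (at s within {p..q})"
        unfolding b_def[abs_def] bs_def a'_def
        by (rule has_vector_derivative_mult[OF trigpoly_has_vector_derivative[OF 1] uexp_has_vector_derivative[OF 2]])
      have "of_real u * bu u s - of_real (g u s) * bs u s
        = of_real (u * P1 (s + u) - g u s * (P1 (s + u) - P1 s)) * trigpoly S a' (P0 (s + u) - P0 s) * uexp (of_int h * (s - P0 s))
          - \<i> * of_real (2 * pi * of_int h * (g u s * (1 - P1 s))) * b u s"
        unfolding bu_def bs_def b_def by (simp add: algebra_simps)
      \<comment> \<open>The defining relation of \<open>g\<close>: the term with the coefficients
        \<open>a'\<close>, which would grow with the frequencies, drops out.\<close>
      also have "u * P1 (s + u) - g u s * (P1 (s + u) - P1 s) = 0"
        unfolding g_def using dq_eq[of s u] dq_nz[OF us] by simp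
      finally show "of_real u * bu u s - of_real (g u s) * bs u s = - \<i> * of_real (2 * pi * of_int h * E u s) * b u s"
        by (simp add: E_def)
    qed
    have S2: "\<forall>s\<in>{p..q}. integral {-w..w} (\<lambda>u. (norm (b u s))\<^sup>2) \<le> (\<Sum>k\<in>S. (norm (a k))\<^sup>2) / c"
    proof
      fix s assume s: "s \<in> {p..q}"
      have "integral {-w..w} (\<lambda>u. (norm (trigpoly S a (P0 (s + u) - P0 s)))\<^sup>2) \<le> (\<Sum>k\<in>S. (norm (a k))\<^sup>2) / c"
      proof (rule trigpoly_substitution_le[OF S _ c0 sgn1])
        show "((\<lambda>u. P0 (s + u) - P0 s) has_real_derivative P1 (s + u)) (at u within {-w..w})" for u
          using has_field_derivative_at_within[OF DERIV_diff[OF P1_shift(3) DERIV_const]] by simp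
        show "c \<le> \<sigma> * P1 (s + u)" if "u \<in> {-w..w}" for u by (rule P1_lb[OF that s])
        show "\<sigma> * ((P0 (s + w) - P0 s) - (P0 (s + - w) - P0 s)) \<le> 1"
          using len[OF s] by (simp add: algebra_simps)
      qed (use pq in \<open>auto intro!: continuous_intros\<close>)
      then show "integral {-w..w} (\<lambda>u. (norm (b u s))\<^sup>2) \<le> (\<Sum>k\<in>S. (norm (a k))\<^sup>2) / c"
        by (simp add: b_def norm_mult)
    qed
    have h1: "1 \<le> \<bar>of_int h :: real\<bar>" using h by linarith
    have pih: "\<bar>of_int h :: real\<bar> \<le> \<bar>2 * pi * of_int h\<bar>"
      using mult_right_mono[of 1 "2 * pi" "\<bar>of_int h :: real\<bar>"] pi_gt3 by (simp add: abs_mult)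
    have "integral {-w..w} (\<lambda>u. (norm (integral {p..q} (\<lambda>s. b u s * of_real (om u s))))\<^sup>2)
       \<le> K * \<bar>2 * pi * of_int h\<bar> powr (-1/3) * ((\<Sum>k\<in>S. (norm (a k))\<^sup>2) / c)"
      by (rule K(2)[OF tr _ S2]) (use pih h1 in linarith)
    also have "\<dots> \<le> K * \<bar>of_int h\<bar> powr (-1/3) * ((\<Sum>k\<in>S. (norm (a k))\<^sup>2) / c)"
      using K(1) c0 h1 pih by (intro mult_right_mono mult_left_mono powr_mono2') (auto intro!: sum_nonneg divide_nonneg_pos)
    finally show ?thesis by (simp add: b_def field_simps)
  qed
  then show ?thesis using K(1) c0 by (intro exI[of _ "K / c"]) auto
qed



section \<open>The Fourier multiplier of the bilinear average and its decay\<close>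

definition m :: "real \<Rightarrow> real \<Rightarrow> complex" where
  "m \<xi> \<eta> = integral {p..q} (\<lambda>t. uexp (\<xi> * t + \<eta> * P0 t) * of_real (r t))"

definition Mr where "Mr = (SOME M. 0 < M \<and> (\<forall>t\<in>{p..q}. r t \<le> M \<and> \<bar>r' t\<bar> \<le> M \<and> \<bar>P1 t\<bar> \<le> M \<and> \<bar>P2 t\<bar> \<le> M))"

lemma Mr: "0 < Mr" "t \<in> {p..q} \<Longrightarrow> r t \<le> Mr" "t \<in> {p..q} \<Longrightarrow> \<bar>r' t\<bar> \<le> Mr"
  "t \<in> {p..q} \<Longrightarrow> \<bar>P1 t\<bar> \<le> Mr" "t \<in> {p..q} \<Longrightarrow> \<bar>P2 t\<bar> \<le> Mr"
proof -
  have "continuous_on {p..q} (\<lambda>t. r t + \<bar>r' t\<bar> + \<bar>P1 t\<bar> + \<bar>P2 t\<bar>)" by (intro continuous_intros)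
  from compact_imp_bounded[OF compact_continuous_image[OF this compact_Icc]]
  obtain M where M: "\<And>t. t \<in> {p..q} \<Longrightarrow> \<bar>r t + \<bar>r' t\<bar> + \<bar>P1 t\<bar> + \<bar>P2 t\<bar>\<bar> \<le> M" unfolding bounded_iff by fastforce
  have "\<exists>M. 0 < M \<and> (\<forall>t\<in>{p..q}. r t \<le> M \<and> \<bar>r' t\<bar> \<le> M \<and> \<bar>P1 t\<bar> \<le> M \<and> \<bar>P2 t\<bar> \<le> M)"
  proof (intro exI[of _ "\<bar>M\<bar> + 1"] conjI ballI)
    fix t assume "t \<in> {p..q}"
    note * = M[OF this] r_nonneg[of t]
    show "r t \<le> \<bar>M\<bar> + 1" "\<bar>r' t\<bar> \<le> \<bar>M\<bar> + 1" "\<bar>P1 t\<bar> \<le> \<bar>M\<bar> + 1" "\<bar>P2 t\<bar> \<le> \<bar>M\<bar> + 1"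
      using * by linarith+
  qed simp
  from someI_ex[OF this, folded Mr_def]
  show "0 < Mr" "t \<in> {p..q} \<Longrightarrow> r t \<le> Mr" "t \<in> {p..q} \<Longrightarrow> \<bar>r' t\<bar> \<le> Mr"
    "t \<in> {p..q} \<Longrightarrow> \<bar>P1 t\<bar> \<le> Mr" "t \<in> {p..q} \<Longrightarrow> \<bar>P2 t\<bar> \<le> Mr" by auto
qed

definition r0 :: real where "r0 = integral {p..q} r"

lemma r0_pos: "0 < r0"
proof -
  have cr: "continuous_on {p..q} r" by (intro continuous_intros)
  have "r0 \<noteq> 0"
  proof
    assume "r0 = 0"
    then have "\<forall>x\<in>{p..q}. r x = 0"
      using integral_eq_0_iff[OF cr pq] r_nonneg by (simp add: r0_def)
    then have "r ((p + q) / 2) = 0" using pq by auto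
    moreover have "((p + q) / 2 - p) * (q - (p + q) / 2) > 0" using pq by (intro mult_pos_pos) auto
    ultimately show False by (simp add: r_def)
  qed
  moreover have "0 \<le> r0" unfolding r0_def by (intro integral_nonneg integrable_continuous_real cr r_nonneg)
  ultimately show ?thesis by simp
qed

lemma phase_deriv: "((\<lambda>t. \<xi> * t + \<eta> * P0 t) has_real_derivative \<xi> + \<eta> * P1 t) (at t within S)"
  "((\<lambda>t. \<xi> + \<eta> * P1 t) has_real_derivative \<eta> * P2 t) (at t within S)"
proof -
  have "((\<lambda>t. \<xi> * t + \<eta> * P0 t) has_real_derivative \<xi> * 1 + \<eta> * P1 t) (at t)"
    by (intro DERIV_add DERIV_cmult DERIV_ident P_deriv)
  then show "((\<lambda>t. \<xi> * t + \<eta> * P0 t) has_real_derivative \<xi> + \<eta> * P1 t) (at t within S)"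
    by (simp add: has_field_derivative_at_within)
  have "((\<lambda>t. \<xi> + \<eta> * P1 t) has_real_derivative 0 + \<eta> * P2 t) (at t)"
    by (intro DERIV_add DERIV_cmult DERIV_const P_deriv)
  then show "((\<lambda>t. \<xi> + \<eta> * P1 t) has_real_derivative \<eta> * P2 t) (at t within S)"
    by (simp add: has_field_derivative_at_within)
qed

text \<open>The phase derivative \<open>\<xi> + \<eta> * P1 t\<close> is kept as a factor instead of
  being divided out, so that \<open>f\<close> may be the exact quotient or a regularised one. The
  factor \<open>2 * pi\<close> only helps and is dropped.\<close>

lemma integral_by_parts_phase:
  fixes f f' :: "real \<Rightarrow> real"
  assumes f: "\<And>t. t \<in> {p..q} \<Longrightarrow> (f has_real_derivative f' t) (at t within {p..q})"
    and 0: "f p = 0" "f q = 0" and cf': "continuous_on {p..q} f'"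
  shows "norm (integral {p..q} (\<lambda>t. uexp (\<xi> * t + \<eta> * P0 t) * of_real ((\<xi> + \<eta> * P1 t) * f t)))
     \<le> integral {p..q} (\<lambda>t. \<bar>f' t\<bar>)"
proof -
  let ?e = "\<lambda>t. uexp (\<xi> * t + \<eta> * P0 t)"
  let ?A = "\<lambda>t. ?e t * of_real ((\<xi> + \<eta> * P1 t) * f t)"
  have cf: "continuous_on {p..q} f" by (rule DERIV_continuous_on[OF f])
  have iA: "?A integrable_on {p..q}" by (intro integrable_continuous_real continuous_intros cf)
  have iB: "(\<lambda>t. ?e t * of_real (f' t)) integrable_on {p..q}" by (intro integrable_continuous_real continuous_intros cf')
  have "integral {p..q} (\<lambda>t. ?e t * of_real (f' t) + (2 * pi * \<i>) * ?A t) = 0"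
  proof (rule integral_derivative_eq_0)
    fix t assume t: "t \<in> {p..q}"
    have "((\<lambda>t. complex_of_real (f t)) has_vector_derivative of_real (f' t)) (at t within {p..q})"
      using f[OF t] by (intro has_vector_derivative_of_real) (simp add: has_real_derivative_iff_has_vector_derivative)
    from has_vector_derivative_mult[OF uexp_has_vector_derivative[OF phase_deriv(1)] this, of \<xi> \<eta>]
    show "((\<lambda>t. ?e t * of_real (f t)) has_vector_derivative (?e t * of_real (f' t) + (2 * pi * \<i>) * ?A t)) (at t within {p..q})"
      by (rule back_subst[of "\<lambda>x. (_ has_vector_derivative x) _"]) (simp only: of_real_mult mult_ac)
  qed (use 0 in auto)
  moreover have "integral {p..q} (\<lambda>t. ?e t * of_real (f' t) + (2 * pi * \<i>) * ?A t)
      = integral {p..q} (\<lambda>t. ?e t * of_real (f' t)) + (2 * pi * \<i>) * integral {p..q} ?A"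
    unfolding integral_add[OF iB integrable_on_mult_right[OF iA]] integral_mult_right ..
  moreover have gen: "norm k * norm b = norm a" if "a + k * b = 0" for a b k :: complex
  proof -
    have "k * b = - a" using that by (simp add: eq_neg_iff_add_eq_0 add.commute)
    then show ?thesis by (metis norm_mult norm_minus_cancel)
  qed
  ultimately have "norm (2 * pi * \<i>) * norm (integral {p..q} ?A) = norm (integral {p..q} (\<lambda>t. ?e t * of_real (f' t)))"
    by (intro gen) simp
  then have "2 * pi * norm (integral {p..q} ?A) = norm (integral {p..q} (\<lambda>t. ?e t * of_real (f' t)))"
    by (simp add: norm_mult[of _ \<i>] norm_mult[of 2])
  also have "\<dots> \<le> integral {p..q} (\<lambda>t. \<bar>f' t\<bar>)"
    by (rule integral_norm_bound_integral[OF iB])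
      (auto simp: norm_mult intro!: integrable_continuous_real continuous_intros cf')
  finally have "2 * pi * norm (integral {p..q} ?A) \<le> integral {p..q} (\<lambda>t. \<bar>f' t\<bar>)" .
  moreover have "1 * norm (integral {p..q} ?A) \<le> 2 * pi * norm (integral {p..q} ?A)"
    using pi_gt3 by (intro mult_right_mono) auto
  ultimately show ?thesis by linarith
qed

text \<open>The regularisation of \<open>kap\<close> replaces the usual splitting at the stationary
  point. With \<open>y\<close> the phase derivative, 1 is written as \<open>L t\<close> plus
  \<open>y t\<close> times \<open>y t / (d\<^sup>2 + (y t)\<^sup>2)\<close>. As \<open>y\<close> is
  monotone with slope at least \<open>c * \<bar>\<eta>\<bar>\<close>, an arctan integrates the first
  part; the second is integrated by parts. The choice \<open>d = sqrt \<bar>\<eta>\<bar>\<close>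
  makes both of size \<open>1 / d\<close>, uniformly in \<open>\<xi>\<close>.\<close>

lemma van_der_Corput:
  assumes "\<eta> \<noteq> 0"
  shows "norm (m \<xi> \<eta>) \<le> (Mr * pi / c + Mr * pi + Mr) * \<bar>\<eta>\<bar> powr (-1/2)"
proof -
  define d where "d = sqrt \<bar>\<eta>\<bar>"
  have d: "0 < d" and d2: "d\<^sup>2 = \<bar>\<eta>\<bar>" using assms by (auto simp: d_def)
  define y where "y t = \<xi> + \<eta> * P1 t" for t
  have cy: "continuous_on {p..q} y" unfolding y_def by (intro continuous_intros)
  have yd: "(y has_real_derivative \<eta> * P2 t) (at t within {p..q})" for t unfolding y_def by (rule phase_deriv)
  have pos: "0 < d\<^sup>2 + (y t)\<^sup>2" for t using d(1) by (simp add: add_pos_nonneg)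
  have ny: "d\<^sup>2 + (y t)\<^sup>2 \<noteq> 0" for t by (metis pos less_irrefl)
  define L where "L t = d\<^sup>2 / (d\<^sup>2 + (y t)\<^sup>2)" for t
  have L0: "0 \<le> L t" for t using pos[of t] by (simp add: L_def)
  have cL: "continuous_on {p..q} L" unfolding L_def by (intro continuous_intros cy) (use ny in auto)
  \<comment> \<open>The sign for which \<open>s * y t\<close> is increasing in
    \<open>t\<close>.\<close>
  define s where "s = \<tau> * sgn \<eta>"
  have s: "s = 1 \<or> s = -1" using sgn2 assms by (auto simp: s_def sgn_if)
  have sy: "c * \<bar>\<eta>\<bar> \<le> s * (\<eta> * P2 t)" if "t \<in> {p..q}" for t
  proof -
    have e: "s * (\<eta> * P2 t) = \<tau> * P2 t * \<bar>\<eta>\<bar>" unfolding s_def abs_sgn by (simp only: mult_ac)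
    show ?thesis unfolding e by (rule mult_right_mono[OF P2_lb[OF that]]) simp
  qed
  have intL: "integral {p..q} (\<lambda>t. L t * (s * (\<eta> * P2 t))) \<le> pi * d"
  proof -
    have "((\<lambda>t. s * d * arctan (y t / d)) has_vector_derivative L t * (s * (\<eta> * P2 t))) (at t within {p..q})" for t
    proof -
      have "((\<lambda>t. s * d * arctan (y t / d)) has_real_derivative s * d * (inverse (1 + (y t / d)\<^sup>2) * (\<eta> * P2 t / d))) (at t within {p..q})"
        by (intro DERIV_cmult DERIV_chain2[OF DERIV_arctan] DERIV_cdivide yd)
      also have "s * d * (inverse (1 + (y t / d)\<^sup>2) * (\<eta> * P2 t / d)) = inverse (1 + (y t / d)\<^sup>2) * (s * (\<eta> * P2 t))"
        using d by simp
      also have "inverse (1 + (y t / d)\<^sup>2) = L t"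
        using d unfolding L_def by (simp add: power_divide add_divide_eq_iff inverse_eq_divide)
      finally show ?thesis by (simp add: has_real_derivative_iff_has_vector_derivative)
    qed
    from fundamental_theorem_of_calculus[OF less_imp_le[OF pq] this]
    have "integral {p..q} (\<lambda>t. L t * (s * (\<eta> * P2 t))) = d * (s * arctan (y q / d) - s * arctan (y p / d))"
      by (subst integral_unique, assumption) (simp add: algebra_simps)
    also have "\<dots> \<le> d * pi"
      using arctan_bounded[of "y q / d"] arctan_bounded[of "y p / d"] d s by (intro mult_left_mono) auto
    finally show ?thesis by (simp add: mult.commute)
  qed
  have intL1: "integral {p..q} L \<le> pi * d / (c * \<bar>\<eta>\<bar>)"
  proof -
    have "integral {p..q} (\<lambda>t. c * \<bar>\<eta>\<bar> * L t) \<le> integral {p..q} (\<lambda>t. L t * (s * (\<eta> * P2 t)))"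
    proof (rule integral_le)
      show "c * \<bar>\<eta>\<bar> * L t \<le> L t * (s * (\<eta> * P2 t))" if "t \<in> {p..q}" for t
        using mult_left_mono[OF sy[OF that] L0[of t]] by (simp add: mult_ac)
    qed (intro integrable_continuous_real continuous_intros cL)+
    then have "c * \<bar>\<eta>\<bar> * integral {p..q} L \<le> pi * d" using intL by simp
    then show ?thesis using c0 assms by (simp add: field_simps)
  qed
  define f where "f t = y t / (d\<^sup>2 + (y t)\<^sup>2) * r t" for t
  define f' where "f' t = (d\<^sup>2 - (y t)\<^sup>2) / (d\<^sup>2 + (y t)\<^sup>2)\<^sup>2 * (\<eta> * P2 t) * r t + y t / (d\<^sup>2 + (y t)\<^sup>2) * r' t" for t
  have fd: "(f has_real_derivative f' t) (at t within {p..q})" for t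
  proof -
    have "((\<lambda>t. d\<^sup>2 + (y t)\<^sup>2) has_real_derivative 0 + of_nat 2 * (\<eta> * P2 t * y t ^ (2 - Suc 0))) (at t within {p..q})"
      by (intro DERIV_add DERIV_const DERIV_power yd)
    from DERIV_mult[OF DERIV_divide[OF yd this ny] has_field_derivative_at_within[OF r_deriv]]
    have "((\<lambda>t. y t / (d\<^sup>2 + (y t)\<^sup>2) * r t) has_real_derivative
      (\<eta> * P2 t * (d\<^sup>2 + (y t)\<^sup>2) - y t * (0 + of_nat 2 * (\<eta> * P2 t * y t ^ (2 - Suc 0)))) / ((d\<^sup>2 + (y t)\<^sup>2) * (d\<^sup>2 + (y t)\<^sup>2)) * r t
        + r' t * (y t / (d\<^sup>2 + (y t)\<^sup>2))) (at t within {p..q})" .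
    also have "\<eta> * P2 t * (d\<^sup>2 + (y t)\<^sup>2) - y t * (0 + of_nat 2 * (\<eta> * P2 t * y t ^ (2 - Suc 0))) = (d\<^sup>2 - (y t)\<^sup>2) * (\<eta> * P2 t)"
      by (simp add: power2_eq_square algebra_simps)
    finally show ?thesis unfolding f_def[abs_def] f'_def by (simp add: power2_eq_square mult_ac)
  qed
  have cf': "continuous_on {p..q} f'"
    unfolding f'_def by (intro continuous_intros cy) (use ny in auto)
  have f'le: "\<bar>f' t\<bar> \<le> Mr / d\<^sup>2 * (L t * (s * (\<eta> * P2 t))) + Mr / d" if t: "t \<in> {p..q}" for t
  proof -
    have "\<bar>d\<^sup>2 - (y t)\<^sup>2\<bar> \<le> d\<^sup>2 + (y t)\<^sup>2" by (simp add: abs_le_iff)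
    then have "\<bar>(d\<^sup>2 - (y t)\<^sup>2) / (d\<^sup>2 + (y t)\<^sup>2)\<^sup>2\<bar> \<le> (d\<^sup>2 + (y t)\<^sup>2) / (d\<^sup>2 + (y t)\<^sup>2)\<^sup>2"
      by (simp add: divide_right_mono)
    also have "\<dots> = 1 / d\<^sup>2 * L t" using pos[of t] d by (simp add: L_def power2_eq_square)
    finally have k': "\<bar>(d\<^sup>2 - (y t)\<^sup>2) / (d\<^sup>2 + (y t)\<^sup>2)\<^sup>2\<bar> \<le> 1 / d\<^sup>2 * L t" .
    have "2 * (d * \<bar>y t\<bar>) \<le> d\<^sup>2 + (y t)\<^sup>2"
      using zero_le_power2[of "d - \<bar>y t\<bar>"] by (simp add: power2_diff)
    moreover have "0 \<le> d * \<bar>y t\<bar>" using d by simp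
    ultimately have "d * \<bar>y t\<bar> \<le> d\<^sup>2 + (y t)\<^sup>2" by linarith
    then have "d * \<bar>y t\<bar> / (d\<^sup>2 + (y t)\<^sup>2) \<le> 1" using pos[of t] by (simp only: divide_le_eq_1_pos)
    moreover have "a / x \<le> 1 / d" if "d * a / x \<le> 1" for a x :: real
      using divide_right_mono[OF that, of d] d by simp
    ultimately have k: "\<bar>y t / (d\<^sup>2 + (y t)\<^sup>2)\<bar> \<le> 1 / d"
      unfolding abs_divide abs_of_pos[OF pos] by blast
    have ab: "\<bar>\<eta> * P2 t\<bar> = s * (\<eta> * P2 t)"
    proof -
      have "0 \<le> s * (\<eta> * P2 t)" using sy[OF t] c0 by (intro order_trans[OF _ sy[OF t]]) auto
      then have "\<bar>s * (\<eta> * P2 t)\<bar> = s * (\<eta> * P2 t)" by simp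
      moreover have "\<bar>s\<bar> = 1" using s by auto
      ultimately show ?thesis by (simp only: abs_mult[of s] mult_1)
    qed
    have "\<bar>f' t\<bar> \<le> \<bar>(d\<^sup>2 - (y t)\<^sup>2) / (d\<^sup>2 + (y t)\<^sup>2)\<^sup>2\<bar> * \<bar>\<eta> * P2 t\<bar> * r t + \<bar>y t / (d\<^sup>2 + (y t)\<^sup>2)\<bar> * \<bar>r' t\<bar>"
      unfolding f'_def using r_nonneg[of t] by (intro order_trans[OF abs_triangle_ineq]) (simp add: abs_mult)
    also have "\<dots> \<le> (1 / d\<^sup>2 * L t) * \<bar>\<eta> * P2 t\<bar> * Mr + 1 / d * Mr"
      by (intro add_mono mult_mono k k' Mr(2,3) t mult_nonneg_nonneg r_nonneg) (use L0[of t] d in auto)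
    finally show ?thesis unfolding ab by (simp add: mult_ac)
  qed
  have intf': "integral {p..q} (\<lambda>t. \<bar>f' t\<bar>) \<le> Mr * pi / d + Mr / d"
  proof -
    have "integral {p..q} (\<lambda>t. \<bar>f' t\<bar>) \<le> integral {p..q} (\<lambda>t. Mr / d\<^sup>2 * (L t * (s * (\<eta> * P2 t))) + Mr / d)"
      by (intro integral_le integrable_continuous_real continuous_intros cf' cL f'le)
    also have "\<dots> = Mr / d\<^sup>2 * integral {p..q} (\<lambda>t. L t * (s * (\<eta> * P2 t))) + Mr / d * (q - p)"
      by (subst integral_add) (use pq d in \<open>auto intro!: integrable_continuous_real continuous_intros cL\<close>)
    also have "\<dots> \<le> Mr / d\<^sup>2 * (pi * d) + Mr / d * 1"
      using d Mr(1) short by (intro add_mono mult_left_mono intL) auto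
    also have "\<dots> = Mr * pi / d + Mr / d" using d by (simp add: power2_eq_square)
    finally show ?thesis .
  qed
  let ?e = "\<lambda>t. uexp (\<xi> * t + \<eta> * P0 t)"
  have cfc: "continuous_on {p..q} f" by (rule DERIV_continuous_on[OF fd])
  have "m \<xi> \<eta> = integral {p..q} (\<lambda>t. ?e t * of_real (L t * r t) + ?e t * of_real ((\<xi> + \<eta> * P1 t) * f t))"
    unfolding m_def
  proof (rule integral_cong)
    fix t
    have "L t * r t + (\<xi> + \<eta> * P1 t) * f t = (d\<^sup>2 + (y t)\<^sup>2) / (d\<^sup>2 + (y t)\<^sup>2) * r t"
      unfolding L_def f_def y_def[symmetric] add_divide_distrib by (simp add: power2_eq_square algebra_simps)
    also have "\<dots> = r t" by (simp only: divide_self[OF ny] mult_1)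
    finally have "r t = L t * r t + (\<xi> + \<eta> * P1 t) * f t" ..
    then show "?e t * of_real (r t) = ?e t * of_real (L t * r t) + ?e t * of_real ((\<xi> + \<eta> * P1 t) * f t)"
      by (metis distrib_left of_real_add)
  qed
  also have "\<dots> = integral {p..q} (\<lambda>t. ?e t * of_real (L t * r t)) + integral {p..q} (\<lambda>t. ?e t * of_real ((\<xi> + \<eta> * P1 t) * f t))"
    by (intro integral_add integrable_continuous_real continuous_intros cL cfc)
  finally have "norm (m \<xi> \<eta>) \<le> norm (integral {p..q} (\<lambda>t. ?e t * of_real (L t * r t)))
      + norm (integral {p..q} (\<lambda>t. ?e t * of_real ((\<xi> + \<eta> * P1 t) * f t)))"
    by (simp only: norm_triangle_ineq)
  moreover have "norm (integral {p..q} (\<lambda>t. ?e t * of_real (L t * r t))) \<le> integral {p..q} (\<lambda>t. Mr * L t)"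
  proof (rule integral_norm_bound_integral)
    show "norm (?e t * of_real (L t * r t)) \<le> Mr * L t" if "t \<in> {p..q}" for t
      using Mr(2)[OF that] L0[of t] r_nonneg[of t] by (simp add: norm_mult mult.commute mult_left_mono)
  qed (intro integrable_continuous_real continuous_intros cL)+
  moreover have "integral {p..q} (\<lambda>t. Mr * L t) \<le> Mr * (pi * d / (c * \<bar>\<eta>\<bar>))"
    using mult_left_mono[OF intL1, of Mr] Mr(1) by simp
  moreover have "norm (integral {p..q} (\<lambda>t. ?e t * of_real ((\<xi> + \<eta> * P1 t) * f t))) \<le> Mr * pi / d + Mr / d"
    by (rule order_trans[OF integral_by_parts_phase[OF fd _ _ cf'] intf']) (auto simp: f_def r_zero)
  ultimately have le: "norm (m \<xi> \<eta>) \<le> Mr * (pi * d / (c * \<bar>\<eta>\<bar>)) + (Mr * pi / d + Mr / d)" by linarith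
  have pd: "pi * d / (c * \<bar>\<eta>\<bar>) = pi / c * (1 / d)"
    unfolding d2[symmetric] using d by (simp add: power2_eq_square)
  have "Mr * (pi * d / (c * \<bar>\<eta>\<bar>)) + (Mr * pi / d + Mr / d) = (Mr * pi / c + Mr * pi + Mr) * (1 / d)"
    unfolding pd by (simp add: add_divide_distrib)
  moreover have "1 / d = \<bar>\<eta>\<bar> powr (-1/2)"
  proof -
    have "\<bar>\<eta>\<bar> powr (-1/2) = \<bar>\<eta>\<bar> powr (-(1/2))" by simp
    also have "\<dots> = inverse d" unfolding powr_minus d_def powr_half_sqrt[OF abs_ge_zero] ..
    finally show ?thesis by (simp only: inverse_eq_divide)
  qed
  ultimately show ?thesis using le by (simp only:)
qed

text \<open>If \<open>\<xi>\<close> dominates, the phase derivative never falls below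
  \<open>\<bar>\<xi>\<bar> / 2\<close> in modulus, and one integration by parts with the exact
  quotient \<open>r t / y t\<close> suffices.\<close>

lemma nonstationary:
  assumes "\<xi> \<noteq> 0" and le: "2 * Mr * \<bar>\<eta>\<bar> \<le> \<bar>\<xi>\<bar>"
  shows "norm (m \<xi> \<eta>) \<le> 4 * Mr / \<bar>\<xi>\<bar>"
proof -
  define y where "y t = \<xi> + \<eta> * P1 t" for t
  have cy: "continuous_on {p..q} y" unfolding y_def by (intro continuous_intros)
  have yd: "(y has_real_derivative \<eta> * P2 t) (at t within {p..q})" for t unfolding y_def by (rule phase_deriv)
  have yl: "\<bar>\<xi>\<bar> / 2 \<le> \<bar>y t\<bar>" if "t \<in> {p..q}" for t
  proof -
    have "\<bar>\<eta> * P1 t\<bar> \<le> \<bar>\<eta>\<bar> * Mr" unfolding abs_mult by (intro mult_left_mono Mr that) auto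
    moreover have "\<bar>\<eta>\<bar> * Mr \<le> \<bar>\<xi>\<bar> / 2" using le by (simp add: mult_ac)
    ultimately show ?thesis unfolding y_def using abs_triangle_ineq2[of \<xi> "- (\<eta> * P1 t)"] by simp
  qed
  have ny: "y t \<noteq> 0" if "t \<in> {p..q}" for t using yl[OF that] assms by auto
  define f where "f t = r t / y t" for t
  define f' where "f' t = (r' t * y t - r t * (\<eta> * P2 t)) / (y t * y t)" for t
  have fd: "(f has_real_derivative f' t) (at t within {p..q})" if "t \<in> {p..q}" for t
    unfolding f_def[abs_def] f'_def
    by (rule DERIV_divide[OF has_field_derivative_at_within[OF r_deriv] yd ny[OF that]])
  have cf': "continuous_on {p..q} f'"
    unfolding f'_def by (intro continuous_intros cy) (use ny in auto)
  have f'le: "\<bar>f' t\<bar> \<le> 4 * Mr / \<bar>\<xi>\<bar>" if t: "t \<in> {p..q}" for t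
  proof -
    have x: "0 < \<bar>\<xi>\<bar> / 2" using assms by simp
    have "f' t = r' t / y t - r t * (\<eta> * P2 t) / (y t * y t)"
      using ny[OF t] by (simp add: f'_def diff_divide_distrib)
    then have "\<bar>f' t\<bar> \<le> \<bar>r' t\<bar> / \<bar>y t\<bar> + r t * (\<bar>\<eta>\<bar> * \<bar>P2 t\<bar>) / (\<bar>y t\<bar> * \<bar>y t\<bar>)"
      using abs_triangle_ineq4[of "r' t / y t" "r t * (\<eta> * P2 t) / (y t * y t)"] r_nonneg[of t]
      by (simp add: abs_mult abs_divide)
    also have "\<dots> \<le> Mr / (\<bar>\<xi>\<bar> / 2) + Mr * (\<bar>\<eta>\<bar> * Mr) / ((\<bar>\<xi>\<bar> / 2) * (\<bar>\<xi>\<bar> / 2))"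
      by (intro add_mono frac_le mult_mono mult_pos_pos x yl t Mr) (use x Mr(1) in auto)
    also have "Mr * (\<bar>\<eta>\<bar> * Mr) / ((\<bar>\<xi>\<bar> / 2) * (\<bar>\<xi>\<bar> / 2)) \<le> Mr * (\<bar>\<xi>\<bar> / 2) / ((\<bar>\<xi>\<bar> / 2) * (\<bar>\<xi>\<bar> / 2))"
      using le Mr(1) by (intro divide_right_mono mult_left_mono) (auto simp: mult.commute)
    also have "Mr / (\<bar>\<xi>\<bar> / 2) + Mr * (\<bar>\<xi>\<bar> / 2) / ((\<bar>\<xi>\<bar> / 2) * (\<bar>\<xi>\<bar> / 2)) = 4 * Mr / \<bar>\<xi>\<bar>"
      using assms(1) by (simp add: field_simps)
    finally show ?thesis by simp
  qed
  have "m \<xi> \<eta> = integral {p..q} (\<lambda>t. uexp (\<xi> * t + \<eta> * P0 t) * of_real ((\<xi> + \<eta> * P1 t) * f t))"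
    unfolding m_def by (rule integral_cong) (use ny in \<open>simp add: f_def y_def\<close>)
  also have "norm \<dots> \<le> integral {p..q} (\<lambda>t. \<bar>f' t\<bar>)"
    by (rule integral_by_parts_phase[OF fd _ _ cf']) (auto simp: f_def r_zero)
  also have "\<dots> \<le> integral {p..q} (\<lambda>t. 4 * Mr / \<bar>\<xi>\<bar>)"
    by (intro integral_le f'le integrable_continuous_real continuous_intros cf')
  also have "\<dots> = (q - p) * (4 * Mr / \<bar>\<xi>\<bar>)" using pq by simp
  also have "\<dots> \<le> 1 * (4 * Mr / \<bar>\<xi>\<bar>)" using short Mr(1) by (intro mult_right_mono) auto
  finally show ?thesis by simp
qed

lemma multiplier_decay:
  "\<exists>K>0. \<forall>R \<xi> \<eta>. 1 \<le> R \<longrightarrow> R \<le> max \<bar>\<xi>\<bar> \<bar>\<eta>\<bar> \<longrightarrow> norm (m \<xi> \<eta>) \<le> K * R powr (-1/2)"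
proof -
  define K0 where "K0 = Mr * pi / c + Mr * pi + Mr"
  \<comment> \<open>The threshold between the two regimes: \<open>A * \<bar>\<eta>\<bar> < R\<close>
    forces \<open>\<bar>\<xi>\<bar> \<ge> R > 2 * Mr * \<bar>\<eta>\<bar>\<close>, which is the
    range of \<open>nonstationary\<close>.\<close>
  define A where "A = 2 * Mr + 1"
  have K0: "0 < K0" unfolding K0_def using Mr(1) c0 by (simp add: add_pos_pos)
  have A: "1 \<le> A" unfolding A_def using Mr(1) by simp
  have "norm (m \<xi> \<eta>) \<le> (K0 * A powr (1/2) + 4 * Mr) * R powr (-1/2)" if R: "1 \<le> R" "R \<le> max \<bar>\<xi>\<bar> \<bar>\<eta>\<bar>" for R \<xi> \<eta>
  proof (cases "R \<le> A * \<bar>\<eta>\<bar>")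
    case True
    then have "\<eta> \<noteq> 0" using R by auto
    from van_der_Corput[OF this, of \<xi>] have "norm (m \<xi> \<eta>) \<le> K0 * \<bar>\<eta>\<bar> powr (-1/2)" by (simp add: K0_def)
    also have "\<bar>\<eta>\<bar> powr (-1/2) \<le> (R / A) powr (-1/2)"
      using True R A by (intro powr_mono2') (auto simp: field_simps)
    also have "(R / A) powr (-1/2) = A powr (1/2) * R powr (-1/2)"
      using R A by (simp add: powr_divide powr_minus field_simps)
    finally have "norm (m \<xi> \<eta>) \<le> K0 * (A powr (1/2) * R powr (-1/2))" using K0 by simp
    moreover have "0 \<le> 4 * Mr * R powr (-1/2)" using Mr(1) by simp
    ultimately show ?thesis by (simp add: algebra_simps)
  next
    case False
    then have "A * \<bar>\<eta>\<bar> < R" by simp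
    moreover have "1 * \<bar>\<eta>\<bar> \<le> A * \<bar>\<eta>\<bar>" using A by (intro mult_right_mono) auto
    ultimately have x: "R \<le> \<bar>\<xi>\<bar>" using R by auto
    have "2 * Mr * \<bar>\<eta>\<bar> \<le> A * \<bar>\<eta>\<bar>" unfolding A_def by (intro mult_right_mono) auto
    then have "norm (m \<xi> \<eta>) \<le> 4 * Mr / \<bar>\<xi>\<bar>" using False x R by (intro nonstationary) auto
    also have "\<dots> \<le> 4 * Mr / R" using x R Mr(1) by (intro divide_left_mono) auto
    also have "\<dots> = 4 * Mr * R powr (-1)" using R by (simp add: powr_minus divide_inverse)
    also have "\<dots> \<le> 4 * Mr * R powr (-1/2)" using R Mr(1) by (intro mult_left_mono powr_mono) auto
    also have "\<dots> \<le> (K0 * A powr (1/2) + 4 * Mr) * R powr (-1/2)" using K0 by (intro mult_right_mono) auto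
    finally show ?thesis .
  qed
  moreover have "0 < K0 * A powr (1/2) + 4 * Mr" using K0 Mr(1) by (simp add: add_nonneg_pos)
  ultimately show ?thesis by blast
qed

end

section \<open>The smoothing inequality\<close>

text \<open>The window up to \<open>2 * N\<close> contains every shift by \<open>x\<close> of the
  support of \<open>F\<close>, so finite sums can be reindexed like sums over all integers.\<close>

lemma sum_shift_support:
  fixes F :: "int \<Rightarrow> 'a::comm_monoid_add"
  assumes F: "\<And>k. k \<notin> {-N..N} \<Longrightarrow> F k = 0" and x: "x \<in> {-N..N}"
  shows "(\<Sum>z\<in>{-2*N..2*N}. F (z - x)) = (\<Sum>k\<in>{-N..N}. F k)" "(\<Sum>z\<in>{-2*N..2*N}. F (x - z)) = (\<Sum>k\<in>{-N..N}. F k)"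
proof -
  show "(\<Sum>z\<in>{-2*N..2*N}. F (z - x)) = (\<Sum>k\<in>{-N..N}. F k)"
    by (rule sum.reindex_bij_witness_not_neutral[where S' = "{z \<in> {-2*N..2*N}. z - x \<notin> {-N..N}}" and T' = "{}" and i = "\<lambda>k. k + x" and j = "\<lambda>z. z - x"])
      (use F x in \<open>auto intro: rev_finite_subset[OF finite_atLeastAtMost_int[of "-(2*N)" "2*N"]]\<close>)
  show "(\<Sum>z\<in>{-2*N..2*N}. F (x - z)) = (\<Sum>k\<in>{-N..N}. F k)"
    by (rule sum.reindex_bij_witness_not_neutral[where S' = "{z \<in> {-2*N..2*N}. x - z \<notin> {-N..N}}" and T' = "{}" and i = "\<lambda>k. x - k" and j = "\<lambda>z. x - z"])
      (use F x in \<open>auto intro: rev_finite_subset[OF finite_atLeastAtMost_int[of "-(2*N)" "2*N"]]\<close>)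
qed

lemma sum_shift_le:
  fixes f :: "int \<Rightarrow> real"
  assumes "\<And>k. 0 \<le> f k" "\<And>k. k \<notin> {-N..N} \<Longrightarrow> f k = 0"
  shows "(\<Sum>k\<in>{-N..N}. f (k + h)) \<le> (\<Sum>k\<in>{-N..N}. f k)"
proof -
  have "(\<Sum>k\<in>{-N..N}. f (k + h)) = (\<Sum>k\<in>(\<lambda>k. k + h) ` {-N..N}. f k)"
    by (subst sum.reindex) auto
  also have "\<dots> = (\<Sum>k\<in>(\<lambda>k. k + h) ` {-N..N} \<inter> {-N..N}. f k)"
    by (rule sum.mono_neutral_right) (use assms in auto)
  also have "\<dots> \<le> (\<Sum>k\<in>{-N..N}. f k)"
    by (rule sum_mono2) (use assms in auto)
  finally show ?thesis .
qed

lemma sum_norm_shift_le: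
  fixes a :: "int \<Rightarrow> complex"
  assumes "\<And>k. k \<notin> {-N..N} \<Longrightarrow> a k = 0"
  shows "(\<Sum>k\<in>{-N..N}. norm (a k) * norm (a (k + h))) \<le> (\<Sum>k\<in>{-N..N}. (norm (a k))\<^sup>2)"
proof -
  have "(\<Sum>k\<in>{-N..N}. norm (a k) * norm (a (k + h))) \<le> (\<Sum>k\<in>{-N..N}. ((norm (a k))\<^sup>2 + (norm (a (k + h)))\<^sup>2) / 2)"
  proof (rule sum_mono)
    fix k show "norm (a k) * norm (a (k + h)) \<le> ((norm (a k))\<^sup>2 + (norm (a (k + h)))\<^sup>2) / 2"
      using zero_le_power2[of "norm (a k) - norm (a (k + h))"] by (simp add: power2_diff)
  qed
  also have "\<dots> = ((\<Sum>k\<in>{-N..N}. (norm (a k))\<^sup>2) + (\<Sum>k\<in>{-N..N}. (norm (a (k + h)))\<^sup>2)) / 2"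
    by (simp add: sum.distrib sum_divide_distrib[symmetric])
  also have "(\<Sum>k\<in>{-N..N}. (norm (a (k + h)))\<^sup>2) \<le> (\<Sum>k\<in>{-N..N}. (norm (a k))\<^sup>2)"
    by (rule sum_shift_le) (use assms in auto)
  finally show ?thesis by simp
qed

section \<open>The squared bilinear operator, sorted by frequency shift\<close>

context good_curve
begin

text \<open>The window for \<open>u\<close> is made independent of \<open>s\<close>, at no cost
  because \<open>r\<close> vanishes off \<open>{p..q}\<close>; the order of integration can then be
  exchanged.\<close>

lemma integral_recentre:
  fixes F :: "real \<Rightarrow> complex"
  assumes s: "s \<in> {p..q}" and cF: "continuous_on {p..q} F"
  shows "integral {p..q} (\<lambda>t. F t * of_real (r t)) = integral {-w..w} (\<lambda>u. F (s + u) * of_real (r (s + u)))"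
proof -
  have "((\<lambda>t. F t * of_real (r t)) has_integral integral {p..q} (\<lambda>t. F t * of_real (r t))) {p..q}"
    by (intro integrable_integral integrable_continuous_real continuous_intros cF)
  then have "((\<lambda>u. F (u + s) * of_real (r (u + s))) has_integral integral {p..q} (\<lambda>t. F t * of_real (r t))) {p - s..q - s}"
    using has_integral_shift_real_ivl[of "\<lambda>t. F t * of_real (r t)" _ p q s] by simp
  then have "((\<lambda>u. F (u + s) * of_real (r (u + s))) has_integral integral {p..q} (\<lambda>t. F t * of_real (r t))) {-w..w}"
    by (rule has_integral_on_superset) (use s in \<open>auto simp: r_zero\<close>)
  then show ?thesis by (simp add: integral_unique add.commute)
qed

text \<open>Put \<open>t = s + u\<close> in the double integral: the phase \<open>\<xi> * t + \<eta>
  * P0 t - (\<xi> - h) * s - (\<eta> + h) * P0 s\<close> becomes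
  \<open>\<xi> * u + \<eta> * (P0 (s + u) - P0 s) + h * (s - P0 s)\<close>. Thus
  \<open>\<xi>\<close> sees only \<open>u\<close>, \<open>\<eta>\<close> only the increment of
  \<open>P0\<close>, and \<open>h\<close> stands alone: the reason for sorting by
  \<open>h\<close>.\<close>

lemma m_cnj_m:
  "m \<xi> \<eta> * cnj (m (\<xi> - h) (\<eta> + h))
   = integral {-w..w} (\<lambda>u. integral {p..q} (\<lambda>s. uexp (\<xi> * u) * (uexp (\<eta> * (P0 (s + u) - P0 s)) * uexp (h * (s - P0 s)) * of_real (om u s))))"
proof -
  let ?f = "\<lambda>u s. uexp (\<xi> * u) * (uexp (\<eta> * (P0 (s + u) - P0 s)) * uexp (h * (s - P0 s)) * of_real (om u s))"
  have "cnj (m (\<xi> - h) (\<eta> + h)) = integral {p..q} (\<lambda>s. uexp (- ((\<xi> - h) * s + (\<eta> + h) * P0 s)) * of_real (r s))"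
    unfolding m_def by (simp add: Henstock_Kurzweil_Integration.integral_cnj cnj_uexp)
  then have "m \<xi> \<eta> * cnj (m (\<xi> - h) (\<eta> + h))
     = integral {p..q} (\<lambda>s. m \<xi> \<eta> * (uexp (- ((\<xi> - h) * s + (\<eta> + h) * P0 s)) * of_real (r s)))"
    by simp
  also have "\<dots> = integral {p..q} (\<lambda>s. integral {-w..w} (\<lambda>u. ?f u s))"
  proof (rule integral_cong)
    fix s assume s: "s \<in> {p..q}"
    have "m \<xi> \<eta> = integral {-w..w} (\<lambda>u. uexp (\<xi> * (s + u) + \<eta> * P0 (s + u)) * of_real (r (s + u)))"
      unfolding m_def by (rule integral_recentre[OF s]) (intro continuous_intros)
    then have "m \<xi> \<eta> * (uexp (- ((\<xi> - h) * s + (\<eta> + h) * P0 s)) * of_real (r s))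
      = integral {-w..w} (\<lambda>u. uexp (\<xi> * (s + u) + \<eta> * P0 (s + u)) * of_real (r (s + u)) * (uexp (- ((\<xi> - h) * s + (\<eta> + h) * P0 s)) * of_real (r s)))"
      by simp
    also have "\<dots> = integral {-w..w} (\<lambda>u. ?f u s)"
    proof (rule integral_cong)
      fix u
      have "uexp (\<xi> * (s + u) + \<eta> * P0 (s + u)) * uexp (- ((\<xi> - h) * s + (\<eta> + h) * P0 s))
        = uexp (\<xi> * u) * uexp (\<eta> * (P0 (s + u) - P0 s)) * uexp (h * (s - P0 s))"
        unfolding uexp_add[symmetric] by (rule arg_cong[of _ _ uexp]) (simp add: algebra_simps)
      moreover have "x * r1 * (y * r2) = a * (b * c * (r2 * r1))" if "x * y = a * b * c" for x y r1 r2 a b c :: complex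
      proof -
        have "x * r1 * (y * r2) = (x * y) * (r2 * r1)" by (simp only: mult_ac)
        then show ?thesis unfolding that by (simp only: mult_ac)
      qed
      ultimately show "uexp (\<xi> * (s + u) + \<eta> * P0 (s + u)) * of_real (r (s + u)) * (uexp (- ((\<xi> - h) * s + (\<eta> + h) * P0 s)) * of_real (r s)) = ?f u s"
        unfolding om_def of_real_mult by blast
    qed
    finally show "m \<xi> \<eta> * (uexp (- ((\<xi> - h) * s + (\<eta> + h) * P0 s)) * of_real (r s)) = integral {-w..w} (\<lambda>u. ?f u s)" .
  qed
  also have "\<dots> = integral {-w..w} (\<lambda>u. integral {p..q} (\<lambda>s. ?f u s))"
    unfolding om_def by (rule integral_swap_interval) (auto simp: case_prod_unfold intro!: continuous_intros)
  finally show ?thesis .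
qed

text \<open>Collects from the squared norm of \<open>conv N a b\<close> the products of the pairs
  \<open>(\<xi>, \<eta>)\<close> and \<open>(\<xi> - h, \<eta> + h)\<close>, which have the same
  sum.\<close>

definition corr :: "int \<Rightarrow> (int \<Rightarrow> complex) \<Rightarrow> (int \<Rightarrow> complex) \<Rightarrow> int \<Rightarrow> complex" where
  "corr N a b h = (\<Sum>\<xi>\<in>{-N..N}. \<Sum>\<eta>\<in>{-N..N}. a \<xi> * cnj (a (\<xi> - h)) * (b \<eta> * cnj (b (\<eta> + h))) *
     (m \<xi> \<eta> * cnj (m (of_int (\<xi> - h)) (of_int (\<eta> + h)))))"

text \<open>The operator averages characters of frequencies \<open>\<xi>\<close> and
  \<open>\<zeta> - \<xi>\<close> to \<open>m\<close> times the character of frequency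
  \<open>\<zeta>\<close>; so these are the Fourier coefficients of the bilinear average.\<close>

definition conv :: "int \<Rightarrow> (int \<Rightarrow> complex) \<Rightarrow> (int \<Rightarrow> complex) \<Rightarrow> int \<Rightarrow> complex" where
  "conv N a b \<zeta> = (\<Sum>\<xi>\<in>{-N..N}. a \<xi> * b (\<zeta> - \<xi>) * m (of_int \<xi>) (of_int (\<zeta> - \<xi>)))"

lemma sum_conv_eq_corr:
  assumes a: "\<And>k. k \<notin> {-N..N} \<Longrightarrow> a k = 0" and b: "\<And>k. k \<notin> {-N..N} \<Longrightarrow> b k = 0"
  shows "of_real (\<Sum>\<zeta>\<in>{-2*N..2*N}. (norm (conv N a b \<zeta>))\<^sup>2) = (\<Sum>h\<in>{-2*N..2*N}. corr N a b h)"
proof -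
  define H where "H \<xi> \<xi>' \<eta> = a \<xi> * b \<eta> * m (of_int \<xi>) (of_int \<eta>) * cnj (a \<xi>' * b (\<eta> + \<xi> - \<xi>') * m (of_int \<xi>') (of_int (\<eta> + \<xi> - \<xi>')))"
    for \<xi> \<xi>' \<eta> :: int
  let ?S = "{-N..N}" and ?Z = "{-2*N..2*N}"
  have "of_real (\<Sum>\<zeta>\<in>?Z. (norm (conv N a b \<zeta>))\<^sup>2) = (\<Sum>\<zeta>\<in>?Z. conv N a b \<zeta> * cnj (conv N a b \<zeta>))"
    by (simp add: complex_norm_square del: of_real_power)
  also have "\<dots> = (\<Sum>\<zeta>\<in>?Z. \<Sum>\<xi>\<in>?S. \<Sum>\<xi>'\<in>?S. H \<xi> \<xi>' (\<zeta> - \<xi>))"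
    unfolding conv_def cnj_sum sum_product H_def by simp
  also have "\<dots> = (\<Sum>\<xi>\<in>?S. \<Sum>\<zeta>\<in>?Z. \<Sum>\<xi>'\<in>?S. H \<xi> \<xi>' (\<zeta> - \<xi>))"
    by (rule sum.swap)
  also have "\<dots> = (\<Sum>\<xi>\<in>?S. \<Sum>\<xi>'\<in>?S. \<Sum>\<zeta>\<in>?Z. H \<xi> \<xi>' (\<zeta> - \<xi>))"
    by (intro sum.cong refl sum.swap)
  also have "\<dots> = (\<Sum>\<xi>\<in>?S. \<Sum>\<xi>'\<in>?S. \<Sum>\<eta>\<in>?S. H \<xi> \<xi>' \<eta>)"
    by (intro sum.cong refl sum_shift_support(1)) (auto simp: H_def b)
  also have "\<dots> = (\<Sum>\<xi>\<in>?S. \<Sum>\<eta>\<in>?S. \<Sum>\<xi>'\<in>?S. H \<xi> \<xi>' \<eta>)"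
    by (intro sum.cong refl sum.swap)
  also have "\<dots> = (\<Sum>\<xi>\<in>?S. \<Sum>\<eta>\<in>?S. \<Sum>h\<in>?Z. H \<xi> (\<xi> - h) \<eta>)"
    by (intro sum.cong refl sum_shift_support(2)[symmetric, where F = "\<lambda>\<xi>'. H _ \<xi>' _"]) (auto simp: H_def a)
  also have "\<dots> = (\<Sum>\<xi>\<in>?S. \<Sum>h\<in>?Z. \<Sum>\<eta>\<in>?S. H \<xi> (\<xi> - h) \<eta>)"
    by (intro sum.cong refl sum.swap)
  also have "\<dots> = (\<Sum>h\<in>?Z. \<Sum>\<xi>\<in>?S. \<Sum>\<eta>\<in>?S. H \<xi> (\<xi> - h) \<eta>)"
    by (rule sum.swap)
  also have "\<dots> = (\<Sum>h\<in>?Z. corr N a b h)"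
    unfolding corr_def H_def by (intro sum.cong refl) (simp add: algebra_simps)
  finally show ?thesis .
qed

text \<open>Serves the small shifts, of which there are few. If no coefficient vanishes, both
  frequency pairs lie in the supports of \<open>a\<close> and \<open>b\<close>, so both multipliers
  obey the bound \<open>\<mu>\<close>.\<close>

lemma corr_le_sup:
  assumes a: "\<And>k. k \<notin> {-N..N} \<Longrightarrow> a k = 0" and b: "\<And>k. k \<notin> {-N..N} \<Longrightarrow> b k = 0"
    and m: "\<And>\<xi> \<eta>. a \<xi> \<noteq> 0 \<Longrightarrow> b \<eta> \<noteq> 0 \<Longrightarrow> norm (m (of_int \<xi>) (of_int \<eta>)) \<le> \<mu>"
  shows "norm (corr N a b h) \<le> \<mu>\<^sup>2 * (\<Sum>k\<in>{-N..N}. (norm (a k))\<^sup>2) * (\<Sum>k\<in>{-N..N}. (norm (b k))\<^sup>2)"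
proof -
  have "norm (corr N a b h) \<le> (\<Sum>\<xi>\<in>{-N..N}. \<Sum>\<eta>\<in>{-N..N}. norm (a \<xi>) * norm (a (\<xi> + -h)) * (norm (b \<eta>) * norm (b (\<eta> + h))) * \<mu>\<^sup>2)"
    unfolding corr_def
  proof (intro order_trans[OF norm_sum] sum_mono)
    fix \<xi> \<eta>
    show "norm (a \<xi> * cnj (a (\<xi> - h)) * (b \<eta> * cnj (b (\<eta> + h))) * (m \<xi> \<eta> * cnj (m (of_int (\<xi> - h)) (of_int (\<eta> + h)))))
      \<le> norm (a \<xi>) * norm (a (\<xi> + -h)) * (norm (b \<eta>) * norm (b (\<eta> + h))) * \<mu>\<^sup>2"
    proof (cases "a \<xi> = 0 \<or> a (\<xi> - h) = 0 \<or> b \<eta> = 0 \<or> b (\<eta> + h) = 0")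
      case False
      have "norm (m \<xi> \<eta>) * norm (m (of_int (\<xi> - h)) (of_int (\<eta> + h))) \<le> \<mu> * \<mu>"
        using m[of \<xi> \<eta>] m[of "\<xi> - h" "\<eta> + h"] False by (intro mult_mono) (auto intro: order_trans[OF norm_ge_zero])
      then show ?thesis
        by (simp only: norm_mult complex_mod_cnj power2_eq_square add_uminus_conv_diff) (intro mult_left_mono, auto)
    qed auto
  qed
  also have "\<dots> = \<mu>\<^sup>2 * (\<Sum>\<xi>\<in>{-N..N}. norm (a \<xi>) * norm (a (\<xi> + -h))) * (\<Sum>\<eta>\<in>{-N..N}. norm (b \<eta>) * norm (b (\<eta> + h)))"
    unfolding mult.assoc sum_product by (simp add: sum_distrib_left mult_ac)
  also have "\<dots> \<le> \<mu>\<^sup>2 * (\<Sum>k\<in>{-N..N}. (norm (a k))\<^sup>2) * (\<Sum>k\<in>{-N..N}. (norm (b k))\<^sup>2)"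
    by (intro mult_mono mult_left_mono sum_norm_shift_le a b) (auto intro!: sum_nonneg mult_nonneg_nonneg)
  finally show ?thesis .
qed

text \<open>By \<open>m_cnj_m\<close> the sums over \<open>\<xi>\<close> and \<open>\<eta>\<close>
  decouple: the first is a trigonometric polynomial in \<open>u\<close> alone, the second goes
  inside the \<open>s\<close>-integral.\<close>

lemma corr_eq_integral:
  "corr N a b h = integral {-w..w} (\<lambda>u. trigpoly {-N..N} (\<lambda>\<xi>. a \<xi> * cnj (a (\<xi> - h))) u *
     integral {p..q} (\<lambda>s. trigpoly {-N..N} (\<lambda>\<eta>. b \<eta> * cnj (b (\<eta> + h))) (P0 (s + u) - P0 s) * uexp (of_int h * (s - P0 s)) * of_real (om u s)))"
proof -
  let ?S = "{-N..N}"
  let ?a = "\<lambda>\<xi>. a \<xi> * cnj (a (\<xi> - h))" and ?b = "\<lambda>\<eta>. b \<eta> * cnj (b (\<eta> + h))"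
  let ?F = "\<lambda>\<eta> u s. uexp (of_int \<eta> * (P0 (s + u) - P0 s)) * uexp (of_int h * (s - P0 s)) * of_real (om u s)"
  have cF: "continuous_on ({-w..w} \<times> {p..q}) (\<lambda>(u,s). ?F \<eta> u s)" for \<eta> :: int
    unfolding case_prod_unfold om_def by (intro continuous_intros)
  have cFs: "continuous_on {p..q} (\<lambda>s. ?F \<eta> u s)" for \<eta> :: int and u
    unfolding om_def by (intro continuous_intros)
  have cI: "continuous_on {-w..w} (\<lambda>u. integral {p..q} (\<lambda>s. ?F \<eta> u s))" for \<eta> :: int
    by (rule continuous_on_integral_interval[OF cF])
  have inner: "integral {p..q} (\<lambda>s. trigpoly ?S ?b (P0 (s + u) - P0 s) * uexp (of_int h * (s - P0 s)) * of_real (om u s))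
     = (\<Sum>\<eta>\<in>?S. ?b \<eta> * integral {p..q} (\<lambda>s. ?F \<eta> u s))" for u
  proof -
    have "integral {p..q} (\<lambda>s. trigpoly ?S ?b (P0 (s + u) - P0 s) * uexp (of_int h * (s - P0 s)) * of_real (om u s))
      = integral {p..q} (\<lambda>s. \<Sum>\<eta>\<in>?S. ?b \<eta> * ?F \<eta> u s)"
      unfolding trigpoly_def by (simp only: sum_distrib_right mult.assoc)
    also have "\<dots> = (\<Sum>\<eta>\<in>?S. integral {p..q} (\<lambda>s. ?b \<eta> * ?F \<eta> u s))"
      by (rule integral_sum) (intro finite_atLeastAtMost_int integrable_continuous_real continuous_on_mult continuous_on_const cFs)+
    finally show ?thesis by (simp only: integral_mult_right)
  qed
  have "integral {-w..w} (\<lambda>u. trigpoly ?S ?a u * integral {p..q} (\<lambda>s. trigpoly ?S ?b (P0 (s + u) - P0 s) * uexp (of_int h * (s - P0 s)) * of_real (om u s)))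
    = integral {-w..w} (\<lambda>u. \<Sum>\<xi>\<in>?S. \<Sum>\<eta>\<in>?S. (?a \<xi> * ?b \<eta>) * (uexp (of_int \<xi> * u) * integral {p..q} (\<lambda>s. ?F \<eta> u s)))"
    unfolding inner unfolding trigpoly_def sum_product by (intro integral_cong sum.cong refl) (simp only: mult_ac)
  also have "\<dots> = (\<Sum>\<xi>\<in>?S. \<Sum>\<eta>\<in>?S. (?a \<xi> * ?b \<eta>) * integral {-w..w} (\<lambda>u. uexp (of_int \<xi> * u) * integral {p..q} (\<lambda>s. ?F \<eta> u s)))"
    (is "?lhs = ?rhs")
  proof -
    have i: "(\<lambda>u. (?a \<xi> * ?b \<eta>) * (uexp (of_int \<xi> * u) * integral {p..q} (\<lambda>s. ?F \<eta> u s))) integrable_on {-w..w}" for \<xi> \<eta>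
      by (intro integrable_continuous_real continuous_on_mult continuous_on_const cI continuous_on_uexp continuous_on_id)
    have "?lhs = (\<Sum>\<xi>\<in>?S. integral {-w..w} (\<lambda>u. \<Sum>\<eta>\<in>?S. (?a \<xi> * ?b \<eta>) * (uexp (of_int \<xi> * u) * integral {p..q} (\<lambda>s. ?F \<eta> u s))))"
      by (rule integral_sum) (intro finite_atLeastAtMost_int integrable_sum i)+
    also have "\<dots> = (\<Sum>\<xi>\<in>?S. \<Sum>\<eta>\<in>?S. integral {-w..w} (\<lambda>u. (?a \<xi> * ?b \<eta>) * (uexp (of_int \<xi> * u) * integral {p..q} (\<lambda>s. ?F \<eta> u s))))"
      by (intro sum.cong refl integral_sum finite_atLeastAtMost_int i)
    finally show ?thesis by (simp only: integral_mult_right)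
  qed
  also have "\<dots> = corr N a b h"
    unfolding corr_def
  proof (intro sum.cong refl arg_cong2[of _ _ _ _ "(*)"])
    fix \<xi> \<eta> :: int
    show "integral {-w..w} (\<lambda>u. uexp (of_int \<xi> * u) * integral {p..q} (\<lambda>s. ?F \<eta> u s)) = m \<xi> \<eta> * cnj (m (of_int (\<xi> - h)) (of_int (\<eta> + h)))"
      unfolding of_int_diff of_int_add m_cnj_m by simp
  qed
  finally show ?thesis ..
qed



text \<open>Cauchy-Schwarz in \<open>u\<close>, with Parseval on the first factor (the window has
  length \<open>2 * w \<le> 1\<close>) and \<open>bilinear_decay\<close> on the second. The additive
  form with a free \<open>lam\<close> is chosen because the two terms can then be summed over
  \<open>h\<close> separately.\<close>

lemma corr_le_decay:
  "\<exists>K>0. \<forall>N a b h lam. h \<noteq> 0 \<longrightarrow> 0 < lam \<longrightarrow> norm (corr N a b h) \<le>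
     (lam * (\<Sum>k\<in>{-N..N}. (norm (a k))\<^sup>2 * (norm (a (k - h)))\<^sup>2)
      + K * \<bar>of_int h\<bar> powr (-1/3) / lam * (\<Sum>k\<in>{-N..N}. (norm (b k))\<^sup>2 * (norm (b (k + h)))\<^sup>2)) / 2"
proof -
  obtain K where K: "0 < K" "\<And>S a h. finite S \<Longrightarrow> h \<noteq> 0 \<Longrightarrow>
     integral {-w..w} (\<lambda>u. (norm (integral {p..q} (\<lambda>s. trigpoly S a (P0 (s + u) - P0 s) * uexp (of_int h * (s - P0 s)) * of_real (om u s))))\<^sup>2)
       \<le> K * \<bar>of_int h\<bar> powr (-1/3) * (\<Sum>k\<in>S. (norm (a k))\<^sup>2)"
    using bilinear_decay by blast
  show ?thesis
  proof (intro exI[of _ K] conjI allI impI K(1))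
    fix N a b lam and h :: int
    assume h: "h \<noteq> 0" and lam: "0 < (lam :: real)"
    define A where "A = trigpoly {-N..N} (\<lambda>\<xi>. a \<xi> * cnj (a (\<xi> - h)))"
    define G where "G u = integral {p..q} (\<lambda>s. trigpoly {-N..N} (\<lambda>\<eta>. b \<eta> * cnj (b (\<eta> + h))) (P0 (s + u) - P0 s) * uexp (of_int h * (s - P0 s)) * of_real (om u s))" for u
    have cA: "continuous_on T A" for T unfolding A_def by (intro continuous_intros)
    have cG: "continuous_on T G" for T
      unfolding G_def om_def by (rule continuous_on_integral_interval) (auto simp: case_prod_unfold intro!: continuous_intros)
    have "norm (corr N a b h) \<le> integral {-w..w} (\<lambda>u. (lam * (norm (A u))\<^sup>2 + (norm (G u))\<^sup>2 / lam) / 2)"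
      unfolding corr_eq_integral A_def[symmetric] G_def[symmetric]
    proof (rule integral_norm_bound_integral)
      fix u
      have "0 \<le> (lam * norm (A u) - norm (G u))\<^sup>2 / lam" using lam by simp
      also have "\<dots> = lam * (norm (A u))\<^sup>2 + (norm (G u))\<^sup>2 / lam - 2 * (norm (A u) * norm (G u))"
        using lam by (simp add: power2_diff power2_eq_square field_simps)
      finally show "norm (A u * G u) \<le> (lam * (norm (A u))\<^sup>2 + (norm (G u))\<^sup>2 / lam) / 2"
        by (simp add: norm_mult)
    qed (use lam in \<open>auto intro!: integrable_continuous_real continuous_intros cA cG\<close>)
    also have "\<dots> = (lam * integral {-w..w} (\<lambda>u. (norm (A u))\<^sup>2) + integral {-w..w} (\<lambda>u. (norm (G u))\<^sup>2) / lam) / 2"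
      using lam by (simp, subst integral_add) (auto intro!: integrable_continuous_real continuous_intros cA cG)
    also have "\<dots> \<le> (lam * (\<Sum>k\<in>{-N..N}. (norm (a k))\<^sup>2 * (norm (a (k - h)))\<^sup>2)
      + K * \<bar>of_int h\<bar> powr (-1/3) * (\<Sum>k\<in>{-N..N}. (norm (b k))\<^sup>2 * (norm (b (k + h)))\<^sup>2) / lam) / 2"
    proof -
      have "integral {-w..w} (\<lambda>u. (norm (A u))\<^sup>2) \<le> (\<Sum>k\<in>{-N..N}. (norm (a k))\<^sup>2 * (norm (a (k - h)))\<^sup>2)"
        using trigpoly_L2_le[of "{-N..N}" w "-w" "\<lambda>\<xi>. a \<xi> * cnj (a (\<xi> - h))"] short
        by (simp add: A_def norm_mult power_mult_distrib)
      moreover have "integral {-w..w} (\<lambda>u. (norm (G u))\<^sup>2) \<le> K * \<bar>of_int h\<bar> powr (-1/3) * (\<Sum>k\<in>{-N..N}. (norm (b k))\<^sup>2 * (norm (b (k + h)))\<^sup>2)"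
        using K(2)[OF _ h, of "{-N..N}" "\<lambda>\<eta>. b \<eta> * cnj (b (\<eta> + h))"] by (simp add: G_def norm_mult power_mult_distrib)
      ultimately show ?thesis using lam
        by (intro divide_right_mono add_mono mult_left_mono) auto
    qed
    finally show "norm (corr N a b h) \<le>
     (lam * (\<Sum>k\<in>{-N..N}. (norm (a k))\<^sup>2 * (norm (a (k - h)))\<^sup>2)
      + K * \<bar>of_int h\<bar> powr (-1/3) / lam * (\<Sum>k\<in>{-N..N}. (norm (b k))\<^sup>2 * (norm (b (k + h)))\<^sup>2)) / 2"
      by simp
  qed
qed

definition smoothing_const :: "real \<Rightarrow> bool" where
  "smoothing_const K \<longleftrightarrow> 0 < K \<and> (\<forall>N a b R. (\<forall>k. k \<notin> {-N..N} \<longrightarrow> a k = 0) \<longrightarrow> (\<forall>k. k \<notin> {-N..N} \<longrightarrow> b k = 0) \<longrightarrow> 1 \<le> R \<longrightarrow>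
     (\<forall>\<xi> \<eta>. a \<xi> \<noteq> 0 \<longrightarrow> b \<eta> \<noteq> 0 \<longrightarrow> R \<le> max \<bar>of_int \<xi>\<bar> \<bar>of_int \<eta>\<bar>) \<longrightarrow>
     (\<Sum>\<zeta>\<in>{-2*N..2*N}. (norm (conv N a b \<zeta>))\<^sup>2) \<le> K * R powr (-1/12) * (\<Sum>k\<in>{-N..N}. (norm (a k))\<^sup>2) * (\<Sum>k\<in>{-N..N}. (norm (b k))\<^sup>2))"

text \<open>Shifts up to about \<open>R powr (1/2)\<close> are that many terms, each of size
  \<open>R powr (-1)\<close> by \<open>multiplier_decay\<close>. For larger shifts
  \<open>bilinear_decay\<close> gives \<open>R powr (-1/6)\<close>, of which optimising
  \<open>lam\<close> leaves the square root; this is the exponent \<open>-1/12\<close>.\<close>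

lemma smoothing: "\<exists>K. smoothing_const K"
proof -
  obtain K1 where K1: "0 < K1" "\<And>R \<xi> \<eta>. 1 \<le> R \<Longrightarrow> R \<le> max \<bar>\<xi>\<bar> \<bar>\<eta>\<bar> \<Longrightarrow> norm (m \<xi> \<eta>) \<le> K1 * R powr (-1/2)"
    using multiplier_decay by blast
  obtain K2 where K2: "0 < K2" "\<And>N a b h lam. h \<noteq> 0 \<Longrightarrow> 0 < lam \<Longrightarrow> norm (corr N a b h) \<le>
     (lam * (\<Sum>k\<in>{-N..N}. (norm (a k))\<^sup>2 * (norm (a (k - h)))\<^sup>2)
      + K2 * \<bar>of_int h\<bar> powr (-1/3) / lam * (\<Sum>k\<in>{-N..N}. (norm (b k))\<^sup>2 * (norm (b (k + h)))\<^sup>2)) / 2"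
    using corr_le_decay by blast
  have "(\<Sum>\<zeta>\<in>{-2*N..2*N}. (norm (conv N a b \<zeta>))\<^sup>2) \<le> (5 * K1\<^sup>2 + (1 + K2) / 2) * R powr (-1/12) * (\<Sum>k\<in>{-N..N}. (norm (a k))\<^sup>2) * (\<Sum>k\<in>{-N..N}. (norm (b k))\<^sup>2)"
    if a: "\<And>k. k \<notin> {-N..N} \<Longrightarrow> a k = 0" and b: "\<And>k. k \<notin> {-N..N} \<Longrightarrow> b k = 0" and R: "1 \<le> R"
      and ab: "\<And>\<xi> \<eta>. a \<xi> \<noteq> 0 \<Longrightarrow> b \<eta> \<noteq> 0 \<Longrightarrow> R \<le> max \<bar>of_int \<xi>\<bar> \<bar>of_int \<eta>\<bar>" for N a b R
  proof -
    define \<alpha> where "\<alpha> = (\<Sum>k\<in>{-N..N}. (norm (a k))\<^sup>2)"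
    define \<beta> where "\<beta> = (\<Sum>k\<in>{-N..N}. (norm (b k))\<^sup>2)"
    let ?Z = "{-2*N..2*N}"
    have nonneg: "0 \<le> \<alpha>" "0 \<le> \<beta>" by (auto simp: \<alpha>_def \<beta>_def intro: sum_nonneg)
    show ?thesis
    proof (cases "\<alpha> = 0 \<or> \<beta> = 0")
      \<comment> \<open>The optimal \<open>lam\<close> below needs both sums to be positive.\<close>
      case True
      then have "(\<forall>k\<in>{-N..N}. a k = 0) \<or> (\<forall>k\<in>{-N..N}. b k = 0)"
        by (auto simp: \<alpha>_def \<beta>_def sum_nonneg_eq_0_iff)
      then have "a k = 0 \<or> b l = 0" for k l using a b by blast
      then have "conv N a b \<zeta> = 0" for \<zeta> unfolding conv_def by (intro sum.neutral) (metis mult_eq_0_iff)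
      then show ?thesis using True by (auto simp: \<alpha>_def \<beta>_def)
    next
      case False
      then have pos: "0 < \<alpha>" "0 < \<beta>" using nonneg by auto
      define rt where "rt = R powr (1/2)"
      have rt: "1 \<le> rt" using R by (simp add: rt_def ge_one_powr_ge_zero)
      define H where "H = \<lceil>rt\<rceil>"
      have H: "rt \<le> of_int H" "of_int H \<le> 2 * rt" "1 \<le> H" using rt by (auto simp: H_def) linarith+
      define Sm where "Sm = ?Z \<inter> {h. \<bar>h\<bar> \<le> H}"
      define La where "La = ?Z \<inter> {h. H < \<bar>h\<bar>}"
      have fin: "finite Sm" "finite La" unfolding Sm_def La_def by (rule finite_Int; simp)+
      have Z: "?Z = Sm \<union> La" "Sm \<inter> La = {}" by (auto simp: Sm_def La_def)
      define x where "x = R powr (-1/12)"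
      have x0: "0 < x" using R by (simp add: x_def)
      \<comment> \<open>Makes both terms of \<open>corr_le_decay\<close>, summed over
        \<open>h\<close>, equal to \<open>x * \<alpha> * \<beta>\<close> up to constants.\<close>
      define lam where "lam = x * \<beta> / \<alpha>"
      have lam: "0 < lam" using x0 pos by (simp add: lam_def)
      have small: "norm (\<Sum>h\<in>Sm. corr N a b h) \<le> 5 * K1\<^sup>2 * x * \<alpha> * \<beta>"
      proof -
        have "norm (\<Sum>h\<in>Sm. corr N a b h) \<le> (\<Sum>h\<in>Sm. (K1 * R powr (-1/2))\<^sup>2 * \<alpha> * \<beta>)"
          unfolding \<alpha>_def \<beta>_def by (intro order_trans[OF norm_sum] sum_mono corr_le_sup a b K1 R ab)
        also have "\<dots> = of_nat (card Sm) * ((K1 * R powr (-1/2))\<^sup>2 * \<alpha> * \<beta>)" by simp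
        also have "of_nat (card Sm) \<le> 5 * rt"
        proof -
          have "card Sm \<le> card {-H..H}" by (rule card_mono) (auto simp: Sm_def)
          then have "real (card Sm) \<le> 2 * of_int H + 1" using H(3) by simp
          then show ?thesis using H rt by linarith
        qed
        also have "5 * rt * ((K1 * R powr (-1/2))\<^sup>2 * \<alpha> * \<beta>) = 5 * K1\<^sup>2 * (rt * (R powr (-1/2))\<^sup>2) * \<alpha> * \<beta>"
          by (simp add: power_mult_distrib)
        also have "rt * (R powr (-1/2))\<^sup>2 = R powr (-1/2)"
          unfolding rt_def power2_eq_square powr_add[symmetric] by simp
        also have "5 * K1\<^sup>2 * R powr (-1/2) * \<alpha> * \<beta> \<le> 5 * K1\<^sup>2 * x * \<alpha> * \<beta>"
          unfolding x_def using R pos K1(1) by (intro mult_right_mono mult_left_mono powr_mono) auto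
        finally show ?thesis using pos by (simp add: mult_right_mono)
      qed
      have large: "norm (\<Sum>h\<in>La. corr N a b h) \<le> (1 + K2) / 2 * x * \<alpha> * \<beta>"
      proof -
        let ?A = "\<lambda>h. \<Sum>k\<in>{-N..N}. (norm (a k))\<^sup>2 * (norm (a (k - h)))\<^sup>2"
        let ?B = "\<lambda>h. \<Sum>k\<in>{-N..N}. (norm (b k))\<^sup>2 * (norm (b (k + h)))\<^sup>2"
        have B0: "0 \<le> ?B h" "0 \<le> ?A h" for h by (auto intro: sum_nonneg)
        have "norm (\<Sum>h\<in>La. corr N a b h) \<le> (\<Sum>h\<in>La. (lam * ?A h + K2 * x\<^sup>2 / lam * ?B h) / 2)"
        proof (intro order_trans[OF norm_sum] sum_mono)
          fix h assume h: "h \<in> La"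
          then have h0: "h \<noteq> 0" using H by (auto simp: La_def)
          have "rt \<le> \<bar>of_int h\<bar>" using h H unfolding La_def by auto
          then have "\<bar>of_int h\<bar> powr (-1/3) \<le> rt powr (-1/3)"
            using rt by (intro powr_mono2') auto
          also have "rt powr (-1/3) = x\<^sup>2"
            using R by (simp add: rt_def x_def powr_powr power2_eq_square powr_add[symmetric])
          finally have hx: "\<bar>of_int h\<bar> powr (-1/3) \<le> x\<^sup>2" .
          have "norm (corr N a b h) \<le> (lam * ?A h + K2 * \<bar>of_int h\<bar> powr (-1/3) / lam * ?B h) / 2"
            by (rule K2(2)[OF h0 lam])
          also have "\<dots> \<le> (lam * ?A h + K2 * x\<^sup>2 / lam * ?B h) / 2"
            using hx K2(1) lam B0 by (intro divide_right_mono add_left_mono mult_right_mono mult_left_mono) auto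
          finally show "norm (corr N a b h) \<le> (lam * ?A h + K2 * x\<^sup>2 / lam * ?B h) / 2" .
        qed
        also have "\<dots> = (lam * (\<Sum>h\<in>La. ?A h) + K2 * x\<^sup>2 / lam * (\<Sum>h\<in>La. ?B h)) / 2"
          by (simp only: sum_divide_distrib[symmetric] sum.distrib sum_distrib_left[symmetric])
        also have "\<dots> \<le> (lam * (\<alpha> * \<alpha>) + K2 * x\<^sup>2 / lam * (\<beta> * \<beta>)) / 2"
        proof -
          \<comment> \<open>Summed over all shifts, the correlation of the squares factorises into a
            product of total masses.\<close>
          have "(\<Sum>h\<in>La. ?A h) \<le> (\<Sum>h\<in>?Z. ?A h)" by (rule sum_mono2) (use B0 in \<open>auto simp: La_def\<close>)
          also have "\<dots> = (\<Sum>k\<in>{-N..N}. (norm (a k))\<^sup>2 * (\<Sum>h\<in>?Z. (norm (a (k - h)))\<^sup>2))"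
            unfolding sum_distrib_left by (rule sum.swap)
          also have "\<dots> = (\<Sum>k\<in>{-N..N}. (norm (a k))\<^sup>2 * \<alpha>)"
            unfolding \<alpha>_def by (intro sum.cong refl arg_cong2[of _ _ _ _ "(*)"] sum_shift_support(2)) (auto simp: a)
          finally have 1: "(\<Sum>h\<in>La. ?A h) \<le> \<alpha> * \<alpha>" by (simp add: \<alpha>_def sum_distrib_right)
          have "(\<Sum>h\<in>La. ?B h) \<le> (\<Sum>h\<in>?Z. ?B h)" by (rule sum_mono2) (use B0 in \<open>auto simp: La_def\<close>)
          also have "\<dots> = (\<Sum>k\<in>{-N..N}. (norm (b k))\<^sup>2 * (\<Sum>h\<in>?Z. (norm (b (k + h)))\<^sup>2))"
            unfolding sum_distrib_left by (rule sum.swap)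
          also have "\<dots> = (\<Sum>k\<in>{-N..N}. (norm (b k))\<^sup>2 * \<beta>)"
          proof (intro sum.cong refl arg_cong2[of _ _ _ _ "(*)"])
            fix k assume "k \<in> {-N..N}"
            then have "- k \<in> {-N..N}" by auto
            from sum_shift_support(1)[of N "\<lambda>k. (norm (b k))\<^sup>2", OF _ this]
            show "(\<Sum>h\<in>?Z. (norm (b (k + h)))\<^sup>2) = \<beta>" by (simp add: b \<beta>_def add.commute)
          qed
          finally have 2: "(\<Sum>h\<in>La. ?B h) \<le> \<beta> * \<beta>" by (simp add: \<beta>_def sum_distrib_right)
          show ?thesis using 1 2 lam K2(1) by (intro divide_right_mono add_mono mult_left_mono) auto
        qed
        also have "\<dots> = (1 + K2) / 2 * x * \<alpha> * \<beta>"
        proof -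
          have l1: "lam * (\<alpha> * \<alpha>) = x * \<alpha> * \<beta>" using pos by (simp add: lam_def)
          have "x\<^sup>2 / lam = x * \<alpha> / \<beta>" using pos x0 by (simp add: lam_def power2_eq_square)
          then have l2: "x\<^sup>2 / lam * (\<beta> * \<beta>) = x * \<alpha> * \<beta>" using pos by simp
          have "K2 * x\<^sup>2 / lam * (\<beta> * \<beta>) = K2 * (x\<^sup>2 / lam * (\<beta> * \<beta>))" by simp
          then show ?thesis unfolding l1 l2 by (simp add: algebra_simps add_divide_distrib)
        qed
        finally show ?thesis .
      qed
      have "complex_of_real (\<Sum>\<zeta>\<in>?Z. (norm (conv N a b \<zeta>))\<^sup>2) = (\<Sum>h\<in>?Z. corr N a b h)"
        by (rule sum_conv_eq_corr) (use a b in auto)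
      also have "\<dots> = (\<Sum>h\<in>Sm. corr N a b h) + (\<Sum>h\<in>La. corr N a b h)"
        unfolding Z(1) by (rule sum.union_disjoint[OF fin Z(2)])
      finally have "complex_of_real (\<Sum>\<zeta>\<in>?Z. (norm (conv N a b \<zeta>))\<^sup>2) = (\<Sum>h\<in>Sm. corr N a b h) + (\<Sum>h\<in>La. corr N a b h)" .
      then have "norm (complex_of_real (\<Sum>\<zeta>\<in>?Z. (norm (conv N a b \<zeta>))\<^sup>2)) \<le> 5 * K1\<^sup>2 * x * \<alpha> * \<beta> + (1 + K2) / 2 * x * \<alpha> * \<beta>"
        using norm_triangle_le[OF add_mono[OF small large]] by simp
      then show ?thesis unfolding norm_of_real by (simp add: x_def \<alpha>_def \<beta>_def algebra_simps)
    qed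
  qed
  moreover have "0 < 5 * K1\<^sup>2 + (1 + K2) / 2" using K1 K2 by (simp add: add_pos_pos)
  ultimately show ?thesis unfolding smoothing_const_def by blast
qed

end

section \<open>The Fejer and de la Vallee-Poussin kernels\<close>

definition fejer :: "nat \<Rightarrow> real \<Rightarrow> real" where
  "fejer M x = (norm (\<Sum>j<M. uexp (of_nat j * x)))\<^sup>2 / M"

definition fejer_coeff :: "nat \<Rightarrow> int \<Rightarrow> real" where
  "fejer_coeff M k = max 0 (1 - \<bar>of_int k\<bar> / M)"

text \<open>Raising \<open>M\<close> by one adds each difference between \<open>- M\<close> and
  \<open>M\<close> exactly once. The new weights vanish at the two new end points, so the window can
  grow along with \<open>M\<close>.\<close>

lemma sum_differences:
  fixes g :: "int \<Rightarrow> complex"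
  shows "(\<Sum>j<M. \<Sum>l<M. g (int j - int l)) = (\<Sum>k\<in>{-int M..int M}. of_int (int M - \<bar>k\<bar>) * g k)"
proof (induction M)
  case (Suc M)
  have ins: "{-int (Suc M)..int (Suc M)} = insert (int (Suc M)) (insert (-int (Suc M)) {-int M..int M})" by auto
  have split: "(\<Sum>k\<in>{-int M..int M}. g k) = (\<Sum>j<M. g (int j - int M)) + (\<Sum>l<M. g (int M - int l)) + g 0"
  proof -
    have "{-int M..int M} = {-int M..<0} \<union> {0} \<union> {0<..int M}" by auto
    then have "(\<Sum>k\<in>{-int M..int M}. g k) = (\<Sum>k\<in>({-int M..<0} \<union> {0}) \<union> {0<..int M}. g k)"
      by simp
    also have "\<dots> = (\<Sum>k\<in>{-int M..<0}. g k) + g 0 + (\<Sum>k\<in>{0<..int M}. g k)"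
      by (subst sum.union_disjoint; auto simp: sum.union_disjoint)+
    also have "(\<Sum>k\<in>{-int M..<0}. g k) = (\<Sum>j<M. g (int j - int M))"
      by (rule sum.reindex_bij_witness[of _ "\<lambda>j. int j - int M" "\<lambda>k. nat (k + int M)"]) auto
    also have "(\<Sum>k\<in>{0<..int M}. g k) = (\<Sum>l<M. g (int M - int l))"
      by (rule sum.reindex_bij_witness[of _ "\<lambda>j. int M - int j" "\<lambda>k. nat (int M - k)"]) auto
    finally show ?thesis by simp
  qed
  have "(\<Sum>j<Suc M. \<Sum>l<Suc M. g (int j - int l)) = (\<Sum>j<M. \<Sum>l<M. g (int j - int l)) + (\<Sum>k\<in>{-int M..int M}. g k)"
    unfolding split by (simp add: sum.distrib)
  also have "\<dots> = (\<Sum>k\<in>{-int M..int M}. of_int (int (Suc M) - \<bar>k\<bar>) * g k)"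
    unfolding Suc.IH sum.distrib[symmetric] by (intro sum.cong) (auto simp: algebra_simps)
  also have "\<dots> = (\<Sum>k\<in>{-int (Suc M)..int (Suc M)}. of_int (int (Suc M) - \<bar>k\<bar>) * g k)"
    unfolding ins by (subst sum.insert; simp)+
  finally show ?case .
qed simp

lemma fejer_eq_trigpoly:
  assumes "0 < M" "int M \<le> N"
  shows "of_real (fejer M x) = trigpoly {-N..N} (\<lambda>k. of_real (fejer_coeff M k)) x"
proof -
  have "of_real ((norm (\<Sum>j<M. uexp (of_nat j * x)))\<^sup>2) = (\<Sum>j<M. \<Sum>l<M. uexp (of_int (int j - int l) * x))"
    unfolding complex_norm_square cnj_sum sum_product
    by (intro sum.cong) (auto simp: cnj_uexp uexp_add[symmetric] algebra_simps)
  also have "\<dots> = (\<Sum>k\<in>{-int M..int M}. of_int (int M - \<bar>k\<bar>) * uexp (of_int k * x))"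
    by (rule sum_differences)
  also have "\<dots> = of_nat M * (\<Sum>k\<in>{-int M..int M}. of_real (fejer_coeff M k) * uexp (of_int k * x))"
    unfolding sum_distrib_left
  proof (intro sum.cong refl)
    fix k assume k: "k \<in> {-int M..int M}"
    then have "\<bar>k\<bar> \<le> int M" by auto
    then have "\<bar>real_of_int k\<bar> \<le> real M" by (metis of_int_abs of_int_le_iff of_int_of_nat_eq)
    then have "real M * fejer_coeff M k = real_of_int (int M - \<bar>k\<bar>)"
      using assms by (auto simp: fejer_coeff_def max_def field_simps)
    then have "complex_of_int (int M - \<bar>k\<bar>) = of_nat M * of_real (fejer_coeff M k)"
      by (metis of_real_mult of_real_of_int_eq of_real_of_nat_eq)
    then show "of_int (int M - \<bar>k\<bar>) * uexp (of_int k * x) = of_nat M * (of_real (fejer_coeff M k) * uexp (of_int k * x))"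
      by simp
  qed
  also have "(\<Sum>k\<in>{-int M..int M}. of_real (fejer_coeff M k) * uexp (of_int k * x)) = trigpoly {-N..N} (\<lambda>k. of_real (fejer_coeff M k)) x"
    unfolding trigpoly_def
  proof (rule sum.mono_neutral_left)
    show "\<forall>k\<in>{-N..N} - {-int M..int M}. complex_of_real (fejer_coeff M k) * uexp (of_int k * x) = 0"
    proof
      fix k assume "k \<in> {-N..N} - {-int M..int M}"
      then have "int M \<le> \<bar>k\<bar>" by auto
      then have "real M \<le> \<bar>real_of_int k\<bar>" by (metis of_int_abs of_int_le_iff of_int_of_nat_eq)
      then have "fejer_coeff M k = 0" using assms by (simp add: fejer_coeff_def max_def field_simps)
      then show "complex_of_real (fejer_coeff M k) * uexp (of_int k * x) = 0" by simp
    qed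
  qed (use assms in auto)
  finally show ?thesis using assms by (simp add: fejer_def)
qed

lemma fejer_nonneg: "0 \<le> fejer M x" by (simp add: fejer_def)

lemma fejer_le: "fejer M x \<le> M"
proof (cases "M = 0")
  case False
  have "norm (\<Sum>j<M. uexp (of_nat j * x)) \<le> M"
    by (rule order_trans[OF norm_sum]) simp
  then have "(norm (\<Sum>j<M. uexp (of_nat j * x)))\<^sup>2 \<le> (real M)\<^sup>2" by (intro power_mono) auto
  then show ?thesis using False by (simp add: fejer_def field_simps power2_eq_square)
qed (simp add: fejer_def)

text \<open>The range goes beyond 1/2 because a point of \<open>{-1/4..3/4}\<close> and one of
  \<open>{0..1/2}\<close> can be 3/4 apart. The split at 1/3 uses that cosine is at least 1/2 on
  \<open>{0..pi/3}\<close>: below it through the mean value theorem, above it because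
  \<open>pi * y\<close> is within \<open>pi / 3\<close> of \<open>pi / 2\<close>.\<close>

lemma abs_sin_pi_ge:
  assumes "\<bar>x\<bar> \<le> 3/4"
  shows "\<bar>x\<bar> / 2 \<le> \<bar>sin (pi * x)\<bar>"
proof -
  have main: "y / 2 \<le> sin (pi * y)" if y: "0 \<le> y" "y \<le> 3/4" for y :: real
  proof (cases "y \<le> 1/3")
    case True
    show ?thesis
    proof (cases "y = 0")
      case False
      then have y0: "0 < y" using y by simp
      obtain z where z: "0 < z" "z < pi * y" "sin (pi * y) - sin 0 = (pi * y - 0) * cos z"
        using MVT2[of 0 "pi * y" sin cos] y0 by (auto intro: DERIV_sin)
      have "pi * y \<le> pi / 3" using True by (simp add: field_simps)
      then have "z \<le> pi / 3" using z(2) by linarith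
      then have "cos (pi / 3) \<le> cos z" using z(1) by (intro cos_monotone_0_pi_le) auto
      then have "1/2 \<le> cos z" by (simp add: cos_60)
      then have "pi * y * (1/2) \<le> pi * y * cos z" using y0 by (intro mult_left_mono) auto
      moreover have "1 * y \<le> pi * y" using pi_gt3 y by (intro mult_right_mono) auto
      moreover have "sin (pi * y) = pi * y * cos z" using z(3) by simp
      ultimately show ?thesis by linarith
    qed simp
  next
    case False
    have "\<bar>pi * y - pi / 2\<bar> \<le> pi / 3"
    proof -
      have "pi * y - pi / 2 = pi * (y - 1/2)" by (simp add: algebra_simps)
      then have "\<bar>pi * y - pi / 2\<bar> = pi * \<bar>y - 1/2\<bar>" by (simp add: abs_mult)
      also have "\<dots> \<le> pi * (1/3)" 
      proof (rule mult_left_mono)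
        show "\<bar>y - 1/2\<bar> \<le> 1/3" using False y by linarith
      qed simp
      finally show ?thesis by simp
    qed
    then have "cos (pi / 3) \<le> cos \<bar>pi * y - pi / 2\<bar>" by (intro cos_monotone_0_pi_le) auto
    also have "cos \<bar>pi * y - pi / 2\<bar> = sin (pi * y)" by (simp add: cos_diff)
    finally show ?thesis using y by (simp add: cos_60)
  qed
  show ?thesis
  proof (cases "0 \<le> x")
    case True
    then show ?thesis using main[of x] assms by (simp add: abs_le_iff)
  next
    case False
    then show ?thesis using main[of "-x"] assms by auto
  qed
qed

lemma norm_1_minus_uexp: "norm (1 - uexp x) = 2 * \<bar>sin (pi * x)\<bar>"
proof -
  have "(norm (1 - uexp x))\<^sup>2 = (1 - cos (2 * pi * x))\<^sup>2 + (sin (2 * pi * x))\<^sup>2"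
    by (simp add: cmod_power2 uexp_def)
  also have "\<dots> = 2 - 2 * cos (2 * pi * x)"
    using sin_cos_squared_add[of "2 * pi * x"] by (simp add: power2_diff) 
  also have "cos (2 * pi * x) = 1 - 2 * (sin (pi * x))\<^sup>2"
    using cos_double_sin[of "pi * x"] by (simp add: mult_ac)
  finally have "(norm (1 - uexp x))\<^sup>2 = (2 * \<bar>sin (pi * x)\<bar>)\<^sup>2" by (simp add: power_mult_distrib)
  then show ?thesis by (rule power2_eq_imp_eq) auto
qed

lemma norm_uexp_diff_le: "norm (uexp x - uexp y) \<le> 2 * pi * \<bar>x - y\<bar>"
proof -
  have "uexp x - uexp y = uexp x * (1 - uexp (y - x))"
    by (simp add: right_diff_distrib uexp_add[symmetric])
  then have "norm (uexp x - uexp y) = 2 * \<bar>sin (pi * (y - x))\<bar>"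
    by (simp add: norm_mult norm_1_minus_uexp)
  also have "\<dots> \<le> 2 * \<bar>pi * (y - x)\<bar>" by (intro mult_left_mono abs_sin_x_le_abs_x) simp
  finally show ?thesis by (simp add: abs_mult abs_minus_commute)
qed

lemma fejer_decay:
  assumes "0 < M" "x \<noteq> 0" "\<bar>x\<bar> \<le> 3/4"
  shows "fejer M x \<le> 4 / (M * x\<^sup>2)"
proof -
  let ?S = "\<Sum>j<M. uexp (of_nat j * x)"
  have pw: "uexp (of_nat j * x) = uexp x ^ j" for j
  proof -
    have "uexp x ^ j = cis (of_nat j * (2 * pi * x))" unfolding uexp_def by (rule Complex.DeMoivre)
    then show ?thesis by (simp add: uexp_def mult_ac)
  qed
  have "(1 - uexp x) * ?S = 1 - uexp x ^ M"
    unfolding pw by (simp add: one_diff_power_eq)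
  then have "norm (1 - uexp x) * norm ?S = norm (1 - uexp x ^ M)" by (metis norm_mult)
  also have "\<dots> \<le> 2" by (rule order_trans[OF norm_triangle_ineq4]) (simp add: norm_power)
  finally have 1: "norm (1 - uexp x) * norm ?S \<le> 2" .
  have "\<bar>x\<bar> \<le> norm (1 - uexp x)" using abs_sin_pi_ge[OF assms(3)] by (simp add: norm_1_minus_uexp)
  then have "\<bar>x\<bar> * norm ?S \<le> 2" using 1 by (meson mult_right_mono norm_ge_zero order_trans)
  then have "(\<bar>x\<bar> * norm ?S)\<^sup>2 \<le> 2\<^sup>2" by (intro power_mono) auto
  then have "x\<^sup>2 * (norm ?S)\<^sup>2 \<le> 4" by (simp add: power_mult_distrib)
  then have "(norm ?S)\<^sup>2 \<le> 4 / x\<^sup>2" using assms by (simp add: field_simps)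
  then show ?thesis using divide_right_mono[of "(norm ?S)\<^sup>2" "4 / x\<^sup>2" "real M"]
    by (simp add: fejer_def mult.commute)
qed

lemma fejer_periodic: "fejer M (x + of_int k) = fejer M x"
proof -
  have "uexp (of_nat j * (x + of_int k)) = uexp (of_nat j * x)" for j
    using uexp_of_int[of "int j * k"] by (simp add: distrib_left uexp_add)
  then show ?thesis by (simp add: fejer_def)
qed

lemma continuous_on_fejer [continuous_intros]: "continuous_on S f \<Longrightarrow> continuous_on S (\<lambda>x. fejer M (f x))"
  unfolding fejer_def divide_inverse by (intro continuous_intros)

text \<open>A dyadic domination that turns kernel means into measures of intervals. At the first
  radius \<open>2^i / 2^n\<close> reaching \<open>z\<close>, either \<open>i = 0\<close> and the
  trivial bound \<open>2^n\<close> applies, or \<open>\<bar>z\<bar>\<close> exceeds half the radius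
  and the decay \<open>4 / (2^n * z\<^sup>2)\<close> gives the factor 16. The last radius is 1, so
  some layer always applies.\<close>

lemma fejer_layer:
  assumes "\<bar>z\<bar> \<le> 3/4"
  shows "fejer (2^n) z \<le> (\<Sum>i\<le>n. 16 * 2^n / 4^i * indicator {- (2^i / 2^n)..2^i / 2^n} z)"
proof -
  define P where "P i \<longleftrightarrow> \<bar>z\<bar> \<le> 2^i / 2^n" for i :: nat
  have Pn: "P n" using assms by (simp add: P_def)
  define i where "i = (LEAST i. P i)"
  have i: "P i" "i \<le> n" using Pn by (auto simp: i_def intro: LeastI Least_le)
  have "fejer (2^n) z \<le> 16 * 2^n / 4^i"
  proof (cases i)
    case 0
    have "real (2^n) \<le> 16 * 2^n / 4^i" by (simp add: 0)
    then show ?thesis using fejer_le[of "2^n" z] by linarith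
  next
    case (Suc j)
    then have nP: "\<not> P j" using not_less_Least[of j P] by (simp add: i_def)
    then have j: "2^j / 2^n < \<bar>z\<bar>" by (simp add: P_def)
    moreover have "(0::real) < 2^j / 2^n" by simp
    ultimately have "0 < \<bar>z\<bar>" by (rule less_trans[rotated])
    then have z: "z \<noteq> 0" by simp
    have "(2^j / 2^n)\<^sup>2 \<le> \<bar>z\<bar>\<^sup>2" using j by (intro power_mono) auto
    then have "4^j / (2^n * 2^n) \<le> z\<^sup>2" by (simp add: power_divide power2_eq_square power_mult_distrib[symmetric])
    have "fejer (2^n) z \<le> 4 / (real (2^n) * z\<^sup>2)" using fejer_decay[of "2^n" z] z assms by simp
    also have "\<dots> \<le> 4 / (2^n * (4^j / (2^n * 2^n)))"
    proof (rule divide_left_mono)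
      show "2^n * (4^j / (2^n * 2^n)) \<le> real (2^n) * z\<^sup>2"
        using \<open>4^j / (2^n * 2^n) \<le> z\<^sup>2\<close> by (simp only: of_nat_power of_nat_numeral) (rule mult_left_mono, auto)
      show "0 < real (2^n) * z\<^sup>2 * (2^n * (4^j / (2^n * 2^n)))" using z by (intro mult_pos_pos divide_pos_pos) auto
    qed simp
    also have "\<dots> = 16 * 2^n / 4^i" by (simp add: Suc field_simps)
    finally show ?thesis .
  qed
  also have "\<dots> = 16 * 2^n / 4^i * indicator {- (2^i / 2^n)..2^i / 2^n} z"
    using i(1) by (auto simp: P_def indicator_def abs_le_iff)
  also have "\<dots> \<le> (\<Sum>i\<le>n. 16 * 2^n / 4^i * indicator {- (2^i / 2^n)..2^i / 2^n} z)"
    using i(2) by (intro member_le_sum) auto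
  finally show ?thesis .
qed

text \<open>A combination of two Fejer kernels, so pointwise kernel estimates are inherited, while
  frequencies up to \<open>2^n\<close> keep weight exactly 1, as the large sieve and the separation
  of blocks require. A single Fejer kernel lacks the second property, a sharp cutoff the
  first.\<close>

definition vp_coeff :: "nat \<Rightarrow> int \<Rightarrow> real" where
  "vp_coeff n k = 2 * fejer_coeff (2^Suc n) k - fejer_coeff (2^n) k"

lemma vp_coeff:
  "0 \<le> vp_coeff n k" "vp_coeff n k \<le> 1" "\<bar>k\<bar> \<le> 2^n \<Longrightarrow> vp_coeff n k = 1" "2^Suc n \<le> \<bar>k\<bar> \<Longrightarrow> vp_coeff n k = 0"
proof -
  define y :: real where "y = \<bar>of_int k\<bar> / 2^n"
  have e: "vp_coeff n k = 2 * max 0 (1 - y / 2) - max 0 (1 - y)"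
    unfolding vp_coeff_def fejer_coeff_def y_def by (simp add: mult.commute)
  have y: "0 \<le> y" by (simp add: y_def)
  show "0 \<le> vp_coeff n k" "vp_coeff n k \<le> 1" unfolding e using y by (auto simp: max_def)
  show "vp_coeff n k = 1" if "\<bar>k\<bar> \<le> 2^n"
  proof -
    have "of_int \<bar>k\<bar> \<le> (of_int (2^n) :: real)" using that by (simp only: of_int_le_iff)
    then have "y \<le> 1" by (simp add: y_def divide_le_eq_1)
    then show ?thesis unfolding e using y by (auto simp: max_def)
  qed
  show "vp_coeff n k = 0" if "2^Suc n \<le> \<bar>k\<bar>"
  proof -
    have "(of_int (2^Suc n) :: real) \<le> of_int \<bar>k\<bar>" using that by (simp only: of_int_le_iff)
    then have "2 \<le> y" by (simp add: y_def field_simps)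
    then show ?thesis unfolding e by (auto simp: max_def)
  qed
qed

definition vp :: "nat \<Rightarrow> real \<Rightarrow> real" where
  "vp n x = 2 * fejer (2^Suc n) x - fejer (2^n) x"

lemma vp_eq_trigpoly:
  assumes "2^Suc n \<le> N"
  shows "of_real (vp n x) = trigpoly {-N..N} (\<lambda>k. of_real (vp_coeff n k)) x"
proof -
  have "(2::int)^n \<le> N" using assms by (rule order_trans[rotated]) simp
  then show ?thesis
    using fejer_eq_trigpoly[of "2^n" N x] fejer_eq_trigpoly[of "2^Suc n" N x] assms
    unfolding vp_def vp_coeff_def
    by (simp add: trigpoly_def sum_subtractf sum_distrib_left algebra_simps)
qed

section \<open>Measures of dimension close to one on the circle\<close>

text \<open>Confining \<open>X\<close> to half a period leaves room for shifts up to 1/4: shifted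
  points stay in \<open>{-1/4..3/4}\<close>, hence within 3/4 of all of \<open>X\<close>, and there
  the periodic kernels still decay with the true distance.\<close>

locale circle_measure = prob_space \<nu> for \<nu> :: "real measure" +
  fixes X :: "real set" and C \<alpha> :: real
  assumes sets_nu: "sets \<nu> = sets borel" and X_sub: "X \<subseteq> {0..1/2}" and AE_X: "AE x in \<nu>. x \<in> X"
    and C1: "1 \<le> C" and \<alpha>: "0 < \<alpha>" "\<alpha> < 1"
    and ball: "\<And>x \<epsilon>. 0 < \<epsilon> \<Longrightarrow> \<epsilon> \<le> 1 \<Longrightarrow> measure \<nu> {x..x + \<epsilon>} \<le> C * \<epsilon> powr \<alpha>"
begin

lemma integrable_continuous:
  fixes f :: "real \<Rightarrow> 'b::{banach,second_countable_topology}"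
  assumes "continuous_on UNIV f" "\<And>x. norm (f x) \<le> B"
  shows "integrable \<nu> f"
proof (rule integrable_const_bound)
  have "f \<in> borel_measurable borel" using assms(1) by (rule borel_measurable_continuous_onI)
  then show "f \<in> borel_measurable \<nu>" using measurable_cong_sets[OF sets_nu refl, of borel] by blast
qed (use assms in auto)

lemma integrable_uexp: "integrable \<nu> (\<lambda>x. uexp (t * x))"
  by (rule integrable_continuous[of _ 1]) (auto intro!: continuous_intros)

text \<open>\<open>fc k\<close> is the Fourier coefficient at frequency \<open>-k\<close>.\<close>

definition fc :: "int \<Rightarrow> complex" where "fc k = (LINT x|\<nu>. uexp (of_int k * x))"

lemma fc_0: "fc 0 = 1" using prob_space by (simp add: fc_def)

lemma fc_uminus: "fc (- k) = cnj (fc k)"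
proof -
  have "cnj (fc k) = (LINT x|\<nu>. cnj (uexp (of_int k * x)))"
    unfolding fc_def by (rule Bochner_Integration.integral_cnj[symmetric])
  then show ?thesis by (simp add: fc_def cnj_uexp)
qed

lemma norm_fc: "norm (fc k) \<le> 1"
proof -
  have "norm (fc k) \<le> (LINT x|\<nu>. norm (uexp (of_int k * x)))"
    unfolding fc_def by (rule integral_norm_bound)
  then show ?thesis using prob_space by simp
qed

lemma integral_trigpoly: "finite S \<Longrightarrow> (LINT x|\<nu>. trigpoly S a x) = (\<Sum>k\<in>S. a k * fc k)"
  unfolding trigpoly_def fc_def by (simp add: integrable_uexp)

lemma fejer_integrable: "integrable \<nu> (\<lambda>y. fejer M (x - y))"
  by (rule integrable_continuous[of _ M]) (auto intro!: continuous_intros simp: fejer_nonneg fejer_le)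

definition u :: "nat \<Rightarrow> real \<Rightarrow> real" where "u n x = (LINT y|\<nu>. vp n (x - y))"

text \<open>The conjugate undoes the sign convention of \<open>fc\<close>: \<open>cnj (fc k)\<close>
  is the coefficient of \<open>\<nu>\<close> at \<open>k\<close>.\<close>

definition cf :: "nat \<Rightarrow> int \<Rightarrow> complex" where "cf n k = of_real (vp_coeff n k) * cnj (fc k)"

lemma u_eq_trigpoly:
  assumes "2^Suc n \<le> N"
  shows "of_real (u n x) = trigpoly {-N..N} (cf n) x"
proof -
  have "complex_of_real (u n x) = (LINT y|\<nu>. of_real (vp n (x - y)))"
    unfolding u_def by (rule integral_complex_of_real[symmetric])
  also have "\<dots> = (LINT y|\<nu>. (\<Sum>k\<in>{-N..N}. (of_real (vp_coeff n k) * uexp (of_int k * x)) * uexp (of_int (- k) * y)))"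
    unfolding vp_eq_trigpoly[OF assms] trigpoly_def right_diff_distrib
    by (simp add: uexp_add[of _ "- _", simplified] mult_ac)
  also have "\<dots> = (\<Sum>k\<in>{-N..N}. (of_real (vp_coeff n k) * uexp (of_int k * x)) * fc (- k))"
    unfolding fc_def by (simp add: integrable_uexp del: of_int_minus)
  also have "\<dots> = trigpoly {-N..N} (cf n) x"
    unfolding trigpoly_def cf_def fc_uminus by (simp add: mult_ac)
  finally show ?thesis .
qed

lemma cf_zero: "2^Suc n \<le> \<bar>k\<bar> \<Longrightarrow> cf n k = 0" by (simp add: cf_def vp_coeff del: power_Suc)

lemma ball2: "0 < \<rho> \<Longrightarrow> \<rho> \<le> 1 \<Longrightarrow> measure \<nu> {x - \<rho>..x + \<rho>} \<le> 2 * C * \<rho> powr \<alpha>"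
proof -
  assume \<rho>: "0 < \<rho>" "\<rho> \<le> 1"
  have m: "{a..b} \<in> sets \<nu>" for a b :: real by (simp add: sets_nu)
  have "measure \<nu> {x - \<rho>..x + \<rho>} \<le> measure \<nu> ({x - \<rho>..(x - \<rho>) + \<rho>} \<union> {x..x + \<rho>})"
    by (intro finite_measure_mono sets.Un m) auto
  also have "\<dots> \<le> measure \<nu> {x - \<rho>..(x - \<rho>) + \<rho>} + measure \<nu> {x..x + \<rho>}"
    by (rule measure_Un_le[OF m m])
  also have "\<dots> \<le> C * \<rho> powr \<alpha> + C * \<rho> powr \<alpha>" by (intro add_mono ball \<rho>)
  finally show ?thesis by simp
qed

text \<open>Layer \<open>i\<close> contributes at most \<open>16 * 2^n / 4^i\<close> times
  \<open>2 * C * (2^i / 2^n) powr \<alpha>\<close>. Bounding \<open>2 powr (i * \<alpha>)\<close> by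
  \<open>2^i\<close> leaves a geometric series of ratio 1/2, whose sum 2 turns 32 into 64.\<close>

lemma fejer_mean_le:
  assumes x: "x \<in> {-1/4..3/4}"
  shows "(LINT y|\<nu>. fejer (2^n) (x - y)) \<le> 64 * C * 2 powr (n * (1 - \<alpha>))"
proof -
  let ?\<rho> = "\<lambda>i::nat. 2^i / 2^n :: real"
  have ms: "{x - ?\<rho> i..x + ?\<rho> i} \<in> sets \<nu>" for i by (simp add: sets_nu)
  have ind: "indicator {- ?\<rho> i..?\<rho> i} (x - y) = (indicator {x - ?\<rho> i..x + ?\<rho> i} y :: real)" for i y
    by (auto simp: indicator_def)
  have int: "integrable \<nu> (\<lambda>y. 16 * 2^n / 4^i * indicator {x - ?\<rho> i..x + ?\<rho> i} y :: real)" for i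
    using ms[of i] by (intro integrable_mult_right integrable_real_indicator) (auto simp: emeasure_eq_measure)
  have "(LINT y|\<nu>. fejer (2^n) (x - y)) \<le> (LINT y|\<nu>. (\<Sum>i\<le>n. 16 * 2^n / 4^i * indicator {x - ?\<rho> i..x + ?\<rho> i} y))"
  proof (rule integral_mono_AE)
    show "AE y in \<nu>. fejer (2^n) (x - y) \<le> (\<Sum>i\<le>n. 16 * 2^n / 4^i * indicator {x - ?\<rho> i..x + ?\<rho> i} y)"
      using AE_X
    proof eventually_elim
      case (elim y)
      then have "y \<in> {0..1/2}" using X_sub by auto
      then have "0 \<le> y" "y \<le> 1/2" "-1/4 \<le> x" "x \<le> 3/4" using x by auto
      then have "\<bar>x - y\<bar> \<le> 3/4" by linarith
      from fejer_layer[OF this, of n] show ?case unfolding ind .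
    qed
  qed (use int in \<open>auto intro!: fejer_integrable Bochner_Integration.integrable_sum\<close>)
  also have "\<dots> = (\<Sum>i\<le>n. 16 * 2^n / 4^i * measure \<nu> {x - ?\<rho> i..x + ?\<rho> i})"
    using ms int by (subst Bochner_Integration.integral_sum) (auto intro!: sum.cong)
  also have "\<dots> \<le> (\<Sum>i\<le>n. 32 * C * 2 powr (n * (1 - \<alpha>)) * (1/2)^i)"
  proof (rule sum_mono)
    fix i assume "i \<in> {..n}"
    then have \<rho>: "0 < ?\<rho> i" "?\<rho> i \<le> 1" by (auto simp: divide_le_eq_1)
    have "measure \<nu> {x - ?\<rho> i..x + ?\<rho> i} \<le> 2 * C * ?\<rho> i powr \<alpha>" by (rule ball2[OF \<rho>])
    also have "?\<rho> i powr \<alpha> \<le> 2^i * 2 powr (- (n * \<alpha>))"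
    proof -
      have "?\<rho> i powr \<alpha> = 2 powr (i * \<alpha>) * 2 powr (- (n * \<alpha>))"
      proof -
        have "?\<rho> i = 2 powr (real i - real n)" by (simp add: powr_diff powr_realpow)
        then show ?thesis by (simp add: powr_powr powr_add[symmetric] algebra_simps)
      qed
      also have "2 powr (i * \<alpha>) \<le> 2 powr (real i)" using \<alpha> by (intro powr_mono mult_left_le) auto
      finally show ?thesis by (simp add: powr_realpow mult_right_mono)
    qed
    finally have "measure \<nu> {x - ?\<rho> i..x + ?\<rho> i} \<le> 2 * C * (2^i * 2 powr (- (n * \<alpha>)))"
      using C1 by (simp add: mult_left_mono)
    then have "16 * 2^n / 4^i * measure \<nu> {x - ?\<rho> i..x + ?\<rho> i} \<le> 16 * 2^n / 4^i * (2 * C * (2^i * 2 powr (- (n * \<alpha>))))"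
      by (intro mult_left_mono) auto
    also have "\<dots> = 32 * C * (2^n * 2 powr (- (n * \<alpha>))) * (2^i / 4^i)" by simp
    also have "(2::real)^i / 4^i = (1/2)^i" by (simp add: power_divide[symmetric])
    also have "(2::real)^n * 2 powr (- (n * \<alpha>)) = 2 powr (n * (1 - \<alpha>))"
      by (simp add: powr_realpow[symmetric] powr_add[symmetric] algebra_simps)
    finally show "16 * 2^n / 4^i * measure \<nu> {x - ?\<rho> i..x + ?\<rho> i} \<le> 32 * C * 2 powr (n * (1 - \<alpha>)) * (1/2)^i" .
  qed
  also have "\<dots> = 32 * C * 2 powr (n * (1 - \<alpha>)) * (\<Sum>i\<le>n. (1/2)^i)" by (rule sum_distrib_left[symmetric])
  also have "(\<Sum>i\<le>n. (1/2)^i) \<le> (2::real)"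
  proof -
    have "(\<Sum>i\<le>n. (1/2)^i) = (2::real) - 2 * (1/2)^Suc n"
      by (induction n) (auto simp: field_simps)
    then show ?thesis by simp
  qed
  finally show ?thesis using C1 by (simp add: mult_left_mono)
qed

text \<open>\<open>192 = 2 * 64 + 64\<close> adds the means of the two Fejer kernels in
  \<open>u n\<close>; the exponent is that of the finer one.\<close>

definition K :: "nat \<Rightarrow> real" where "K n = 192 * C * 2 powr (real (Suc n) * (1 - \<alpha>))"

lemma K_pos: "1 \<le> K n" "0 < K n"
proof -
  have "1 \<le> (2::real) powr (real (Suc n) * (1 - \<alpha>))" using \<alpha> by (intro ge_one_powr_ge_zero) auto
  then have "1 * 1 \<le> (192 * C) * 2 powr (real (Suc n) * (1 - \<alpha>))" using C1 by (intro mult_mono) auto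
  then show "1 \<le> K n" "0 < K n" by (auto simp: K_def)
qed

lemma K_mono: "n \<le> n' \<Longrightarrow> K n \<le> K n'"
  unfolding K_def using C1 \<alpha> by (intro mult_left_mono powr_mono mult_right_mono) auto

lemma u_split: "u n x = 2 * (LINT y|\<nu>. fejer (2^Suc n) (x - y)) - (LINT y|\<nu>. fejer (2^n) (x - y))"
  unfolding u_def vp_def by (subst Bochner_Integration.integral_diff) (auto intro!: fejer_integrable integrable_mult_right)

lemma abs_u_le_fejer: "\<bar>u n x\<bar> \<le> 2 * (LINT y|\<nu>. fejer (2^Suc n) (x - y)) + (LINT y|\<nu>. fejer (2^n) (x - y))"
proof -
  have "0 \<le> (LINT y|\<nu>. fejer M (x - y))" for M by (simp add: fejer_nonneg)
  from this[of "2^Suc n"] this[of "2^n"] show ?thesis unfolding u_split by (auto simp: abs_le_iff)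
qed

lemma abs_u_le: "\<bar>u n x\<bar> \<le> K n"
proof -
  \<comment> \<open>Translates \<open>x\<close> by an integer into \<open>{-1/4..3/4}\<close>, where
    \<open>fejer_mean_le\<close> holds; the kernels have period 1.\<close>
  define k where "k = \<lfloor>x + 1/4\<rfloor>"
  define x' where "x' = x + of_int (- k)"
  have x': "x' \<in> {-1/4..3/4}" unfolding x'_def k_def by (simp, linarith)
  have per: "(LINT y|\<nu>. fejer M (x - y)) = (LINT y|\<nu>. fejer M (x' - y))" for M
  proof (rule Bochner_Integration.integral_cong[OF refl])
    fix y
    have "x' - y = (x - y) + of_int (- k)" by (simp add: x'_def)
    then show "fejer M (x - y) = fejer M (x' - y)" using fejer_periodic by metis
  qed
  have m: "2 powr (real n * (1 - \<alpha>)) \<le> 2 powr (real (Suc n) * (1 - \<alpha>))"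
    using \<alpha> by (intro powr_mono mult_right_mono) auto
  have "\<bar>u n x\<bar> \<le> 2 * (64 * C * 2 powr (real (Suc n) * (1 - \<alpha>))) + 64 * C * 2 powr (real n * (1 - \<alpha>))"
    by (rule order_trans[OF abs_u_le_fejer]) (intro add_mono mult_left_mono fejer_mean_le[OF x', folded per]; simp)
  also have "\<dots> \<le> 2 * (64 * C * 2 powr (real (Suc n) * (1 - \<alpha>))) + 64 * C * 2 powr (real (Suc n) * (1 - \<alpha>))"
    using C1 m by (intro add_left_mono mult_left_mono) auto
  finally show ?thesis by (simp add: K_def)
qed

lemma continuous_on_u [continuous_intros]:
  assumes "continuous_on S f" shows "continuous_on S (\<lambda>x. u n (f x))"
proof -
  have "(\<lambda>x. u n (f x)) = (\<lambda>x. Re (trigpoly {-(2^Suc n)..2^Suc n} (cf n) (f x)))"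
    using u_eq_trigpoly[of n "2^Suc n"] by (metis Re_complex_of_real order_refl)
  then show ?thesis using assms by (simp only:) (intro continuous_intros)
qed

text \<open>Pairing \<open>u n\<close> with \<open>\<nu>\<close> itself expresses the energy as a
  mean, so the sup bound on \<open>u n\<close> becomes an \<open>L\<^sup>2\<close> bound with no
  further loss.\<close>

lemma energy:
  assumes "2^Suc n \<le> N"
  shows "(\<Sum>k\<in>{-N..N}. vp_coeff n k * (norm (fc k))\<^sup>2) = (LINT x|\<nu>. u n x)"
proof -
  have "complex_of_real (LINT x|\<nu>. u n x) = (LINT x|\<nu>. of_real (u n x))"
    by (rule integral_complex_of_real[symmetric])
  also have "\<dots> = (\<Sum>k\<in>{-N..N}. cf n k * fc k)"
    unfolding u_eq_trigpoly[OF assms] by (rule integral_trigpoly) simp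
  also have "\<dots> = of_real (\<Sum>k\<in>{-N..N}. vp_coeff n k * (norm (fc k))\<^sup>2)"
    by (simp add: cf_def complex_norm_square mult_ac del: of_real_power)
  finally show ?thesis by (simp only: of_real_eq_iff)
qed

lemma mean_u_le: "(LINT x|\<nu>. u n x) \<le> K n"
proof -
  have "(LINT x|\<nu>. u n x) \<le> (LINT x|\<nu>. K n)"
    by (rule integral_mono[OF integrable_continuous[of _ "K n"]])
      (use abs_u_le in \<open>auto intro!: continuous_intros simp: abs_le_iff\<close>)
  then show ?thesis using prob_space by simp
qed

text \<open>The zero frequency alone contributes 1 to the energy, and the other terms are
  nonnegative.\<close>

lemma mean_u_ge: "1 \<le> (LINT x|\<nu>. u n x)"
proof -
  let ?N = "2^Suc n :: int"
  have "1 = vp_coeff n 0 * (norm (fc 0))\<^sup>2" by (simp add: vp_coeff fc_0)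
  also have "\<dots> \<le> (\<Sum>k\<in>{-?N..?N}. vp_coeff n k * (norm (fc k))\<^sup>2)"
    by (rule member_le_sum) (auto simp: vp_coeff)
  finally show ?thesis by (subst (asm) energy) auto
qed

lemma sum_fc_le: "(\<Sum>k\<in>{-(2^n)..2^n}. (norm (fc k))\<^sup>2) \<le> K n"
proof -
  let ?N = "2^Suc n :: int"
  have "(\<Sum>k\<in>{-(2^n)..2^n}. (norm (fc k))\<^sup>2) = (\<Sum>k\<in>{-(2^n)..2^n}. vp_coeff n k * (norm (fc k))\<^sup>2)"
    by (intro sum.cong refl) (auto simp: vp_coeff abs_le_iff)
  also have "\<dots> \<le> (\<Sum>k\<in>{-?N..?N}. vp_coeff n k * (norm (fc k))\<^sup>2)"
    by (rule sum_mono2) (auto simp: vp_coeff intro: order_trans)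
  also have "\<dots> \<le> K n" using mean_u_le[of n] by (subst energy) auto
  finally show ?thesis .
qed

lemma norm_cf_le: "norm (cf n k) \<le> norm (fc k)"
  unfolding cf_def norm_mult using vp_coeff(1,2)[of n k] by (simp add: mult_left_le_one_le)

lemma norm_cf_diff_le: "norm (cf n k - cf n' k) \<le> norm (fc k)"
proof -
  have e: "cf n k - cf n' k = of_real (vp_coeff n k - vp_coeff n' k) * cnj (fc k)" by (simp add: cf_def algebra_simps)
  have "\<bar>vp_coeff n k - vp_coeff n' k\<bar> \<le> 1" using vp_coeff(1,2)[of n k] vp_coeff(1,2)[of n' k] by linarith
  then show ?thesis unfolding e norm_mult norm_of_real by (simp add: mult_left_le_one_le)
qed

text \<open>A large sieve inequality: \<open>|G|\<^sup>2\<close> has frequencies below \<open>2^m\<close>, so integrating it against \<open>\<nu>\<close>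
  is the same as integrating it against the density \<open>u m\<close>.\<close>

lemma large_sieve:
  assumes N: "2 * N \<le> 2^m"
  shows "(LINT x|\<nu>. (norm (trigpoly {-N..N} g x))\<^sup>2) \<le> K m * (\<Sum>k\<in>{-N..N}. (norm (g k))\<^sup>2)"
proof -
  let ?S = "{-N..N}" and ?J = "{-(2^Suc m)..2^Suc m} :: int set"
  have uG: "of_real ((norm (trigpoly ?S g x))\<^sup>2 * u m x)
     = (\<Sum>k\<in>?S. \<Sum>l\<in>?S. \<Sum>j\<in>?J. (g k * cnj (g l) * cf m j) * uexp (of_int (k - l + j) * x))" for x
    unfolding of_real_mult norm_trigpoly_square u_eq_trigpoly[OF order_refl] unfolding trigpoly_def sum_distrib_right
    unfolding sum_distrib_left
  proof (intro sum.cong refl)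
    fix k l j :: int
    have "uexp (of_int (k - l + j) * x) = uexp (of_int (k - l) * x) * uexp (of_int j * x)"
      by (simp only: of_int_add distrib_right uexp_add)
    then show "g k * cnj (g l) * uexp (of_int (k - l) * x) * (cf m j * uexp (of_int j * x))
        = g k * cnj (g l) * cf m j * uexp (of_int (k - l + j) * x)"
      by (simp only: mult_ac)
  qed
  have i1: "(\<lambda>x. c * uexp (t * x)) integrable_on {0..1}" for c t
    by (intro integrable_continuous_real continuous_intros)
  have "complex_of_real (integral {0..1} (\<lambda>x. (norm (trigpoly ?S g x))\<^sup>2 * u m x))
     = (\<Sum>k\<in>?S. \<Sum>l\<in>?S. \<Sum>j\<in>?J. (g k * cnj (g l) * cf m j) * integral {0..1} (\<lambda>x. uexp (of_int (k - l + j) * x)))"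
    unfolding integral_interval_complex_of_real[symmetric] uG
    by (simp add: integral_sum integrable_sum i1 del: of_int_diff of_int_add)
  also have "\<dots> = (\<Sum>k\<in>?S. \<Sum>l\<in>?S. g k * cnj (g l) * fc (k - l))"
  proof (intro sum.cong refl)
    fix k l assume kl: "k \<in> ?S" "l \<in> ?S"
    have per: "integral {0..1} (\<lambda>x. uexp (of_int n * x)) = (if n = 0 then 1 else 0)" for n
      using integral_uexp_period[of 0 n] by simp
    have "(\<Sum>j\<in>?J. (g k * cnj (g l) * cf m j) * integral {0..1} (\<lambda>x. uexp (of_int (k - l + j) * x)))
      = (\<Sum>j\<in>?J. if j = l - k then g k * cnj (g l) * cf m j else 0)"
      unfolding per by (intro sum.cong refl) auto
    also have "\<dots> = g k * cnj (g l) * cf m (l - k)"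
    proof -
      have "l - k \<in> ?J" using kl N by auto
      then show ?thesis by simp
    qed
    also have "cf m (l - k) = fc (k - l)"
    proof -
      have "\<bar>l - k\<bar> \<le> 2^m" using kl N by auto
      then show ?thesis using fc_uminus[of "l - k"] by (simp add: cf_def vp_coeff)
    qed
    finally show "(\<Sum>j\<in>?J. (g k * cnj (g l) * cf m j) * integral {0..1} (\<lambda>x. uexp (of_int (k - l + j) * x))) = g k * cnj (g l) * fc (k - l)" .
  qed
  also have "\<dots> = (LINT x|\<nu>. (\<Sum>k\<in>?S. \<Sum>l\<in>?S. g k * cnj (g l) * uexp (of_int (k - l) * x)))"
    unfolding fc_def by (simp add: integrable_uexp del: of_int_diff)
  also have "\<dots> = of_real (LINT x|\<nu>. (norm (trigpoly ?S g x))\<^sup>2)"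
    unfolding norm_trigpoly_square[symmetric] by (rule integral_complex_of_real)
  finally have "(LINT x|\<nu>. (norm (trigpoly ?S g x))\<^sup>2) = integral {0..1} (\<lambda>x. (norm (trigpoly ?S g x))\<^sup>2 * u m x)"
    by (simp only: of_real_eq_iff)
  also have "\<dots> \<le> integral {0..1} (\<lambda>x. (norm (trigpoly ?S g x))\<^sup>2 * K m)"
    using abs_u_le[of m] by (intro integral_le integrable_continuous_real continuous_intros mult_left_mono) (auto simp: abs_le_iff)
  also have "\<dots> = K m * (\<Sum>k\<in>{-N..N}. (norm (g k))\<^sup>2)"
    using parseval_period[of ?S 0 g] by simp
  finally show ?thesis .
qed

text \<open>At distance \<open>d\<close> from \<open>X\<close> both Fejer kernels have decayed; the
  constant is \<open>2 * 4 / 2 + 4\<close>, the first kernel being twice as fine.\<close>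

lemma abs_u_off_support:
  assumes x: "x \<in> {-1/4..3/4}" and d: "0 < d" "\<And>y. y \<in> X \<Longrightarrow> d \<le> \<bar>x - y\<bar>"
  shows "\<bar>u n x\<bar> \<le> 8 / (2^n * d\<^sup>2)"
proof -
  have b: "(LINT y|\<nu>. fejer (2^M) (x - y)) \<le> 4 / (2^M * d\<^sup>2)" for M
  proof -
    have "(LINT y|\<nu>. fejer (2^M) (x - y)) \<le> (LINT y|\<nu>. 4 / (2^M * d\<^sup>2))"
    proof (rule integral_mono_AE[OF fejer_integrable])
      show "AE y in \<nu>. fejer (2^M) (x - y) \<le> 4 / (2^M * d\<^sup>2)"
        using AE_X
      proof eventually_elim
        case (elim y)
        then have "y \<in> {0..1/2}" using X_sub by auto
        then have "0 \<le> y" "y \<le> 1/2" "-1/4 \<le> x" "x \<le> 3/4" using x by auto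
        then have 1: "\<bar>x - y\<bar> \<le> 3/4" by linarith
        have dy: "d \<le> \<bar>x - y\<bar>" by (rule d(2)[OF elim])
        then have "x - y \<noteq> 0" using d(1) by auto
        then have "fejer (2^M) (x - y) \<le> 4 / (real (2^M) * (x - y)\<^sup>2)" using 1 by (intro fejer_decay) auto
        also have "d\<^sup>2 \<le> (x - y)\<^sup>2" using power_mono[OF dy, of 2] d(1) by simp
        then have "4 / (real (2^M) * (x - y)\<^sup>2) \<le> 4 / (2^M * d\<^sup>2)"
          using d(1) \<open>x - y \<noteq> 0\<close> by (intro divide_left_mono) auto
        finally show ?case .
      qed
    qed simp
    then show ?thesis using prob_space by simp
  qed
  have "\<bar>u n x\<bar> \<le> 2 * (4 / (2^Suc n * d\<^sup>2)) + 4 / (2^n * d\<^sup>2)"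
    by (rule order_trans[OF abs_u_le_fejer]) (intro add_mono mult_left_mono b; simp)
  also have "\<dots> = 8 / (2^n * d\<^sup>2)" using d(1) by (simp add: field_simps)
  finally show ?thesis .
qed

text \<open>Deliberately crude: \<open>Lp\<close> and \<open>Bd\<close> rest only on
  \<open>norm (fc k) \<le> 1\<close>, so they depend on \<open>n\<close> and not on the measure. A
  piece of the curve can thus be fixed before the measure is known.\<close>

definition Lp :: "nat \<Rightarrow> real" where "Lp n = (\<Sum>k\<in>{-(2^Suc n)..2^Suc n::int}. 2 * pi * \<bar>of_int k\<bar>)"
definition Bd :: "nat \<Rightarrow> real" where "Bd n = (\<Sum>k\<in>{-(2^Suc n)..2^Suc n::int}. 1)"

lemma u_Lipschitz: "\<bar>u n x - u n y\<bar> \<le> Lp n * \<bar>x - y\<bar>"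
proof -
  let ?N = "2^Suc n :: int"
  have "\<bar>u n x - u n y\<bar> = norm (complex_of_real (u n x) - of_real (u n y))" by (simp flip: of_real_diff)
  also have "\<dots> = norm (\<Sum>k\<in>{-?N..?N}. cf n k * (uexp (of_int k * x) - uexp (of_int k * y)))"
    unfolding u_eq_trigpoly[OF order_refl] trigpoly_def by (simp add: sum_subtractf right_diff_distrib)
  also have "\<dots> \<le> (\<Sum>k\<in>{-?N..?N}. 2 * pi * \<bar>of_int k\<bar> * \<bar>x - y\<bar>)"
  proof (intro order_trans[OF norm_sum] sum_mono)
    fix k
    have "norm (cf n k) * norm (uexp (of_int k * x) - uexp (of_int k * y)) \<le> 1 * (2 * pi * \<bar>of_int k * x - of_int k * y\<bar>)"
      by (intro mult_mono norm_uexp_diff_le order_trans[OF norm_cf_le norm_fc]) auto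
    then show "norm (cf n k * (uexp (of_int k * x) - uexp (of_int k * y))) \<le> 2 * pi * \<bar>of_int k\<bar> * \<bar>x - y\<bar>"
      by (simp add: norm_mult right_diff_distrib[symmetric] abs_mult)
  qed
  finally show ?thesis by (simp add: Lp_def sum_distrib_right)
qed

lemma abs_u_le_Bd: "\<bar>u n x\<bar> \<le> Bd n"
proof -
  have "\<bar>u n x\<bar> = norm (complex_of_real (u n x))" by simp
  also have "\<dots> \<le> (\<Sum>k\<in>{-(2^Suc n)..2^Suc n}. norm (cf n k))"
    unfolding u_eq_trigpoly[OF order_refl] by (rule norm_trigpoly_le)
  also have "\<dots> \<le> Bd n" unfolding Bd_def by (intro sum_mono order_trans[OF norm_cf_le norm_fc])
  finally show ?thesis .
qed



lemma integral_swap: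
  fixes f :: "real \<Rightarrow> real \<Rightarrow> real"
  assumes cont: "continuous_on UNIV (\<lambda>(x,t). f x t)" and B: "\<And>x t. \<bar>f x t\<bar> \<le> B"
  shows "(LINT x|\<nu>. integral {a..b} (f x)) = integral {a..b} (\<lambda>t. LINT x|\<nu>. f x t)"
    and "integrable \<nu> (\<lambda>x. integral {a..b} (f x))"
    and "(\<lambda>t. LINT x|\<nu>. f x t) integrable_on {a..b}"
proof -
  interpret P: pair_sigma_finite \<nu> lborel by unfold_locales
  let ?A = "space \<nu> \<times> {a..b}"
  have m: "(\<lambda>(x,t). f x t) \<in> borel_measurable (\<nu> \<Otimes>\<^sub>M lborel)"
  proof -
    have "(\<lambda>(x,t). f x t) \<in> borel_measurable (borel \<Otimes>\<^sub>M borel)"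
      unfolding borel_prod using cont by (rule borel_measurable_continuous_onI)
    moreover have "sets (\<nu> \<Otimes>\<^sub>M lborel) = sets (borel \<Otimes>\<^sub>M borel)"
      by (intro sets_pair_measure_cong sets_nu sets_lborel)
    ultimately show ?thesis using measurable_cong_sets by blast
  qed
  have A: "?A \<in> sets (\<nu> \<Otimes>\<^sub>M lborel)" by auto
  have "emeasure (\<nu> \<Otimes>\<^sub>M lborel) ?A = emeasure \<nu> (space \<nu>) * emeasure lborel {a..b}"
    by (rule lborel.emeasure_pair_measure_Times) auto
  then have fin: "emeasure (\<nu> \<Otimes>\<^sub>M lborel) ?A < \<infinity>"
    by (simp add: emeasure_space_1 emeasure_lborel_Icc_eq)
  have int: "integrable (\<nu> \<Otimes>\<^sub>M lborel) (\<lambda>z. indicator ?A z *\<^sub>R (case z of (x,t) \<Rightarrow> f x t))"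
    by (rule integrableI_bounded_set_indicator[OF A m fin, of B]) (use B in auto)
  have "integrable (\<nu> \<Otimes>\<^sub>M lborel) (\<lambda>(x,t). indicator {a..b} t * f x t)"
    by (rule Bochner_Integration.integrable_cong[THEN iffD1, OF refl _ int])
      (auto simp: space_pair_measure indicator_def)
  note int = this
  have in1: "(LINT t|lborel. indicator {a..b} t * f x t) = integral {a..b} (f x)" for x
  proof -
    have "continuous_on {a..b} (f x)"
      by (rule continuous_on_fix_fst[of UNIV]) (use cont in \<open>auto intro: continuous_on_subset\<close>)
    then have "set_integrable lborel {a..b} (f x)" by (rule borel_integrable_atLeastAtMost')
    from set_borel_integral_eq_integral(2)[OF this] show ?thesis by (simp add: set_lebesgue_integral_def)
  qed
  \<comment> \<open>Continuity of the mean in \<open>t\<close> identifies the outer Lebesgue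
    integral with the gauge integral over \<open>{a..b}\<close>.\<close>
  have "continuous_on UNIV (\<lambda>t. LINT x|\<nu>. f x t)"
    unfolding continuous_on_eq_continuous_within
  proof
    fix t :: real
    show "continuous (at t) (\<lambda>t. LINT x|\<nu>. f x t)"
    proof (rule continuous_at_sequentiallyI)
      fix s :: "nat \<Rightarrow> real" assume s: "s \<longlonglongrightarrow> t"
      have meas: "f' \<in> borel_measurable \<nu>" if "continuous_on UNIV f'" for f' :: "real \<Rightarrow> real"
        using borel_measurable_continuous_onI[OF that] measurable_cong_sets[OF sets_nu refl, of borel] by blast
      have cx: "continuous_on UNIV (\<lambda>x. f x t)" for t
        by (rule continuous_on_fix_snd[of _ UNIV]) (use cont in auto)
      show "(\<lambda>n. LINT x|\<nu>. f x (s n)) \<longlonglongrightarrow> (LINT x|\<nu>. f x t)"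
      proof (rule integral_dominated_convergence[where w = "\<lambda>_. B"])
        show "AE x in \<nu>. (\<lambda>n. f x (s n)) \<longlonglongrightarrow> f x t"
        proof (intro always_eventually allI)
          fix x
          have "continuous_on UNIV (f x)" by (rule continuous_on_fix_fst[of UNIV]) (use cont in auto)
          then show "(\<lambda>n. f x (s n)) \<longlonglongrightarrow> f x t"
            using s by (auto intro: continuous_on_tendsto_compose)
        qed
      qed (use B cx meas in auto)
    qed
  qed
  then have ct: "continuous_on {a..b} (\<lambda>t. LINT x|\<nu>. f x t)" by (rule continuous_on_subset) simp
  show "(\<lambda>t. LINT x|\<nu>. f x t) integrable_on {a..b}" by (rule integrable_continuous_real[OF ct])
  have "(LINT x|\<nu>. integral {a..b} (f x)) = (LINT x|\<nu>. LINT t|lborel. indicator {a..b} t * f x t)"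
    unfolding in1 ..
  also have "\<dots> = (LINT t|lborel. LINT x|\<nu>. indicator {a..b} t * f x t)"
    by (rule P.Fubini_integral[symmetric, OF int])
  also have "\<dots> = (LINT t|lborel. indicator {a..b} t * (LINT x|\<nu>. f x t))" by simp
  also have "\<dots> = integral {a..b} (\<lambda>t. LINT x|\<nu>. f x t)"
    using set_borel_integral_eq_integral(2)[OF borel_integrable_atLeastAtMost'[OF ct]]
    by (simp add: set_lebesgue_integral_def)
  finally show "(LINT x|\<nu>. integral {a..b} (f x)) = integral {a..b} (\<lambda>t. LINT x|\<nu>. f x t)" .
  show "integrable \<nu> (\<lambda>x. integral {a..b} (f x))"
    using P.integrable_fst'[OF int] unfolding case_prod_conv in1 .
qed

text \<open>The variance is nonnegative.\<close>

lemma square_mean_le: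
  fixes f :: "real \<Rightarrow> real"
  assumes f: "continuous_on UNIV f" and B: "\<And>x. \<bar>f x\<bar> \<le> B"
  shows "(LINT x|\<nu>. f x)\<^sup>2 \<le> (LINT x|\<nu>. (f x)\<^sup>2)"
proof -
  let ?c = "LINT x|\<nu>. f x"
  have i1: "integrable \<nu> f" by (rule integrable_continuous[of _ B]) (use assms in auto)
  have i2: "integrable \<nu> (\<lambda>x. (f x)\<^sup>2)"
  proof (rule integrable_continuous)
    show "norm ((f x)\<^sup>2) \<le> B\<^sup>2" for x using power_mono[OF B[of x], of 2] by simp
  qed (intro continuous_intros f)
  have "0 \<le> (LINT x|\<nu>. (f x - ?c)\<^sup>2)" by simp
  also have "\<dots> = (LINT x|\<nu>. (f x)\<^sup>2 - 2 * ?c * f x + ?c\<^sup>2)"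
    by (simp add: power2_diff algebra_simps)
  also have "\<dots> = (LINT x|\<nu>. (f x)\<^sup>2) - 2 * ?c * ?c + ?c\<^sup>2"
    using i1 i2 prob_space by simp
  finally show ?thesis by (simp add: power2_eq_square)
qed

lemma mean_norm_trigpoly_le:
  assumes "2 * N \<le> 2^m"
  shows "(LINT x|\<nu>. norm (trigpoly {-N..N} g x)) \<le> sqrt (K m * (\<Sum>k\<in>{-N..N}. (norm (g k))\<^sup>2))"
proof (rule real_le_rsqrt)
  have "(LINT x|\<nu>. norm (trigpoly {-N..N} g x))\<^sup>2 \<le> (LINT x|\<nu>. (norm (trigpoly {-N..N} g x))\<^sup>2)"
    by (rule square_mean_le[of _ "\<Sum>k\<in>{-N..N}. norm (g k)"]) (auto intro!: continuous_intros norm_trigpoly_le)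
  also have "\<dots> \<le> K m * (\<Sum>k\<in>{-N..N}. (norm (g k))\<^sup>2)" by (rule large_sieve[OF assms])
  finally show "(LINT x|\<nu>. norm (trigpoly {-N..N} g x))\<^sup>2 \<le> K m * (\<Sum>k\<in>{-N..N}. (norm (g k))\<^sup>2)" .
qed

text \<open>The shift \<open>s\<close> only multiplies coefficients by unimodular numbers, so the
  bound is uniform in it. Frequencies reach \<open>2^Suc n\<close> and the large sieve needs
  \<open>2^m\<close> to be twice that; hence \<open>n + 2\<close>.\<close>

lemma mean_u_diff_le:
  assumes "l \<le> n"
  shows "(LINT x|\<nu>. \<bar>u n (x + s) - u l (x + s)\<bar>) \<le> sqrt (K (n + 2) * (\<Sum>k\<in>{-(2^Suc n)..2^Suc n}. (norm (cf n k - cf l k))\<^sup>2))"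
proof -
  let ?N = "2^Suc n :: int"
  have l: "(2::int)^Suc l \<le> ?N" using assms by (intro power_increasing) auto
  let ?g = "\<lambda>k. (cf n k - cf l k) * uexp (of_int k * s)"
  have e: "\<bar>u n (x + s) - u l (x + s)\<bar> = norm (trigpoly {-?N..?N} ?g x)" for x
  proof -
    have "\<bar>u n (x + s) - u l (x + s)\<bar> = norm (complex_of_real (u n (x + s)) - of_real (u l (x + s)))"
      by (simp flip: of_real_diff)
    also have "\<dots> = norm (trigpoly {-?N..?N} ?g x)"
      unfolding u_eq_trigpoly[of n ?N, OF order_refl] u_eq_trigpoly[OF l] trigpoly_def sum_subtractf[symmetric]
      by (intro arg_cong[where f = norm] sum.cong refl) (simp add: uexp_add algebra_simps)
    finally show ?thesis .
  qed
  show ?thesis unfolding e by (rule order_trans[OF mean_norm_trigpoly_le[of ?N "n + 2"]]) (auto simp: norm_mult)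
qed

end

section \<open>The counting form along a piece of the curve\<close>

locale curve_measure = good_curve P p q c \<sigma> \<tau> dq dqu dqs + circle_measure \<nu> X C \<alpha>
  for P p q c \<sigma> \<tau> dq dqu dqs \<nu> X C \<alpha> +
  assumes X_closed: "closed X" and q_le: "q \<le> 1/4" and P_le: "\<And>t. t \<in> {p..q} \<Longrightarrow> \<bar>poly P t\<bar> \<le> 1/4"
begin

definition Wb where "Wb N a b x = integral {p..q} (\<lambda>t. trigpoly {-N..N} a (x + t) * trigpoly {-N..N} b (x + P0 t) * of_real (r t))"

lemma Wb_eq_trigpoly:
  assumes b: "\<And>k. k \<notin> {-N..N} \<Longrightarrow> b k = 0"
  shows "Wb N a b x = trigpoly {-2*N..2*N} (conv N a b) x"
proof -
  let ?S = "{-N..N}" and ?Z = "{-2*N..2*N}"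
  let ?F = "\<lambda>\<xi> \<eta>. a \<xi> * b \<eta> * m (of_int \<xi>) (of_int \<eta>) * uexp (of_int (\<xi> + \<eta>) * x)"
  have i: "(\<lambda>t. (a \<xi> * b \<eta> * uexp (of_int (\<xi> + \<eta>) * x)) * (uexp (of_int \<xi> * t + of_int \<eta> * P0 t) * of_real (r t))) integrable_on {p..q}" for \<xi> \<eta>
    by (intro integrable_continuous_real continuous_intros)
  have "Wb N a b x = integral {p..q} (\<lambda>t. \<Sum>\<xi>\<in>?S. \<Sum>\<eta>\<in>?S. (a \<xi> * b \<eta> * uexp (of_int (\<xi> + \<eta>) * x)) * (uexp (of_int \<xi> * t + of_int \<eta> * P0 t) * of_real (r t)))"
    unfolding Wb_def
  proof (rule integral_cong)
    fix t
    have "uexp (of_int \<xi> * (x + t)) * uexp (of_int \<eta> * (x + P0 t)) = uexp (of_int (\<xi> + \<eta>) * x) * uexp (of_int \<xi> * t + of_int \<eta> * P0 t)" for \<xi> \<eta> :: int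
      unfolding uexp_add[symmetric] by (rule arg_cong[of _ _ uexp]) (simp add: algebra_simps)
    then have "(a \<xi> * uexp (of_int \<xi> * (x + t))) * (b \<eta> * uexp (of_int \<eta> * (x + P0 t))) * of_real (r t)
       = (a \<xi> * b \<eta> * uexp (of_int (\<xi> + \<eta>) * x)) * (uexp (of_int \<xi> * t + of_int \<eta> * P0 t) * of_real (r t))" for \<xi> \<eta> :: int
      by (simp add: mult_ac)
    then show "trigpoly ?S a (x + t) * trigpoly ?S b (x + P0 t) * of_real (r t)
       = (\<Sum>\<xi>\<in>?S. \<Sum>\<eta>\<in>?S. (a \<xi> * b \<eta> * uexp (of_int (\<xi> + \<eta>) * x)) * (uexp (of_int \<xi> * t + of_int \<eta> * P0 t) * of_real (r t)))"
      unfolding trigpoly_def sum_product unfolding sum_distrib_right by (intro sum.cong refl)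
  qed
  also have "\<dots> = (\<Sum>\<xi>\<in>?S. \<Sum>\<eta>\<in>?S. integral {p..q} (\<lambda>t. (a \<xi> * b \<eta> * uexp (of_int (\<xi> + \<eta>) * x)) * (uexp (of_int \<xi> * t + of_int \<eta> * P0 t) * of_real (r t))))"
    by (subst integral_sum; (intro finite_atLeastAtMost_int integrable_sum i)?) (intro sum.cong refl integral_sum finite_atLeastAtMost_int i)
  also have "\<dots> = (\<Sum>\<xi>\<in>?S. \<Sum>\<eta>\<in>?S. ?F \<xi> \<eta>)"
    unfolding integral_mult_right m_def[symmetric] by (simp add: mult_ac)
  also have "\<dots> = (\<Sum>\<xi>\<in>?S. \<Sum>\<zeta>\<in>?Z. ?F \<xi> (\<zeta> - \<xi>))"
    by (intro sum.cong refl sum_shift_support(1)[symmetric, where F = "\<lambda>\<eta>. ?F _ \<eta>"]) (auto simp: b)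
  also have "\<dots> = (\<Sum>\<zeta>\<in>?Z. \<Sum>\<xi>\<in>?S. ?F \<xi> (\<zeta> - \<xi>))" by (rule sum.swap)
  also have "\<dots> = trigpoly ?Z (conv N a b) x"
    unfolding trigpoly_def conv_def sum_distrib_right by simp
  finally show ?thesis .
qed

text \<open>From \<open>L\<^sup>1\<close> to \<open>L\<^sup>2\<close> of \<open>\<nu>\<close>, then
  the large sieve. The average has frequencies up to \<open>2 * N\<close>, whence the condition on
  \<open>4 * N\<close>.\<close>

lemma mean_Wb_le:
  assumes a: "\<And>k. k \<notin> {-N..N} \<Longrightarrow> a k = 0" and b: "\<And>k. k \<notin> {-N..N} \<Longrightarrow> b k = 0"
    and M: "4 * N \<le> 2^M" and S: "(\<Sum>\<zeta>\<in>{-2*N..2*N}. (norm (conv N a b \<zeta>))\<^sup>2) \<le> S"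
  shows "integrable \<nu> (Wb N a b)" "norm (LINT x|\<nu>. Wb N a b x) \<le> sqrt (K M * S)"
proof -
  have W: "Wb N a b = trigpoly {-(2*N)..2*N} (conv N a b)" using Wb_eq_trigpoly[OF b] by auto
  show "integrable \<nu> (Wb N a b)"
    unfolding W by (rule integrable_continuous[OF _ norm_trigpoly_le]) (intro continuous_intros)
  have "norm (LINT x|\<nu>. Wb N a b x) \<le> (LINT x|\<nu>. norm (Wb N a b x))" by (rule integral_norm_bound)
  also have "\<dots> \<le> sqrt (K M * (\<Sum>\<zeta>\<in>{-(2*N)..2*N}. (norm (conv N a b \<zeta>))\<^sup>2))"
    unfolding W by (rule mean_norm_trigpoly_le) (use M in simp)
  also have "\<dots> \<le> sqrt (K M * S)" using S K_pos[of M] by (intro real_sqrt_le_mono mult_left_mono) auto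
  finally show "norm (LINT x|\<nu>. Wb N a b x) \<le> sqrt (K M * S)" .
qed

definition W where "W n x = integral {p..q} (\<lambda>t. u n (x + t) * u n (x + P0 t) * r t)"
definition Lam where "Lam n = (LINT x|\<nu>. W n x)"

lemma Lam_swap:
  "Lam n = integral {p..q} (\<lambda>t. (LINT x|\<nu>. u n (x + t) * u n (x + P0 t)) * r t)"
  "integrable \<nu> (W n)"
  "(\<lambda>t. (LINT x|\<nu>. u n (x + t) * u n (x + P0 t)) * r t) integrable_on {p..q}"
proof -
  define r1 where "r1 t = r (max p (min q t))" for t
  have r1: "r1 t = r t" if "t \<in> {p..q}" for t using that by (auto simp: r1_def)
  have r1b: "\<bar>r1 t\<bar> \<le> Mr" for t using Mr(2)[of "max p (min q t)"] pq r_nonneg by (auto simp: r1_def)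
  let ?f = "\<lambda>x t. u n (x + t) * u n (x + P0 t) * r t"
  have c: "continuous_on UNIV (\<lambda>(x,t). ?f x t)" unfolding case_prod_unfold by (intro continuous_intros)
  have B: "\<bar>?f x t\<bar> \<le> K n * K n * Mr" for x t
  proof (cases "t \<in> {p..q}")
    case True
    then show ?thesis using abs_u_le[of n] K_pos[of n] r_nonneg[of t] Mr(1) Mr(2)[OF True] unfolding abs_mult by (intro mult_mono) auto
  next
    case False
    then have "r t = 0" by (auto intro: r_zero)
    then show ?thesis using K_pos[of n] Mr(1) by simp
  qed
  show "Lam n = integral {p..q} (\<lambda>t. (LINT x|\<nu>. u n (x + t) * u n (x + P0 t)) * r t)"
    unfolding Lam_def W_def using integral_swap(1)[OF c B] by simp
  show "integrable \<nu> (W n)" unfolding W_def[abs_def] by (rule integral_swap(2)[OF c B])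
  show "(\<lambda>t. (LINT x|\<nu>. u n (x + t) * u n (x + P0 t)) * r t) integrable_on {p..q}"
    using integral_swap(3)[OF c B] by simp
qed

lemma product_integrable: "integrable \<nu> (\<lambda>x. u n (x + s) * u n (x + t))"
  by (rule integrable_continuous[of _ "K n * K n"])
    (use abs_u_le[of n] K_pos[of n] in \<open>auto intro!: continuous_intros mult_mono simp: abs_mult\<close>)

text \<open>The mean of \<open>(u l)\<^sup>2\<close> is at least 1. Inserting the shifts costs 1/8
  by the Lipschitz bound, and replacing \<open>u l\<close> by \<open>u n\<close> in both factors
  costs another 1/8 through their \<open>L\<^sup>1\<close> distance times the sup bound
  \<open>K n\<close>. The remaining 3/4 is integrated against \<open>r\<close>.\<close>

lemma Lam_lower:
  assumes l: "l \<le> n" and small: "\<And>t. t \<in> {p..q} \<Longrightarrow> Bd l * Lp l * (t + \<bar>P0 t\<bar>) \<le> 1/8"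
    and d: "2 * K n * sqrt (K (n + 2) * (\<Sum>k\<in>{-(2^Suc n)..2^Suc n}. (norm (cf n k - cf l k))\<^sup>2)) \<le> 1/8"
  shows "3/4 * r0 \<le> Lam n"
proof -
  let ?s = "sqrt (K (n + 2) * (\<Sum>k\<in>{-(2^Suc n)..2^Suc n}. (norm (cf n k - cf l k))\<^sup>2))"
  have iu: "integrable \<nu> (\<lambda>x. u l x * u l x)" using product_integrable[of l 0 0] by simp
  have main: "3/4 \<le> (LINT x|\<nu>. u n (x + t) * u n (x + P0 t))" if t: "t \<in> {p..q}" for t
  proof -
    have iu1: "integrable \<nu> (\<lambda>x. \<bar>u n (x + s) - u l (x + s)\<bar>)" for s
      by (rule integrable_continuous[of _ "K n + K l"])
        (use abs_u_le[of n] abs_u_le[of l] in \<open>auto intro!: continuous_intros order_trans[OF abs_triangle_ineq4] add_mono\<close>)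
    have Kl: "\<bar>u l y\<bar> \<le> K n" for y using abs_u_le[of l y] K_mono[OF l] by linarith
    have Bd0: "0 \<le> Bd l" using abs_u_le_Bd[of l 0] by linarith
    have "1 \<le> (LINT x|\<nu>. u l x)\<^sup>2" using mean_u_ge[of l] by simp
    also have "\<dots> \<le> (LINT x|\<nu>. (u l x)\<^sup>2)"
      by (rule square_mean_le[of _ "K l"]) (auto intro!: continuous_intros abs_u_le)
    finally have "1 \<le> (LINT x|\<nu>. u l x * u l x)" by (simp add: power2_eq_square)
    also have "\<dots> \<le> (LINT x|\<nu>. u n (x + t) * u n (x + P0 t) + (1/8 + K n * \<bar>u n (x + t) - u l (x + t)\<bar> + K n * \<bar>u n (x + P0 t) - u l (x + P0 t)\<bar>))"
    proof (rule integral_mono[OF iu])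
      show "integrable \<nu> (\<lambda>x. u n (x + t) * u n (x + P0 t) + (1/8 + K n * \<bar>u n (x + t) - u l (x + t)\<bar> + K n * \<bar>u n (x + P0 t) - u l (x + P0 t)\<bar>))"
        by (intro Bochner_Integration.integrable_add product_integrable integrable_mult_right iu1 integrable_const)
      fix x
      let ?a = "u l (x + t)" and ?b = "u l (x + P0 t)" and ?A = "u n (x + t)" and ?B = "u n (x + P0 t)" and ?c = "u l x"
      \<comment> \<open>Exchanges one factor at a time, for the shifts as well as for the
        scales.\<close>
      have e: "?c * ?c - ?A * ?B = - (?b * (?a - ?c)) - ?c * (?b - ?c) - ?B * (?A - ?a) - ?a * (?B - ?b)"
        by (simp add: algebra_simps)
      have pr: "- (y * z) \<le> B * D" if "\<bar>y\<bar> \<le> B" "\<bar>z\<bar> \<le> D" for y z B D :: real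
      proof -
        have "\<bar>y * z\<bar> \<le> B * D" unfolding abs_mult using that by (intro mult_mono) auto
        then show ?thesis by linarith
      qed
      have t0: "0 \<le> t" using t p0 by auto
      have 1: "- (?b * (?a - ?c)) \<le> Bd l * (Lp l * t)"
        by (rule pr[OF abs_u_le_Bd]) (use u_Lipschitz[of l "x + t" x] t0 in simp)
      have 2: "- (?c * (?b - ?c)) \<le> Bd l * (Lp l * \<bar>P0 t\<bar>)"
        by (rule pr[OF abs_u_le_Bd]) (use u_Lipschitz[of l "x + P0 t" x] in simp)
      have 3: "- (?B * (?A - ?a)) \<le> K n * \<bar>?A - ?a\<bar>" by (rule pr[OF abs_u_le order_refl])
      have 4: "- (?a * (?B - ?b)) \<le> K n * \<bar>?B - ?b\<bar>" by (rule pr[OF Kl order_refl])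
      have "Bd l * (Lp l * t) + Bd l * (Lp l * \<bar>P0 t\<bar>) \<le> 1/8" using small[OF t] by (simp add: algebra_simps)
      then show "?c * ?c \<le> ?A * ?B + (1/8 + K n * \<bar>?A - ?a\<bar> + K n * \<bar>?B - ?b\<bar>)"
        using 1 2 3 4 e by linarith
    qed
    also have "\<dots> = (LINT x|\<nu>. u n (x + t) * u n (x + P0 t)) + (1/8 + K n * (LINT x|\<nu>. \<bar>u n (x + t) - u l (x + t)\<bar>) + K n * (LINT x|\<nu>. \<bar>u n (x + P0 t) - u l (x + P0 t)\<bar>))"
      using iu1 product_integrable[of n t "P0 t"] prob_space by simp
    also have "\<dots> \<le> (LINT x|\<nu>. u n (x + t) * u n (x + P0 t)) + (1/8 + K n * ?s + K n * ?s)"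
      using K_pos[of n] by (intro add_mono order_refl mult_left_mono mean_u_diff_le l) auto
    finally show ?thesis using d by simp
  qed
  have "3/4 * r0 = integral {p..q} (\<lambda>t. 3/4 * r t)" by (simp add: r0_def)
  also have "\<dots> \<le> integral {p..q} (\<lambda>t. (LINT x|\<nu>. u n (x + t) * u n (x + P0 t)) * r t)"
    by (intro integral_le Lam_swap(3) integrable_continuous_real continuous_intros mult_right_mono main r_nonneg)
  finally show ?thesis by (simp add: Lam_swap(1))
qed

text \<open>Telescoping the product leaves in each term a factor \<open>u (Suc n) - u n\<close>,
  whose frequencies are at least \<open>2^n\<close>; so smoothing applies with that
  \<open>R\<close>. Of the three factors \<open>K (n + 4)\<close>, two bound the energies of the
  coefficients and one comes from the large sieve.\<close>

lemma Lam_step: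
  assumes "smoothing_const KS"
  shows "\<bar>Lam (Suc n) - Lam n\<bar> \<le> 2 * sqrt (K (n + 4) * (KS * (2^n) powr (-1/12) * K (n + 4) * K (n + 4)))"
proof -
  have KS: "0 < KS" and smooth: "\<And>N a b R. (\<And>k. k \<notin> {-N..N} \<Longrightarrow> a k = 0) \<Longrightarrow> (\<And>k. k \<notin> {-N..N} \<Longrightarrow> b k = 0) \<Longrightarrow> 1 \<le> R \<Longrightarrow>
     (\<And>\<xi> \<eta>. a \<xi> \<noteq> 0 \<Longrightarrow> b \<eta> \<noteq> 0 \<Longrightarrow> R \<le> max \<bar>of_int \<xi>\<bar> \<bar>of_int \<eta>\<bar>) \<Longrightarrow>
     (\<Sum>\<zeta>\<in>{-2*N..2*N}. (norm (conv N a b \<zeta>))\<^sup>2) \<le> KS * R powr (-1/12) * (\<Sum>k\<in>{-N..N}. (norm (a k))\<^sup>2) * (\<Sum>k\<in>{-N..N}. (norm (b k))\<^sup>2)"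
    using assms unfolding smoothing_const_def by blast+
  \<comment> \<open>The cutoff of \<open>cf (Suc n)\<close>; then \<open>4 * N = 2^(n + 4)\<close>
    explains the index in the bound.\<close>
  define N :: int where "N = 2^(n + 2)"
  define d where "d k = cf (Suc n) k - cf n k" for k
  let ?S = "{-N..N}"
  have N1: "2^Suc n \<le> N" "2^Suc (Suc n) \<le> N" by (auto simp: N_def)
  have z1: "cf n k = 0" "cf (Suc n) k = 0" if "k \<notin> ?S" for k
    using that N1 by (intro cf_zero; force simp: not_le)+
  have zd: "d k = 0" if "k \<notin> ?S" for k using z1[OF that] by (simp add: d_def)
  have dR: "2^n \<le> \<bar>real_of_int k\<bar>" if "d k \<noteq> 0" for k
  proof (rule ccontr)
    assume "\<not> 2^n \<le> \<bar>real_of_int k\<bar>"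
    then have "of_int \<bar>k\<bar> < (of_int (2^n) :: real)" by simp
    then have "\<bar>k\<bar> < 2^n" by (simp only: of_int_less_iff)
    moreover have "(2::int)^n \<le> 2^Suc n" by simp
    ultimately have "vp_coeff n k = 1" "vp_coeff (Suc n) k = 1" by (auto intro!: vp_coeff(3))
    then show False using that by (simp add: d_def cf_def)
  qed
  have norms: "(\<Sum>k\<in>?S. (norm (f k))\<^sup>2) \<le> K (n + 4)" if "\<And>k. norm (f k) \<le> norm (fc k)" for f
  proof -
    have "(\<Sum>k\<in>?S. (norm (f k))\<^sup>2) \<le> (\<Sum>k\<in>?S. (norm (fc k))\<^sup>2)" by (intro sum_mono power_mono that) auto
    also have "\<dots> \<le> K (n + 2)" unfolding N_def by (rule sum_fc_le)
    also have "\<dots> \<le> K (n + 4)" by (rule K_mono) simp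
    finally show ?thesis .
  qed
  let ?Q = "KS * (2^n) powr (-1/12) * K (n + 4) * K (n + 4)"
  have c1: "(\<Sum>\<zeta>\<in>{-2*N..2*N}. (norm (conv N a b \<zeta>))\<^sup>2) \<le> ?Q"
    if "\<And>k. k \<notin> ?S \<Longrightarrow> a k = 0" "\<And>k. k \<notin> ?S \<Longrightarrow> b k = 0" "\<And>\<xi> \<eta>. a \<xi> \<noteq> 0 \<Longrightarrow> b \<eta> \<noteq> 0 \<Longrightarrow> 2^n \<le> max \<bar>real_of_int \<xi>\<bar> \<bar>real_of_int \<eta>\<bar>"
      "\<And>k. norm (a k) \<le> norm (fc k)" "\<And>k. norm (b k) \<le> norm (fc k)" for a b
  proof -
    have "(\<Sum>\<zeta>\<in>{-2*N..2*N}. (norm (conv N a b \<zeta>))\<^sup>2) \<le> KS * (2^n) powr (-1/12) * (\<Sum>k\<in>?S. (norm (a k))\<^sup>2) * (\<Sum>k\<in>?S. (norm (b k))\<^sup>2)"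
      by (rule smooth) (use that in auto)
    also have "\<dots> \<le> ?Q"
      using KS K_pos[of "n + 4"] by (intro mult_mono mult_left_mono norms that) (auto intro: sum_nonneg)
    finally show ?thesis .
  qed
  have m4: "4 * N \<le> 2^(n + 4)" by (simp add: N_def power_add)
  have W1: "integrable \<nu> (Wb N (cf (Suc n)) d)" "norm (LINT x|\<nu>. Wb N (cf (Suc n)) d x) \<le> sqrt (K (n + 4) * ?Q)"
    by (rule mean_Wb_le[OF z1(2) zd m4 c1]; use z1 zd dR norm_cf_le norm_cf_diff_le in \<open>auto simp: d_def le_max_iff_disj\<close>)+
  have W2: "integrable \<nu> (Wb N d (cf n))" "norm (LINT x|\<nu>. Wb N d (cf n) x) \<le> sqrt (K (n + 4) * ?Q)"
    by (rule mean_Wb_le[OF zd z1(1) m4 c1]; use z1 zd dR norm_cf_le norm_cf_diff_le in \<open>auto simp: d_def le_max_iff_disj\<close>)+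
  have td: "trigpoly ?S d y = of_real (u (Suc n) y - u n y)" for y
    unfolding of_real_diff u_eq_trigpoly[OF N1(1)] u_eq_trigpoly[OF N1(2)]
    by (simp add: trigpoly_def d_def left_diff_distrib sum_subtractf)
  have diff: "complex_of_real (W (Suc n) x - W n x) = Wb N (cf (Suc n)) d x + Wb N d (cf n) x" for x
  proof -
    have c: "(\<lambda>t. u k (x + t) * u k' (x + P0 t) * r t) integrable_on {p..q}" for k k'
      by (intro integrable_continuous_real continuous_intros)
    have c': "(\<lambda>t. u (Suc n) (x + t) * (u (Suc n) (x + P0 t) - u n (x + P0 t)) * r t) integrable_on {p..q}"
      "(\<lambda>t. (u (Suc n) (x + t) - u n (x + t)) * u n (x + P0 t) * r t) integrable_on {p..q}"
      by (intro integrable_continuous_real continuous_intros)+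
    have "W (Suc n) x - W n x = integral {p..q} (\<lambda>t. u (Suc n) (x + t) * u (Suc n) (x + P0 t) * r t - u n (x + t) * u n (x + P0 t) * r t)"
      unfolding W_def by (rule integral_diff[symmetric]) (rule c)+
    also have "\<dots> = integral {p..q} (\<lambda>t. u (Suc n) (x + t) * (u (Suc n) (x + P0 t) - u n (x + P0 t)) * r t + (u (Suc n) (x + t) - u n (x + t)) * u n (x + P0 t) * r t)"
      by (rule integral_cong) (simp add: algebra_simps)
    also have "\<dots> = integral {p..q} (\<lambda>t. u (Suc n) (x + t) * (u (Suc n) (x + P0 t) - u n (x + P0 t)) * r t)
       + integral {p..q} (\<lambda>t. (u (Suc n) (x + t) - u n (x + t)) * u n (x + P0 t) * r t)"
      by (rule integral_add[OF c'])
    finally have "complex_of_real (W (Suc n) x - W n x) = of_real (integral {p..q} (\<lambda>t. u (Suc n) (x + t) * (u (Suc n) (x + P0 t) - u n (x + P0 t)) * r t))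
       + of_real (integral {p..q} (\<lambda>t. (u (Suc n) (x + t) - u n (x + t)) * u n (x + P0 t) * r t))"
      by simp
    then show ?thesis
      unfolding Wb_def td u_eq_trigpoly[OF N1(1), symmetric] u_eq_trigpoly[OF N1(2), symmetric]
        integral_interval_complex_of_real[symmetric] by simp
  qed
  have "complex_of_real (Lam (Suc n) - Lam n) = (LINT x|\<nu>. of_real (W (Suc n) x - W n x))"
    unfolding Lam_def using Lam_swap(2) by (subst integral_complex_of_real) simp
  also have "\<dots> = (LINT x|\<nu>. Wb N (cf (Suc n)) d x) + (LINT x|\<nu>. Wb N d (cf n) x)"
    unfolding diff by (rule Bochner_Integration.integral_add[OF W1(1) W2(1)])
  finally have "norm (complex_of_real (Lam (Suc n) - Lam n)) \<le> sqrt (K (n + 4) * ?Q) + sqrt (K (n + 4) * ?Q)"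
    using norm_triangle_le[OF add_mono[OF W1(2) W2(2)]] by simp
  then show ?thesis unfolding norm_of_real by simp
qed



text \<open>Three factors \<open>K (n + 4)\<close> cost
  \<open>2 powr (3 * (n + 5) * (1 - \<alpha>))\<close>. For \<open>1 - \<alpha> \<le> 1/72\<close>
  this is at most \<open>2 powr ((n + 5) / 24)\<close>, against a gain of
  \<open>2 powr (n / 12)\<close>; \<open>5/24\<close> is rounded up to 1, and the square root leaves
  \<open>2 powr (- n / 48)\<close>.\<close>

lemma Lam_step_geometric:
  assumes sm: "smoothing_const KS"
    and al: "71/72 \<le> \<alpha>"
  shows "\<bar>Lam (Suc n) - Lam n\<bar> \<le> 2 * sqrt (2 * KS * (192 * C)^3) * (2 powr (-1/48))^n"
proof -
  have KS: "0 < KS" using sm by (simp add: smoothing_const_def)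
  let ?x = "2 powr (real (n + 5) * (1 - \<alpha>))" and ?\<theta> = "(2::real) powr (-1/48)"
  have Kn: "K (n + 4) = 192 * C * ?x" by (simp add: K_def add.commute)
  have "K (n + 4) * (KS * (2^n) powr (-1/12) * K (n + 4) * K (n + 4)) = KS * (192 * C)^3 * (?x * ?x * ?x * (2^n) powr (-1/12))"
    unfolding Kn by (simp add: power3_eq_cube mult_ac)
  also have "?x * ?x * ?x * (2^n) powr (-1/12) = 2 powr (3 * (real (n + 5) * (1 - \<alpha>)) - n / 12)"
    by (simp add: powr_realpow[symmetric] powr_powr powr_add[symmetric] algebra_simps)
  also have "\<dots> \<le> 2 powr (1 - n / 24)"
  proof (rule powr_mono)
    have "real (n + 5) * (1 - \<alpha>) \<le> real (n + 5) * (1/72)" using al by (intro mult_left_mono) auto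
    then have "3 * (real (n + 5) * (1 - \<alpha>)) - n / 12 \<le> 3 * (real (n + 5) * (1/72)) - n / 12"
      by (intro diff_right_mono mult_left_mono) auto
    also have "\<dots> \<le> 1 - n / 24" by (simp add: field_simps)
    finally show "3 * (real (n + 5) * (1 - \<alpha>)) - n / 12 \<le> 1 - n / 24" .
  qed simp
  also have "2 powr (1 - n / 24) = 2 * (?\<theta>^n)\<^sup>2"
  proof -
    have "?\<theta>^n = ?\<theta> powr n" by (simp add: powr_realpow)
    then have "?\<theta>^n = 2 powr (-1/48 * n)" by (simp only: powr_powr)
    then have "2 * (?\<theta>^n)\<^sup>2 = 2 powr 1 * (2 powr (-1/48 * n) * 2 powr (-1/48 * n))"
      by (simp only: power2_eq_square powr_one zero_less_numeral zero_le_numeral)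
    also have "\<dots> = 2 powr (1 + (-1/48 * n + -1/48 * n))" by (simp only: powr_add)
    also have "1 + (-1/48 * n + -1/48 * n) = 1 - n / 24" by simp
    finally show ?thesis ..
  qed
  finally have "K (n + 4) * (KS * (2^n) powr (-1/12) * K (n + 4) * K (n + 4)) \<le> KS * (192 * C)^3 * (2 * (?\<theta>^n)\<^sup>2)"
    using KS C1 by (simp add: mult_left_mono)
  then have "sqrt (K (n + 4) * (KS * (2^n) powr (-1/12) * K (n + 4) * K (n + 4))) \<le> sqrt (2 * KS * (192 * C)^3 * (?\<theta>^n)\<^sup>2)"
    by (intro real_sqrt_le_mono) (simp add: mult_ac)
  also have "\<dots> = sqrt (2 * KS * (192 * C)^3) * ?\<theta>^n"
    unfolding real_sqrt_mult by simp
  finally have "2 * sqrt (K (n + 4) * (KS * (2^n) powr (-1/12) * K (n + 4) * K (n + 4)))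
      \<le> 2 * (sqrt (2 * KS * (192 * C)^3) * ?\<theta>^n)"
    by (rule mult_left_mono) simp
  from order_trans[OF Lam_step[OF sm] this] show ?thesis by (simp only: mult.assoc)
qed

lemma Lam_tail:
  assumes step: "\<And>n. \<bar>Lam (Suc n) - Lam n\<bar> \<le> B * \<theta>^n" and \<theta>: "0 < \<theta>" "\<theta> < 1" and B: "0 \<le> B" and nm: "n \<le> n'"
  shows "Lam n - B * \<theta>^n / (1 - \<theta>) \<le> Lam n'"
proof -
  have "Lam n - B * \<theta>^n * (1 - \<theta>^k) / (1 - \<theta>) \<le> Lam (n + k)" for k
  proof (induction k)
    case (Suc k)
    have "B * \<theta>^n * (1 - \<theta>^Suc k) / (1 - \<theta>) = B * \<theta>^n * (1 - \<theta>^k) / (1 - \<theta>) + B * \<theta>^(n + k)"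
      using \<theta> by (simp add: power_add field_simps)
    then show ?case using Suc step[of "n + k"] by simp
  qed simp
  from this[of "n' - n"] have "Lam n - B * \<theta>^n * (1 - \<theta>^(n' - n)) / (1 - \<theta>) \<le> Lam n'" using nm by simp
  moreover have "B * \<theta>^n * (1 - \<theta>^(n' - n)) / (1 - \<theta>) \<le> B * \<theta>^n * 1 / (1 - \<theta>)"
    using \<theta> B by (intro divide_right_mono mult_left_mono) auto
  ultimately show ?thesis by simp
qed

lemma exists_large_product:
  assumes "r0 / 2 \<le> Lam n"
  shows "\<exists>x\<in>X. \<exists>t\<in>{p..q}. 1/4 \<le> \<bar>u n (x + t)\<bar> * \<bar>u n (x + P0 t)\<bar>"
proof (rule ccontr)
  assume no: "\<not> ?thesis"
  have "W n x \<le> r0 / 4" if "x \<in> X" for x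
  proof -
    have "W n x \<le> integral {p..q} (\<lambda>t. 1/4 * r t)"
      unfolding W_def
    proof (intro integral_le integrable_continuous_real continuous_intros)
      fix t assume "t \<in> {p..q}"
      then have "\<bar>u n (x + t)\<bar> * \<bar>u n (x + P0 t)\<bar> < 1/4" using no that by force
      then have "u n (x + t) * u n (x + P0 t) \<le> 1/4" unfolding abs_mult[symmetric] by linarith
      then show "u n (x + t) * u n (x + P0 t) * r t \<le> 1/4 * r t" by (intro mult_right_mono r_nonneg)
    qed
    then show ?thesis by (simp add: r0_def)
  qed
  then have "AE x in \<nu>. W n x \<le> r0 / 4" using AE_X by auto
  then have "Lam n \<le> (LINT x|\<nu>. r0 / 4)" unfolding Lam_def by (intro integral_mono_AE Lam_swap(2)) auto
  then show False using assms r0_pos prob_space by simp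
qed

text \<open>Without a configuration, the larger of the distances of \<open>x + t\<close> and
  \<open>x + P0 t\<close> to \<open>X\<close> has a positive minimum \<open>d\<close> on a compact
  set. One factor of the product is then at most \<open>8 / (2^n' * d\<^sup>2)\<close> and the other
  at most \<open>K n'\<close>, which grows more slowly than \<open>2^n'\<close>; so the product
  tends to 0, against its lower bound 1/4.\<close>

lemma extraction:
  assumes lam: "\<And>n'. n \<le> n' \<Longrightarrow> r0 / 2 \<le> Lam n'" and al: "71/72 \<le> \<alpha>"
  shows "\<exists>x\<in>X. \<exists>t\<in>{p..q}. x + t \<in> X \<and> x + P0 t \<in> X"
proof (rule ccontr)
  assume no: "\<not> ?thesis"
  obtain x0 where x0: "x0 \<in> X" using exists_large_product[OF lam[of n]] by auto
  have Xne: "X \<noteq> {}" using x0 by auto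
  have cX: "compact X" using X_closed X_sub compact_Icc[of 0 "1/2::real"] by (metis closed_Int_compact inf.absorb1)
  define G where "G z = max (infdist (fst z + snd z) X) (infdist (fst z + P0 (snd z)) X)" for z
  have "continuous_on (X \<times> {p..q}) G" unfolding G_def by (intro continuous_intros)
  moreover have "compact (X \<times> {p..q})" by (intro compact_Times cX compact_Icc)
  moreover have "X \<times> {p..q} \<noteq> {}" using x0 pq by auto
  ultimately obtain z0 where z0: "z0 \<in> X \<times> {p..q}" "\<And>z. z \<in> X \<times> {p..q} \<Longrightarrow> G z0 \<le> G z"
    using continuous_attains_inf by metis
  define d where "d = G z0"
  have d: "0 < d"
  proof (rule ccontr)
    assume "\<not> 0 < d"
    then have "infdist (fst z0 + snd z0) X = 0" "infdist (fst z0 + P0 (snd z0)) X = 0"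
      using infdist_nonneg[of _ X] unfolding d_def G_def by (auto simp: max_def not_less split: if_splits intro: antisym order_trans)
    then have "fst z0 + snd z0 \<in> X" "fst z0 + P0 (snd z0) \<in> X"
      using X_closed Xne by (auto simp: in_closed_iff_infdist_zero)
    then show False using no z0(1) by auto
  qed
  have far: "d \<le> \<bar>y - x\<bar>" if "d \<le> infdist y X" "x \<in> X" for x y
    using infdist_le[OF that(2), of y] that(1) by (simp add: dist_real_def)
  have bound: "1/4 \<le> 8 / (2^n' * d\<^sup>2) * K n'" if n': "n \<le> n'" for n'
  proof -
    obtain x t where xt: "x \<in> X" "t \<in> {p..q}" "1/4 \<le> \<bar>u n' (x + t)\<bar> * \<bar>u n' (x + P0 t)\<bar>"
      using exists_large_product[OF lam[OF n']] by blast
    have xr: "0 \<le> x" "x \<le> 1/2" using xt X_sub by auto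
    have r1: "x + t \<in> {-1/4..3/4}" using xr xt(2) p0 q_le by auto
    have r2: "x + P0 t \<in> {-1/4..3/4}" using xr P_le[OF xt(2)] by (auto simp: abs_le_iff)
    have "d \<le> G (x, t)" using z0(2)[of "(x,t)"] xt by (simp add: d_def)
    then consider "d \<le> infdist (x + t) X" | "d \<le> infdist (x + P0 t) X" by (auto simp: G_def le_max_iff_disj)
    then have "\<bar>u n' (x + t)\<bar> * \<bar>u n' (x + P0 t)\<bar> \<le> 8 / (2^n' * d\<^sup>2) * K n'"
    proof cases
      case 1
      show ?thesis by (intro mult_mono abs_u_off_support[OF r1 d far[OF 1]] abs_u_le) auto
    next
      case 2
      have "\<bar>u n' (x + t)\<bar> * \<bar>u n' (x + P0 t)\<bar> \<le> K n' * (8 / (2^n' * d\<^sup>2))"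
        using K_pos[of n'] by (intro mult_mono abs_u_off_support[OF r2 d far[OF 2]] abs_u_le) auto
      then show ?thesis by (simp add: mult.commute)
    qed
    then show ?thesis using xt(3) by linarith
  qed
  have lim: "(\<lambda>n'. 8 / (2^n' * d\<^sup>2) * K n') \<longlonglongrightarrow> 0"
  proof (rule Lim_null_comparison)
    show "\<forall>\<^sub>F n' in sequentially. norm (8 / (2^n' * d\<^sup>2) * K n') \<le> 8 * 192 * C * 2 / d\<^sup>2 * (2 powr (-1/2))^n'"
    proof (intro always_eventually allI)
      fix n'
      have "real (Suc n') * (1 - \<alpha>) \<le> real (Suc n') * (1/2)" using al by (intro mult_left_mono) auto
      also have "\<dots> \<le> 1 + n' / 2" by simp
      finally have "2 powr (real (Suc n') * (1 - \<alpha>)) \<le> 2 powr (1 + n' / 2)" by (intro powr_mono) auto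
      then have "K n' \<le> 192 * C * 2 powr (1 + n' / 2)" unfolding K_def using C1 by (intro mult_left_mono) auto
      then have "8 / (2^n' * d\<^sup>2) * K n' \<le> 8 / (2^n' * d\<^sup>2) * (192 * C * 2 powr (1 + n' / 2))"
        by (intro mult_left_mono) auto
      also have "\<dots> = 8 * 192 * C / d\<^sup>2 * (2 powr (1 + n' / 2) / 2^n')" by (simp add: mult_ac)
      also have "2 powr (1 + n' / 2) / 2^n' = 2 * (2 powr (-1/2))^n'"
      proof -
        have "2 powr (1 + n' / 2) / 2^n' = 2 powr (1 + n' / 2 - n')" by (simp only: powr_diff powr_realpow[OF zero_less_numeral])
        also have "1 + n' / 2 - n' = 1 + n' * (-1/2)" by simp
        also have "2 powr (1 + n' * (-1/2)) = 2 * (2 powr (-1/2)) powr n'"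
          unfolding powr_add powr_powr by (simp add: mult.commute)
        also have "(2 powr (-1/2)) powr n' = ((2::real) powr (-1/2))^n'" by (rule powr_realpow) simp
        finally show ?thesis .
      qed
      finally show "norm (8 / (2^n' * d\<^sup>2) * K n') \<le> 8 * 192 * C * 2 / d\<^sup>2 * (2 powr (-1/2))^n'"
        using K_pos[of n'] by simp
    qed
    have "(2::real) powr (-1/2) < 2 powr 0" by (intro powr_less_mono) auto
    then have "(\<lambda>n'. ((2::real) powr (-1/2))^n') \<longlonglongrightarrow> 0" by (intro LIMSEQ_realpow_zero) auto
    from tendsto_mult_left[OF this, of "8 * 192 * C * 2 / d\<^sup>2"]
    show "(\<lambda>n'. 8 * 192 * C * 2 / d\<^sup>2 * (2 powr (-1/2))^n') \<longlonglongrightarrow> 0" by simp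
  qed
  have "\<forall>\<^sub>F n' in sequentially. 8 / (2^n' * d\<^sup>2) * K n' < 1/4"
    using order_tendstoD(2)[OF lim, of "1/4"] by simp
  then obtain N where "\<forall>n'\<ge>N. 8 / (2^n' * d\<^sup>2) * K n' < 1/4" unfolding eventually_sequentially by blast
  then have "8 / (2^(max n N) * d\<^sup>2) * K (max n N) < 1/4" by simp
  then show False using bound[of "max n N"] by simp
qed

end

section \<open>Nondegenerate pieces of the curve near the origin\<close>

text \<open>With \<open>A = Q * (1 - Q)\<close> and \<open>B = pderiv Q\<close> the polynomial is
  the Wronskian \<open>A' B - A B'\<close>, the numerator of the derivative of \<open>A / B\<close>.
  If it vanished, leading coefficients would force \<open>degree A = degree B\<close>, whereas
  \<open>2 * degree Q\<close> exceeds \<open>degree Q - 1\<close>.\<close>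

lemma wronskian_nonzero:
  fixes P :: "real poly"
  assumes "degree P > 1"
  defines "Q \<equiv> pderiv P"
  shows "pderiv Q \<noteq> 0" "(pderiv Q * pderiv Q - Q * pderiv (pderiv Q)) * (1 - Q) - Q * (pderiv Q * pderiv Q) \<noteq> 0"
proof -
  have dQ: "degree Q = degree P - 1" by (simp add: Q_def degree_pderiv)
  then have dQ1: "degree Q \<ge> 1" using assms(1) by simp
  then show B0: "pderiv Q \<noteq> 0" by (auto simp: pderiv_eq_0_iff)
  let ?A = "Q * (1 - Q)" and ?B = "pderiv Q"
  have d1: "degree (1 - Q) = degree Q"
    using degree_add_eq_right[of 1 "- Q"] dQ1 by simp
  have Q0: "Q \<noteq> 0" "1 - Q \<noteq> 0" using dQ1 d1 by auto
  have dA: "degree ?A = 2 * degree Q" using degree_mult_eq[OF Q0] d1 by simp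
  have dB: "degree ?B = degree Q - 1" by (simp add: degree_pderiv)
  have A0: "?A \<noteq> 0" using Q0 by simp
  have lc: "lead_coeff (pderiv p) = of_nat (degree p) * lead_coeff p" for p :: "real poly"
    by (cases "degree p") (auto simp: degree_pderiv coeff_pderiv coeff_eq_0)
  have "pderiv ?A * ?B \<noteq> ?A * pderiv ?B"
  proof
    assume "pderiv ?A * ?B = ?A * pderiv ?B"
    then have "lead_coeff (pderiv ?A) * lead_coeff ?B = lead_coeff ?A * lead_coeff (pderiv ?B)"
      by (metis lead_coeff_mult)
    then have "of_nat (degree ?A) * (lead_coeff ?A * lead_coeff ?B) = of_nat (degree ?B) * (lead_coeff ?A * lead_coeff ?B)"
      unfolding lc by (simp only: mult_ac)
    moreover have "lead_coeff ?A * lead_coeff ?B \<noteq> 0" using A0 B0 by simp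
    ultimately have "degree ?A = degree ?B" by simp
    then show False using dA dB dQ1 by simp
  qed
  moreover have "pderiv ?A * ?B - ?A * pderiv ?B = (pderiv Q * pderiv Q - Q * pderiv (pderiv Q)) * (1 - Q) - Q * (pderiv Q * pderiv Q)"
    by (simp add: pderiv_mult pderiv_diff pderiv_1 algebra_simps)
  ultimately show "(pderiv Q * pderiv Q - Q * pderiv (pderiv Q)) * (1 - Q) - Q * (pderiv Q * pderiv Q) \<noteq> 0"
    by (metis eq_iff_diff_eq_0)
qed

text \<open>The nondegeneracy requirements are strict inequalities between continuous functions at
  \<open>(u, s) = (0, t0)\<close>, hence persist on a small box. They hold at \<open>t0\<close>
  unless it is a root of one nonzero polynomial, and finitely many roots leave room for
  \<open>t0\<close> arbitrarily close to 0, where \<open>P\<close> is small.\<close>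

lemma good_curve_exists:
  fixes P :: "real poly" and \<epsilon> :: real
  assumes P0: "coeff P 0 = 0" and deg: "degree P > 1" and \<epsilon>: "0 < \<epsilon>"
  shows "\<exists>p q c \<sigma> \<tau> dq dqu dqs. good_curve P p q c \<sigma> \<tau> dq dqu dqs \<and> (\<forall>t\<in>{p..q}. t \<le> \<epsilon> \<and> \<bar>poly P t\<bar> \<le> \<epsilon>)"
proof -
  let ?P1 = "pderiv P" and ?P2 = "pderiv (pderiv P)" and ?P3 = "pderiv (pderiv (pderiv P))"
  obtain dq dqu dqs where dq: "\<And>u s. poly ?P1 (s + u) - poly ?P1 s = u * dq u s" "\<And>s. dq 0 s = poly ?P2 s"
    "\<And>u s. ((\<lambda>u. dq u s) has_real_derivative dqu u s) (at u)" "\<And>u s. (dq u has_real_derivative dqs u s) (at s)"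
    and cont: "continuous_on UNIV (\<lambda>(u,s). dq u s)" "continuous_on UNIV (\<lambda>(u,s). dqu u s)" "continuous_on UNIV (\<lambda>(u,s). dqs u s)"
    using poly_divided_difference[of ?P1] by blast
  have dqs0: "dqs 0 s = poly ?P3 s" for s
  proof -
    have "dq 0 = poly ?P2" using dq(2) by auto
    then show ?thesis using dq(4)[of 0 s] poly_DERIV[of ?P2 s] by (metis DERIV_unique)
  qed
  \<comment> \<open>The 1/2 yields \<open>len\<close>: two values of \<open>P\<close> of modulus at
    most 1/2 differ by at most 1.\<close>
  define e where "e = min \<epsilon> (1/2)"
  have e: "0 < e" "e \<le> \<epsilon>" "e \<le> 1/2" using \<epsilon> by (auto simp: e_def)
  have "isCont (poly P) 0" by simp
  then obtain \<delta>0 where \<delta>0: "0 < \<delta>0" "\<And>x. \<bar>x\<bar> < \<delta>0 \<Longrightarrow> \<bar>poly P x\<bar> < e"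
    using e(1) P0 unfolding continuous_at_eps_delta dist_real_def by (metis diff_zero poly_0_coeff_0)
  define \<delta> where "\<delta> = min \<delta>0 e"
  have \<delta>: "0 < \<delta>" "\<delta> \<le> e" "\<And>x. \<bar>x\<bar> < \<delta> \<Longrightarrow> \<bar>poly P x\<bar> < e" using \<delta>0 e by (auto simp: \<delta>_def)
  \<comment> \<open>A point with \<open>Z\<close> nonzero is one where \<open>P'\<close>,
    \<open>P''\<close> and the derivative of \<open>P' (1 - P') / P''\<close> are all
    nonzero.\<close>
  define Z where "Z = ?P1 * ?P2 * ((?P2 * ?P2 - ?P1 * ?P3) * (1 - ?P1) - ?P1 * (?P2 * ?P2))"
  have "?P1 \<noteq> 0" using wronskian_nonzero(1)[OF deg] by auto
  then have "Z \<noteq> 0" unfolding Z_def using wronskian_nonzero[OF deg] by simp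
  then have "finite {x. poly Z x = 0}" by (rule poly_roots_finite)
  moreover have "infinite {0<..<\<delta>}" using \<delta>(1) by simp
  ultimately have "\<not> {0<..<\<delta>} \<subseteq> {x. poly Z x = 0}" using finite_subset by blast
  then obtain t0 where "t0 \<in> {0<..<\<delta>}" "poly Z t0 \<noteq> 0" by blast
  then have t0: "0 < t0" "t0 < \<delta>" "poly Z t0 \<noteq> 0" by auto
  define F where "F z = (poly ?P2 (snd z + fst z) * dq (fst z) (snd z) - poly ?P1 (snd z + fst z) * dqs (fst z) (snd z)) / (dq (fst z) (snd z))\<^sup>2 * (1 - poly ?P1 (snd z))
              - poly ?P1 (snd z + fst z) / dq (fst z) (snd z) * poly ?P2 (snd z)" for z :: "real \<times> real"
  have nz: "poly ?P1 t0 \<noteq> 0" "poly ?P2 t0 \<noteq> 0"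
    "(poly ?P2 t0 * poly ?P2 t0 - poly ?P1 t0 * poly ?P3 t0) * (1 - poly ?P1 t0) - poly ?P1 t0 * (poly ?P2 t0 * poly ?P2 t0) \<noteq> 0"
    using t0(3) by (auto simp: Z_def)
  have F0: "F (0, t0) \<noteq> 0"
  proof -
    have "F (0, t0) = ((poly ?P2 t0 * poly ?P2 t0 - poly ?P1 t0 * poly ?P3 t0) * (1 - poly ?P1 t0) - poly ?P1 t0 * (poly ?P2 t0 * poly ?P2 t0)) / (poly ?P2 t0)\<^sup>2"
    proof -
      have "y / b\<^sup>2 * z - a / b * b = (y * z - a * (b * b)) / b\<^sup>2" if "b \<noteq> 0" for a b y z :: real
        using that by (simp add: diff_divide_distrib power2_eq_square)
      from this[OF nz(2)] show ?thesis by (simp add: F_def dq(2) dqs0)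
    qed
    then show ?thesis using nz by simp
  qed
  define \<sigma> where "\<sigma> = sgn (poly ?P1 t0)"
  define \<tau> where "\<tau> = sgn (poly ?P2 t0)"
  \<comment> \<open>Half the smallest of the three values at \<open>t0\<close>, which leaves
    continuity a margin.\<close>
  define c where "c = min (min \<bar>poly ?P1 t0\<bar> \<bar>poly ?P2 t0\<bar>) \<bar>F (0, t0)\<bar> / 2"
  have c: "0 < c" "c < \<bar>poly ?P1 t0\<bar>" "c < \<bar>poly ?P2 t0\<bar>" "c < \<bar>F (0, t0)\<bar>" using nz F0 by (auto simp: c_def min_def)
  have cdq: "isCont (\<lambda>z. dq (fst z) (snd z)) z" "isCont (\<lambda>z. dqs (fst z) (snd z)) z" for z
    using cont by (cases z; auto simp: case_prod_unfold continuous_on_eq_continuous_at)+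
  have cF: "isCont F (0, t0)"
    unfolding F_def by (intro continuous_intros cdq) (use nz in \<open>auto simp: dq(2)\<close>)
  have near: "\<exists>\<rho>>0. \<forall>z. dist z (0, t0) < \<rho> \<longrightarrow> k < G z" if "isCont G (0, t0)" "k < G (0, t0)" for G :: "real \<times> real \<Rightarrow> real" and k
  proof -
    have "0 < G (0, t0) - k" using that(2) by simp
    from continuous_at_eps_delta[THEN iffD1, OF that(1), rule_format, OF this]
    obtain \<rho> where \<rho>: "\<rho> > 0" "\<forall>z. dist z (0, t0) < \<rho> \<longrightarrow> dist (G z) (G (0, t0)) < G (0, t0) - k"
      by (elim exE conjE)
    have "k < G z" if "dist z (0, t0) < \<rho>" for z
      using \<rho>(2)[rule_format, OF that] unfolding dist_real_def by linarith
    then show ?thesis using \<rho>(1) by blast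
  qed
  have "\<exists>\<rho>>0. \<forall>z :: real \<times> real. dist z (0, t0) < \<rho> \<longrightarrow> c < \<sigma> * poly ?P1 (snd z + fst z)"
  proof (rule near)
    show "isCont (\<lambda>z :: real \<times> real. \<sigma> * poly ?P1 (snd z + fst z)) (0, t0)" by (intro continuous_intros)
    show "c < \<sigma> * poly ?P1 (snd (0, t0) + fst (0, t0))" using c(2) by (simp add: \<sigma>_def abs_sgn mult.commute)
  qed
  then obtain \<rho>1 where \<rho>1: "0 < \<rho>1" "\<And>z :: real \<times> real. dist z (0, t0) < \<rho>1 \<Longrightarrow> c < \<sigma> * poly ?P1 (snd z + fst z)" by blast
  have "\<exists>\<rho>>0. \<forall>z :: real \<times> real. dist z (0, t0) < \<rho> \<longrightarrow> c < \<tau> * poly ?P2 (snd z)"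
  proof (rule near)
    show "isCont (\<lambda>z :: real \<times> real. \<tau> * poly ?P2 (snd z)) (0, t0)" by (intro continuous_intros)
    show "c < \<tau> * poly ?P2 (snd (0, t0))" using c(3) by (simp add: \<tau>_def abs_sgn mult.commute)
  qed
  then obtain \<rho>2 where \<rho>2: "0 < \<rho>2" "\<And>z :: real \<times> real. dist z (0, t0) < \<rho>2 \<Longrightarrow> c < \<tau> * poly ?P2 (snd z)" by blast
  have "\<exists>\<rho>>0. \<forall>z :: real \<times> real. dist z (0, t0) < \<rho> \<longrightarrow> c < \<bar>F z\<bar>"
    by (rule near[of "\<lambda>z. \<bar>F z\<bar>", OF continuous_rabs[OF cF] c(4)])
  then obtain \<rho>3 where \<rho>3: "0 < \<rho>3" "\<And>z :: real \<times> real. dist z (0, t0) < \<rho>3 \<Longrightarrow> c < \<bar>F z\<bar>" by blast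
  have "\<exists>\<rho>>0. \<forall>z. dist z (0, t0) < \<rho> \<longrightarrow> 0 < \<bar>dq (fst z) (snd z)\<bar>"
    by (rule near[of "\<lambda>z. \<bar>dq (fst z) (snd z)\<bar>", OF continuous_rabs[OF cdq(1)]]) (use nz(2) in \<open>simp add: dq(2)\<close>)
  then obtain \<rho>4 where \<rho>4: "0 < \<rho>4" "\<And>z :: real \<times> real. dist z (0, t0) < \<rho>4 \<Longrightarrow> 0 < \<bar>dq (fst z) (snd z)\<bar>" by blast
  define \<rho> where "\<rho> = min (min \<rho>1 \<rho>2) (min \<rho>3 \<rho>4)"
  \<comment> \<open>\<open>\<rho> / 3\<close> keeps
    \<open>\<bar>u\<bar> + \<bar>s - t0\<bar>\<close> below \<open>\<rho>\<close>;
    \<open>t0 / 2\<close> and \<open>(\<delta> - t0) / 3\<close> keep \<open>s + u\<close> between 0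
    and \<open>\<delta>\<close>; \<open>1/2\<close> is \<open>short\<close>.\<close>
  define w where "w = min (min (\<rho> / 3) (t0 / 2)) (min ((\<delta> - t0) / 3) (1/2))"
  have w: "0 < w" "w \<le> \<rho> / 3" "w \<le> t0 / 2" "w \<le> (\<delta> - t0) / 3" "w \<le> 1/2"
  proof -
    have "0 < \<rho>" using \<rho>1(1) \<rho>2(1) \<rho>3(1) \<rho>4(1) by (simp add: \<rho>_def)
    then show "0 < w" using t0 by (simp add: w_def)
  qed (unfold w_def, linarith+)
  have near: "dist (u, s) (0, t0) < \<rho>'" if "u \<in> {-w..w}" "s \<in> {t0..t0 + w}" "\<rho> \<le> \<rho>'" for u s \<rho>'
  proof -
    have "dist (u, s) (0, t0) \<le> \<bar>u\<bar> + \<bar>s - t0\<bar>"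
      unfolding dist_Pair_Pair dist_real_def using sqrt_sum_squares_le_sum_abs[of u "s - t0"] by simp
    also have "\<dots> \<le> w + w" using that by (intro add_mono) auto
    also have "\<dots> < \<rho>'" using w that by linarith
    finally show ?thesis .
  qed
  have \<rho>: "\<rho> \<le> \<rho>1" "\<rho> \<le> \<rho>2" "\<rho> \<le> \<rho>3" "\<rho> \<le> \<rho>4" by (auto simp: \<rho>_def)
  have sml: "\<bar>poly P x\<bar> < e" if "- \<delta> < x" "x < \<delta>" for x using that by (intro \<delta>(3)) auto
  have "good_curve P t0 (t0 + w) c \<sigma> \<tau> dq dqu dqs"
  proof
    show "\<sigma> = 1 \<or> \<sigma> = -1" "\<tau> = 1 \<or> \<tau> = -1" using nz by (auto simp: \<sigma>_def \<tau>_def sgn_if)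
    fix s assume s: "s \<in> {t0..t0 + w}"
    have "\<bar>\<sigma> * (poly P (s + w) - poly P (s - w))\<bar> \<le> 1 * (\<bar>poly P (s + w)\<bar> + \<bar>poly P (s - w)\<bar>)"
      unfolding abs_mult by (intro mult_mono abs_triangle_ineq4) (auto simp: \<sigma>_def sgn_if)
    also have "\<dots> \<le> 1 * (e + e)"
    proof -
      have "- \<delta> < s + w" "s + w < \<delta>" "- \<delta> < s - w" "s - w < \<delta>" using s w t0 \<delta>(1) by auto
      from sml[OF this(1,2)] sml[OF this(3,4)] show ?thesis by simp
    qed
    finally show "\<sigma> * (poly P (s + (t0 + w - t0)) - poly P (s - (t0 + w - t0))) \<le> 1" using e(3) by simp
    show "c \<le> \<tau> * poly ?P2 s" using \<rho>2(2)[OF near[OF _ s \<rho>(2)], of 0] w by simp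
    fix u assume "u \<in> {- (t0 + w - t0)..t0 + w - t0}"
    then have u: "u \<in> {-w..w}" by simp
    show "c \<le> \<sigma> * poly ?P1 (s + u)" using \<rho>1(2)[OF near[OF u s \<rho>(1)]] by simp
    show "dq u s \<noteq> 0" using \<rho>4(2)[OF near[OF u s \<rho>(4)]] by simp
    show "c \<le> \<bar>(poly ?P2 (s + u) * dq u s - poly ?P1 (s + u) * dqs u s) / (dq u s)\<^sup>2 * (1 - poly ?P1 s)
              - poly ?P1 (s + u) / dq u s * poly ?P2 s\<bar>"
      using \<rho>3(2)[OF near[OF u s \<rho>(3)]] by (simp add: F_def)
  qed (use t0 w c dq cont in auto)
  moreover have "t \<le> \<epsilon> \<and> \<bar>poly P t\<bar> \<le> \<epsilon>" if t: "t \<in> {t0..t0 + w}" for t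
  proof -
    have "t < \<delta>" using t w t0 by auto
    moreover have "- \<delta> < t" using t t0 \<delta>(1) by auto
    ultimately show ?thesis using sml[of t] \<delta>(2) e(2) by auto
  qed
  ultimately show ?thesis by blast
qed

section \<open>Choice of the scales\<close>

text \<open>\<open>l\<close> fixes how close to 0 the piece of curve must lie, the piece fixes
  \<open>KS\<close> and \<open>r0\<close>, and these fix how large \<open>n\<close> must be; the
  measure and its exponent come afterwards.\<close>

lemma scale_step:
  fixes P :: "real poly" and C :: real
  assumes P: "coeff P 0 = 0" "degree P > 1" and C: "1 \<le> C"
  shows "\<exists>n>l. \<forall>\<nu> X \<alpha>. circle_measure \<nu> X C \<alpha> \<longrightarrow> closed X \<longrightarrow> 71/72 \<le> \<alpha> \<longrightarrow> 2 powr (real (n + 3) * (1 - \<alpha>)) \<le> 2 \<longrightarrow>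
    (\<Sum>k\<in>{-(2^Suc n)..2^Suc n}. (norm (circle_measure.cf \<nu> n k - circle_measure.cf \<nu> l k))\<^sup>2) \<le> 1 / (256 * (384 * C)^3) \<longrightarrow>
    (\<exists>x\<in>X. \<exists>t>0. x + t \<in> X \<and> x + poly P t \<in> X)"
proof -
  define b where "b = circle_measure.Bd l * circle_measure.Lp l"
  \<comment> \<open>\<open>2 * \<epsilon> * \<bar>b\<bar> \<le> 1/8\<close> is what
    \<open>Lam_lower\<close> asks of the Lipschitz error, and 1/4 is the room for shifts in
    \<open>curve_measure\<close>. The \<open>+ 1\<close> covers \<open>b = 0\<close>.\<close>
  define \<epsilon> where "\<epsilon> = min (1/4) (1 / (16 * (\<bar>b\<bar> + 1)))"
  have \<epsilon>: "0 < \<epsilon>" "\<epsilon> \<le> 1/4" "\<epsilon> \<le> 1 / (16 * (\<bar>b\<bar> + 1))" by (auto simp: \<epsilon>_def)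
  obtain p q c \<sigma> \<tau> dq dqu dqs where gc: "good_curve P p q c \<sigma> \<tau> dq dqu dqs"
    and small: "\<And>t. t \<in> {p..q} \<Longrightarrow> t \<le> \<epsilon>" "\<And>t. t \<in> {p..q} \<Longrightarrow> \<bar>poly P t\<bar> \<le> \<epsilon>"
    using good_curve_exists[OF P \<epsilon>(1)] by blast
  interpret G: good_curve P p q c \<sigma> \<tau> dq dqu dqs by (rule gc)
  obtain KS where KS: "G.smoothing_const KS" using G.smoothing by blast
  then have KS0: "0 < KS" by (simp add: G.smoothing_const_def)
  define \<theta> :: real where "\<theta> = 2 powr (-1/48)"
  have "(2::real) powr (-1/48) < 2 powr 0" by (intro powr_less_mono) auto
  then have \<theta>: "0 < \<theta>" "\<theta> < 1" by (auto simp: \<theta>_def)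
  define B where "B = 2 * sqrt (2 * KS * (192 * C)^3)"
  have B: "0 \<le> B" using KS0 C by (simp add: B_def)
  have "(\<lambda>n. \<theta>^n) \<longlonglongrightarrow> 0" using \<theta> by (intro LIMSEQ_realpow_zero) auto
  from tendsto_mult_left[OF this, of "B / (1 - \<theta>)"]
  have "(\<lambda>n. B / (1 - \<theta>) * \<theta>^n) \<longlonglongrightarrow> 0" by simp
  from order_tendstoD(2)[OF this, of "G.r0 / 4"] G.r0_pos
  obtain N where N: "\<And>n. N \<le> n \<Longrightarrow> B / (1 - \<theta>) * \<theta>^n < G.r0 / 4"
    unfolding eventually_sequentially by auto
  \<comment> \<open>From \<open>N\<close> on the geometric tail is below \<open>r0 / 4\<close>, so
    that \<open>Lam\<close> keeps \<open>r0 / 2\<close> of its initial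
    \<open>3/4 * r0\<close>.\<close>
  define n where "n = max N (Suc l)"
  show ?thesis
  proof (intro exI[of _ n] conjI allI impI)
    show "l < n" by (simp add: n_def)
    fix \<nu> :: "real measure" and X :: "real set" and \<alpha> :: real
    assume cm: "circle_measure \<nu> X C \<alpha>" and X: "closed X" and al: "71/72 \<le> \<alpha>" and n3: "2 powr (real (n + 3) * (1 - \<alpha>)) \<le> 2"
      and d: "(\<Sum>k\<in>{-(2^Suc n)..2^Suc n}. (norm (circle_measure.cf \<nu> n k - circle_measure.cf \<nu> l k))\<^sup>2) \<le> 1 / (256 * (384 * C)^3)"
    interpret C: circle_measure \<nu> X C \<alpha> by (rule cm)
    interpret curve_measure P p q c \<sigma> \<tau> dq dqu dqs \<nu> X C \<alpha>
    proof
      show "closed X" by (rule X)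
      show "q \<le> 1/4" using small(1)[of q] G.pq \<epsilon>(2) by auto
      show "\<bar>poly P t\<bar> \<le> 1/4" if "t \<in> {p..q}" for t using small(2)[OF that] \<epsilon>(2) by auto
    qed
    \<comment> \<open>\<open>384 = 2 * 192\<close>, since the power of 2 in \<open>K (n + 2)\<close>
      is at most 2. The energy threshold is the one with
      \<open>2 * ?K0 * sqrt (?K0 * (1 / (256 * ?K0^3))) = 1/8\<close>.\<close>
    let ?K0 = "384 * C"
    have K2: "C.K (n + 2) \<le> ?K0" using n3 C unfolding C.K_def by (simp add: add.commute)
    have K1: "C.K n \<le> ?K0" using C.K_mono[of n "n + 2"] K2 by simp
    have low: "3/4 * G.r0 \<le> Lam n"
    proof (rule Lam_lower)
      show "l \<le> n" by (simp add: n_def)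
      show "C.Bd l * C.Lp l * (t + \<bar>poly P t\<bar>) \<le> 1/8" if t: "t \<in> {p..q}" for t
      proof -
        have t0: "0 \<le> t" using t G.p0 by auto
        have "b * (t + \<bar>poly P t\<bar>) \<le> \<bar>b\<bar> * (\<epsilon> + \<epsilon>)"
          using small[OF t] t0 by (intro mult_mono add_mono) auto
        also have "\<dots> \<le> (\<bar>b\<bar> + 1) * (2 * (1 / (16 * (\<bar>b\<bar> + 1))))"
          using \<epsilon> by (intro mult_mono) auto
        also have "\<dots> = 1/8" by (simp add: field_simps)
        finally show ?thesis by (simp add: b_def)
      qed
      show "2 * C.K n * sqrt (C.K (n + 2) * (\<Sum>k\<in>{-(2^Suc n)..2^Suc n}. (norm (C.cf n k - C.cf l k))\<^sup>2)) \<le> 1/8"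
      proof -
        have "C.K (n + 2) * (\<Sum>k\<in>{-(2^Suc n)..2^Suc n}. (norm (C.cf n k - C.cf l k))\<^sup>2) \<le> ?K0 * (1 / (256 * ?K0^3))"
          using K2 C d by (intro mult_mono) (auto intro: sum_nonneg)
        also have "\<dots> = (1 / (16 * ?K0))\<^sup>2" using C by (simp add: power2_eq_square power3_eq_cube)
        finally have "sqrt (C.K (n + 2) * (\<Sum>k\<in>{-(2^Suc n)..2^Suc n}. (norm (C.cf n k - C.cf l k))\<^sup>2)) \<le> 1 / (16 * ?K0)"
          using C by (intro real_le_lsqrt) auto
        then have "2 * C.K n * sqrt (C.K (n + 2) * (\<Sum>k\<in>{-(2^Suc n)..2^Suc n}. (norm (C.cf n k - C.cf l k))\<^sup>2)) \<le> 2 * ?K0 * (1 / (16 * ?K0))"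
          using K1 C.K_pos[of n] C.K_pos[of "n+2"] C by (intro mult_mono) (auto intro!: mult_nonneg_nonneg sum_nonneg)
        then show ?thesis using C by simp
      qed
    qed
    have "G.r0 / 2 \<le> Lam n'" if "n \<le> n'" for n'
    proof -
      have "Lam n - B * \<theta>^n / (1 - \<theta>) \<le> Lam n'"
        by (rule Lam_tail[OF _ \<theta> B that]) (use Lam_step_geometric[OF KS al] in \<open>simp add: B_def \<theta>_def\<close>)
      moreover have "B * \<theta>^n / (1 - \<theta>) < G.r0 / 4" using N[of n] by (simp add: n_def)
      ultimately show ?thesis using low by linarith
    qed
    from extraction[OF this al] obtain x t where "x \<in> X" "t \<in> {p..q}" "x + t \<in> X" "x + poly P t \<in> X" by blast
    moreover from this have "0 < t" using G.p0 by simp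
    ultimately show "\<exists>x\<in>X. \<exists>t>0. x + t \<in> X \<and> x + poly P t \<in> X" by blast
  qed
qed

text \<open>The blocks of frequencies between \<open>2^l\<close> and \<open>2^n\<close> produced by \<open>scale_step\<close> are disjoint, so one of
  them carries little energy.\<close>

lemma circle_configuration:
  fixes P :: "real poly" and C :: real
  assumes P: "coeff P 0 = 0" "degree P > 1" and C: "1 \<le> C"
  shows "\<exists>\<alpha>\<^sub>0. 0 < \<alpha>\<^sub>0 \<and> \<alpha>\<^sub>0 < 1 \<and> (\<forall>\<nu> X \<alpha>. circle_measure \<nu> X C \<alpha> \<longrightarrow> closed X \<longrightarrow> \<alpha>\<^sub>0 < \<alpha> \<longrightarrow>
    (\<exists>x\<in>X. \<exists>t>0. x + t \<in> X \<and> x + poly P t \<in> X))"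
proof -
  define \<eta> where "\<eta> = 1 / (256 * (384 * C)^3)"
  have \<eta>: "0 < \<eta>" using C by (simp add: \<eta>_def)
  define good where "good l n \<longleftrightarrow> (\<forall>\<nu> X \<alpha>. circle_measure \<nu> X C \<alpha> \<longrightarrow> closed X \<longrightarrow> 71/72 \<le> \<alpha> \<longrightarrow> 2 powr (real (n + 3) * (1 - \<alpha>)) \<le> 2 \<longrightarrow>
    (\<Sum>k\<in>{-(2^Suc n)..2^Suc n}. (norm (circle_measure.cf \<nu> n k - circle_measure.cf \<nu> l k))\<^sup>2) \<le> \<eta> \<longrightarrow>
    (\<exists>x\<in>X. \<exists>t>0. x + t \<in> X \<and> x + poly P t \<in> X))" for l n
  have "\<exists>n>l. good l n" for l
    unfolding good_def \<eta>_def by (rule scale_step[OF P C])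
  then obtain f where f: "\<And>l. l < f l" "\<And>l. good l (f l)" by metis
  \<comment> \<open>The \<open>Suc\<close> separates the blocks: \<open>cf (f l)\<close> lives below
    \<open>2^Suc (f l)\<close>, and the differences starting at the next scale vanish up to that
    frequency.\<close>
  define L where "L j = ((\<lambda>l. Suc (f l)) ^^ j) 0" for j
  have L: "L (Suc j) = Suc (f (L j))" for j by (simp add: L_def)
  have Lmono: "L i \<le> L j" if "i \<le> j" for i j
  proof -
    have "L n \<le> L (Suc n)" for n using f(1)[of "L n"] by (simp add: L)
    then show ?thesis by (rule lift_Suc_mono_le) (rule that)
  qed
  \<comment> \<open>Pigeonhole: \<open>J\<close> disjoint blocks of energy above
    \<open>\<eta>\<close> would exceed the total \<open>K (L J) \<le> 384 * C\<close>.\<close>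
  define J where "J = nat \<lceil>384 * C / \<eta>\<rceil> + 1"
  have J: "384 * C < real J * \<eta>"
  proof -
    have "384 * C / \<eta> < real J" unfolding J_def by linarith
    then show ?thesis using \<eta> by (simp add: field_simps)
  qed
  \<comment> \<open>The second entry gives \<open>2 powr (i * (1 - \<alpha>)) \<le> 2\<close> at
    every scale in use; the chain up to \<open>L J\<close> is fixed by now, so this depends on
    \<open>P\<close> and \<open>C\<close> only.\<close>
  define \<alpha>\<^sub>0 where "\<alpha>\<^sub>0 = max (71/72) (1 - 1 / real (L J + 3))"
  show ?thesis
  proof (intro exI[of _ \<alpha>\<^sub>0] conjI allI impI)
    show "0 < \<alpha>\<^sub>0" "\<alpha>\<^sub>0 < 1" by (auto simp: \<alpha>\<^sub>0_def)
    fix \<nu> :: "real measure" and X :: "real set" and \<alpha> :: real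
    assume cm: "circle_measure \<nu> X C \<alpha>" and X: "closed X" and al0: "\<alpha>\<^sub>0 < \<alpha>"
    interpret circle_measure \<nu> X C \<alpha> by (rule cm)
    have al: "71/72 \<le> \<alpha>" using al0 by (simp add: \<alpha>\<^sub>0_def)
    have "1 - \<alpha> \<le> 1 / real (L J + 3)" using al0 by (simp add: \<alpha>\<^sub>0_def)
    then have "real (L J + 3) * (1 - \<alpha>) \<le> real (L J + 3) * (1 / real (L J + 3))" by (rule mult_left_mono) simp
    then have LJ: "real (L J + 3) * (1 - \<alpha>) \<le> 1" by simp
    have pw: "2 powr (real i * (1 - \<alpha>)) \<le> 2" if "i \<le> L J + 3" for i
    proof -
      have "real i * (1 - \<alpha>) \<le> real (L J + 3) * (1 - \<alpha>)" using that \<alpha> by (intro mult_right_mono) auto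
      then have "2 powr (real i * (1 - \<alpha>)) \<le> 2 powr 1" using LJ by (intro powr_mono) auto
      then show ?thesis by simp
    qed
    let ?d = "\<lambda>j k. (norm (cf (f (L j)) k - cf (L j) k))\<^sup>2"
    have "\<exists>j<J. (\<Sum>k\<in>{-(2^Suc (f (L j)))..2^Suc (f (L j))}. ?d j k) \<le> \<eta>"
    proof (rule ccontr)
      assume no: "\<not> ?thesis"
      have KJ: "K (L J) \<le> 384 * C" using pw[of "Suc (L J)"] C by (simp add: K_def)
      \<comment> \<open>Each frequency belongs to at most one block: those before \<open>i\<close>
        live below \<open>2^L i\<close>, and block \<open>i\<close> between \<open>2^L i\<close> and
        \<open>2^L (Suc i)\<close>.\<close>
      have one: "(\<Sum>j<i. ?d j k) \<le> (if \<bar>k\<bar> < 2^L i then (norm (fc k))\<^sup>2 else 0)" for i k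
      proof (induction i)
        case (Suc i)
        consider "2^L (Suc i) \<le> \<bar>k\<bar>" | "\<bar>k\<bar> < 2^L i" | "2^L i \<le> \<bar>k\<bar>" "\<bar>k\<bar> < 2^L (Suc i)" by linarith
        then show ?case
        proof cases
          case 1
          have "(2::int)^L i \<le> 2^L (Suc i)" by (intro power_increasing Lmono) auto
          then have "2^L i \<le> \<bar>k\<bar>" using 1 by linarith
          moreover have "(2::int)^Suc (L i) \<le> 2^Suc (f (L i))" using f(1)[of "L i"] by (intro power_increasing) auto
          then have "2^Suc (f (L i)) \<le> \<bar>k\<bar>" "2^Suc (L i) \<le> \<bar>k\<bar>" using 1 unfolding L by linarith+
          then have "cf (f (L i)) k = 0" "cf (L i) k = 0" by (auto intro!: cf_zero)
          ultimately show ?thesis using Suc 1 by (simp del: power_Suc)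
        next
          case 2
          have "(2::int)^L i \<le> 2^f (L i)" using f(1)[of "L i"] by (intro power_increasing) auto
          then have "\<bar>k\<bar> \<le> 2^L i" "\<bar>k\<bar> \<le> 2^f (L i)" using 2 by linarith+
          then have "vp_coeff (L i) k = 1" "vp_coeff (f (L i)) k = 1" by (simp_all only: vp_coeff(3))
          then have "cf (f (L i)) k = cf (L i) k" by (simp add: cf_def)
          moreover have "(2::int)^L i \<le> 2^L (Suc i)" by (intro power_increasing Lmono) auto
          then have "\<bar>k\<bar> < 2^L (Suc i)" using 2 by linarith
          ultimately show ?thesis using Suc 2 by simp
        next
          case 3
          have d: "?d i k \<le> (norm (fc k))\<^sup>2" by (intro power_mono norm_cf_diff_le) simp
          have "(\<Sum>j<i. ?d j k) \<le> 0" using Suc 3(1) by simp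
          from add_mono[OF this d] show ?thesis using 3(2) by simp
        qed
      qed simp
      have "real J * \<eta> = (\<Sum>j<J. \<eta>)" by simp
      also have "\<dots> \<le> (\<Sum>j<J. \<Sum>k\<in>{-(2^L J)..2^L J}. ?d j k)"
      proof (rule sum_mono)
        fix j assume j: "j \<in> {..<J}"
        then have "L (Suc j) \<le> L J" by (intro Lmono) auto
        then have le: "(2::int)^Suc (f (L j)) \<le> 2^L J" unfolding L by (intro power_increasing) auto
        have "\<eta> \<le> (\<Sum>k\<in>{-(2^Suc (f (L j)))..2^Suc (f (L j))}. ?d j k)" using no j by force
        also have "\<dots> \<le> (\<Sum>k\<in>{-(2^L J)..2^L J}. ?d j k)" using le by (intro sum_mono2) auto
        finally show "\<eta> \<le> (\<Sum>k\<in>{-(2^L J)..2^L J}. ?d j k)" .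
      qed
      also have "\<dots> = (\<Sum>k\<in>{-(2^L J)..2^L J}. \<Sum>j<J. ?d j k)" by (rule sum.swap)
      also have "\<dots> \<le> (\<Sum>k\<in>{-(2^L J)..2^L J}. (norm (fc k))\<^sup>2)"
        by (intro sum_mono order_trans[OF one]) auto
      also have "\<dots> \<le> K (L J)" by (rule sum_fc_le)
      finally show False using KJ J by linarith
    qed
    then obtain j where j: "j < J" "(\<Sum>k\<in>{-(2^Suc (f (L j)))..2^Suc (f (L j))}. ?d j k) \<le> \<eta>" by blast
    have "L (Suc j) \<le> L J" using j by (intro Lmono) auto
    then have "f (L j) + 3 \<le> L J + 3" by (simp add: L)
    from f(2)[of "L j", unfolded good_def, rule_format, OF cm X al pw[OF this] j(2)]
    show "\<exists>x\<in>X. \<exists>t>0. x + t \<in> X \<and> x + poly P t \<in> X" .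
  qed
qed

section \<open>Passage from the unit interval to the circle\<close>

text \<open>Second countability: every point off the support lies in a null set of a countable
  basis, and the union of these null sets is null.\<close>

lemma supports_AE:
  assumes "supports E \<mu>" "closed E"
  shows "AE x in \<mu>. x \<in> E"
proof -
  have s: "sets \<mu> = sets borel" and sub: "measure_support \<mu> \<subseteq> E" using assms by (auto simp: supports_def)
  obtain B :: "real set set" where B: "countable B" "topological_basis B" using ex_countable_basis by blast
  let ?N = "{U \<in> B. emeasure \<mu> U = 0}"
  have op: "open U" if "U \<in> B" for U using B(2) that by (rule topological_basis_open)
  have "(\<Union>U\<in>?N. U) \<in> null_sets \<mu>"
    by (rule null_sets_UN') (use B(1) op s in \<open>auto intro: countable_subset\<close>)
  moreover have "{x \<in> space \<mu>. x \<notin> E} \<subseteq> (\<Union>U\<in>?N. U)"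
  proof
    fix x assume "x \<in> {x \<in> space \<mu>. x \<notin> E}"
    then have "x \<notin> measure_support \<mu>" using sub by auto
    then obtain U where U: "open U" "x \<in> U" "\<not> 0 < emeasure \<mu> U" unfolding measure_support_def by blast
    then obtain V where V: "V \<in> B" "x \<in> V" "V \<subseteq> U" using topological_basisE[OF B(2) U(1,2)] by blast
    have "emeasure \<mu> V \<le> emeasure \<mu> U" using U(1) s by (intro emeasure_mono V) auto
    then have "emeasure \<mu> V = 0" using U(3) by (simp add: not_less)
    then show "x \<in> (\<Union>U\<in>?N. U)" using V by auto
  qed
  ultimately show ?thesis by (rule AE_I')
qed

text \<open>Halving maps \<open>[0,1]\<close> into half of the circle \<open>\<real>/\<int>\<close>, where short progressions cannot wrap around.\<close>

lemma circle_measure_halving: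
  assumes E: "closed E" "E \<subseteq> {0..1}" "supports E \<mu>" and \<alpha>: "0 < \<alpha>" "\<alpha> < 1"
    and ball: "\<And>x \<epsilon>. 0 < \<epsilon> \<Longrightarrow> \<epsilon> \<le> 1 \<Longrightarrow> measure \<mu> {x..x + \<epsilon>} \<le> C\<^sub>1 * \<epsilon> powr \<alpha>" and C1: "0 < C\<^sub>1"
  shows "circle_measure (distr \<mu> borel (\<lambda>x. x / 2)) ((\<lambda>x. x / 2) ` E) (max 2 (2 * C\<^sub>1)) \<alpha>"
proof -
  have s: "sets \<mu> = sets borel" and "prob_space \<mu>" using E by (auto simp: supports_def)
  interpret M: prob_space \<mu> by fact
  have m: "(\<lambda>x. x / 2) \<in> measurable \<mu> borel"
  proof -
    have "(\<lambda>x::real. x / 2) \<in> measurable borel borel" by measurable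
    then show ?thesis unfolding measurable_cong_sets[OF s refl] .
  qed
  interpret N: prob_space "distr \<mu> borel (\<lambda>x. x / 2)" by (rule M.prob_space_distr[OF m])
  show ?thesis
  proof
    show "sets (distr \<mu> borel (\<lambda>x. x / 2)) = sets borel" by simp
    show "(\<lambda>x. x / 2) ` E \<subseteq> {0..1/2}" using E by auto
    have cl: "closed ((\<lambda>x. x / 2) ` E)"
      using closed_scaling[OF E(1), of "1/2"] by simp
    show "AE x in distr \<mu> borel (\<lambda>x. x / 2). x \<in> (\<lambda>x. x / 2) ` E"
      using supports_AE[OF E(3,1)] cl by (subst AE_distr_iff[OF m]) auto
    show "1 \<le> max 2 (2 * C\<^sub>1)" by simp
    fix x \<epsilon> :: real assume \<epsilon>: "0 < \<epsilon>" "\<epsilon> \<le> 1"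
    have sp: "space \<mu> = UNIV" using sets_eq_imp_space_eq[OF s] by simp
    have pre: "(\<lambda>x. x / 2) -` {x..x + \<epsilon>} \<inter> space \<mu> = {2 * x..2 * x + 2 * \<epsilon>}" by (auto simp: sp)
    have e: "measure (distr \<mu> borel (\<lambda>x. x / 2)) {x..x + \<epsilon>} = measure \<mu> {2 * x..2 * x + 2 * \<epsilon>}"
      by (subst measure_distr[OF m]) (auto simp: pre)
    show "measure (distr \<mu> borel (\<lambda>x. x / 2)) {x..x + \<epsilon>} \<le> max 2 (2 * C\<^sub>1) * \<epsilon> powr \<alpha>"
    proof (cases "2 * \<epsilon> \<le> 1")
      case True
      have "measure \<mu> {2 * x..2 * x + 2 * \<epsilon>} \<le> C\<^sub>1 * (2 * \<epsilon>) powr \<alpha>" using \<epsilon> True by (intro ball) auto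
      also have "(2 * \<epsilon>) powr \<alpha> = 2 powr \<alpha> * \<epsilon> powr \<alpha>" by (rule powr_mult)
      also have "\<dots> \<le> 2 powr 1 * \<epsilon> powr \<alpha>" using \<alpha> by (intro mult_right_mono powr_mono) auto
      finally have "measure \<mu> {2 * x..2 * x + 2 * \<epsilon>} \<le> 2 * C\<^sub>1 * \<epsilon> powr \<alpha>" using C1 by simp
      also have "\<dots> \<le> max 2 (2 * C\<^sub>1) * \<epsilon> powr \<alpha>" by (intro mult_right_mono) auto
      finally show ?thesis unfolding e .
    next
      case False
      \<comment> \<open>For \<open>\<epsilon> > 1/2\<close> the doubled length is outside the range
        of \<open>ball\<close>; here \<open>\<epsilon> powr \<alpha> \<ge> \<epsilon> > 1/2\<close>,
        so the entry 2 of the maximum reduces the claim to the trivial bound 1.\<close>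
      have "\<epsilon> powr 1 \<le> \<epsilon> powr \<alpha>" using \<epsilon> \<alpha> by (intro powr_mono') auto
      then have "1/2 \<le> \<epsilon> powr \<alpha>" using False \<epsilon> by simp
      then have "2 * (1/2) \<le> max 2 (2 * C\<^sub>1) * \<epsilon> powr \<alpha>" by (intro mult_mono) auto
      then have "1 \<le> max 2 (2 * C\<^sub>1) * \<epsilon> powr \<alpha>" by simp
      then show ?thesis unfolding e by (rule order_trans[OF M.prob_le_1])
    qed
  qed (use \<alpha> in auto)
qed

theorem theorem1p1:
  fixes P :: "real poly"
  assumes "coeff P 0 = 0" and "degree P > 1"
  shows "\<exists>s\<^sub>0::real. s\<^sub>0 > 0 \<and>
    (\<forall>\<beta> C\<^sub>1 C\<^sub>2 B :: real.
       1 - s\<^sub>0 < \<beta> \<longrightarrow> \<beta> < 1 \<longrightarrow> C\<^sub>1 > 0 \<longrightarrow> C\<^sub>2 > 0 \<longrightarrow> B > 0 \<longrightarrow>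
       (\<exists>\<alpha>\<^sub>0::real. 0 < \<alpha>\<^sub>0 \<and> \<alpha>\<^sub>0 < 1 \<and>
          (\<forall>(\<alpha>::real) (E::real set) (\<mu>::real measure).
             \<alpha>\<^sub>0 < \<alpha> \<longrightarrow> \<alpha> < 1 \<longrightarrow>
             closed E \<longrightarrow> E \<subseteq> {0..1} \<longrightarrow> supports E \<mu> \<longrightarrow>
             (\<forall>x \<epsilon> :: real. 0 < \<epsilon> \<longrightarrow> \<epsilon> \<le> 1 \<longrightarrow>
                measure \<mu> {x..x + \<epsilon>} \<le> C\<^sub>1 * \<epsilon> powr \<alpha>) \<longrightarrow>
             (\<forall>k::int. k \<noteq> 0 \<longrightarrow>
                cmod (fourier_coeff \<mu> k)
                  \<le> C\<^sub>2 * (1 - \<alpha>) powr (- B) * \<bar>of_int k\<bar> powr (- \<beta> / 2)) \<longrightarrow>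
             (\<exists>x t :: real. t > 0 \<and> x \<in> E \<and> x + t \<in> E \<and> x + poly P t \<in> E))))"
proof (rule exI[of _ 1], intro conjI allI impI)
  fix \<beta> C\<^sub>1 C\<^sub>2 B :: real
  assume C1: "C\<^sub>1 > 0"
  \<comment> \<open>\<open>P\<close> conjugated by the halving map: a triple for \<open>H\<close> in
    the halved set doubles to one for \<open>P\<close> in \<open>E\<close>, with gap
    \<open>2 * t\<close>.\<close>
  define H where "H = smult (1/2) (pcompose P [:0, 2:])"
  have H: "poly H t = poly P (2 * t) / 2" for t by (simp add: H_def poly_pcompose mult.commute)
  have "coeff H 0 = 0" using H[of 0] assms(1) by (simp add: poly_0_coeff_0)
  moreover have "degree H > 1" using assms(2) by (simp add: H_def degree_pcompose)
  ultimately obtain \<alpha>\<^sub>0 where \<alpha>\<^sub>0: "0 < \<alpha>\<^sub>0" "\<alpha>\<^sub>0 < 1"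
    "\<And>\<nu> X \<alpha>. circle_measure \<nu> X (max 2 (2 * C\<^sub>1)) \<alpha> \<Longrightarrow> closed X \<Longrightarrow> \<alpha>\<^sub>0 < \<alpha> \<Longrightarrow> \<exists>x\<in>X. \<exists>t>0. x + t \<in> X \<and> x + poly H t \<in> X"
    using circle_configuration[of H "max 2 (2 * C\<^sub>1)", OF _ _ order_trans[OF one_le_numeral max.cobounded1]] by blast
  have triple: "\<exists>x t. t > 0 \<and> x \<in> E \<and> x + t \<in> E \<and> x + poly P t \<in> E"
    if "\<alpha>\<^sub>0 < \<alpha>" "\<alpha> < 1" "closed E" "E \<subseteq> {0..1}" "supports E \<mu>"
      and ball: "\<forall>x \<epsilon>. 0 < \<epsilon> \<longrightarrow> \<epsilon> \<le> 1 \<longrightarrow> measure \<mu> {x..x + \<epsilon>} \<le> C\<^sub>1 * \<epsilon> powr \<alpha>" for \<alpha> E \<mu>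
  proof -
    have cm: "circle_measure (distr \<mu> borel (\<lambda>x. x / 2)) ((\<lambda>x. x / 2) ` E) (max 2 (2 * C\<^sub>1)) \<alpha>"
      by (rule circle_measure_halving) (use that \<alpha>\<^sub>0 C1 in auto)
    have cl: "closed ((\<lambda>x. x / 2) ` E)" using closed_scaling[OF that(3), of "1/2"] by simp
    from \<alpha>\<^sub>0(3)[OF cm cl that(1)]
    obtain x t where x: "x \<in> E" and t: "t > 0" "x / 2 + t \<in> (\<lambda>x. x / 2) ` E" "x / 2 + poly H t \<in> (\<lambda>x. x / 2) ` E"
      by blast
    have dbl: "z \<in> E" if "y \<in> (\<lambda>x. x / 2) ` E" "z = 2 * y" for y z using that by auto
    have "x + 2 * t \<in> E" by (rule dbl[OF t(2)]) simp
    moreover have "x + poly P (2 * t) \<in> E" by (rule dbl[OF t(3)]) (simp add: H)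
    ultimately show ?thesis using x t(1) by (intro exI[of _ x] exI[of _ "2 * t"]) auto
  qed
  show "\<exists>\<alpha>\<^sub>0::real. 0 < \<alpha>\<^sub>0 \<and> \<alpha>\<^sub>0 < 1 \<and>
          (\<forall>(\<alpha>::real) (E::real set) (\<mu>::real measure).
             \<alpha>\<^sub>0 < \<alpha> \<longrightarrow> \<alpha> < 1 \<longrightarrow>
             closed E \<longrightarrow> E \<subseteq> {0..1} \<longrightarrow> supports E \<mu> \<longrightarrow>
             (\<forall>x \<epsilon> :: real. 0 < \<epsilon> \<longrightarrow> \<epsilon> \<le> 1 \<longrightarrow>
                measure \<mu> {x..x + \<epsilon>} \<le> C\<^sub>1 * \<epsilon> powr \<alpha>) \<longrightarrow>
             (\<forall>k::int. k \<noteq> 0 \<longrightarrow>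
                cmod (fourier_coeff \<mu> k)
                  \<le> C\<^sub>2 * (1 - \<alpha>) powr (- B) * \<bar>of_int k\<bar> powr (- \<beta> / 2)) \<longrightarrow>
             (\<exists>x t :: real. t > 0 \<and> x \<in> E \<and> x + t \<in> E \<and> x + poly P t \<in> E))"
    by (rule exI[of _ \<alpha>\<^sub>0], intro conjI allI impI \<alpha>\<^sub>0(1,2), rule triple)
qed simp

end
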